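(* Let $\{\ell_n\}_{n\in\mathbb{N}}$ be a decreasing sequence of positive numbers with $\ell_n\in(0,1)$, and let $\{\omega_n\}_{n\in\mathbb{N}}$ be an i.i.d. sequence of random variables uniformly distributed on the circle $\mathbb{T}=\mathbb{R}/\mathbb{Z}$. Let $\mathcal{U}(\omega)$ be the associated uniform random covering set (defined in the context). 1) Let $$\delta=\liminf_{n\to\infty}\left(\frac{n\ell_n}{\ln n}\right).$$ Assume that $\delta<1$ and let $A\subset\mathbb{T}$ be a set with $\delta<\dim_{\mathrm H}A$. Then $\Pr(\omega\colon A\subset\mathcal{U}(\omega))=0$. Furthermore, the random set $A\setminus\mathcal{U}(\omega)$ of points of $A$ that are not covered by $\mathcal{U}(\omega)$ has Hausdorff dimension at least $\dim_{\mathrm H}A-\delta$ almost surely. 2) Let $A\subset\mathbb{T}$ be a set with $\overline{\dim}_{\mathrm B}A\le\beta$ (or with $N(r)\le r^{-\beta}$ for all sufficiently small $r>0$, where $N(r)$ is the number of balls of radius $r$ needed to cover $A$), and assume that for some $d\in(0,1)$ $$\sum_{n=1}^{\infty}\left(\frac{1}{\ell_n}\right)^{\beta}\exp(-n d\,\ell_n)<\infty.$$ Then $\Pr(\omega\colon A\subset\mathcal{U}(\omega))=1$.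
   Context: Put $r_n=\ell_n/2$ and, for $x\in\mathbb{T}$ and $r>0$, let $B(x,r)=(x-r,x+r)\subset\mathbb{T}$ be the open arc of center $x$ and radius $r$. For each $n\in\mathbb{N}$ let $E_n=\bigcup_{k=1}^{n}B(\omega_k,r_n)$ (all $n$ arcs have the same radius $r_n$), and define $$\mathcal{U}(\omega)=\liminf_{n\to\infty}E_n=\bigcup_{N\ge1}\bigcap_{n\ge N}E_n .$$ Thus $y\in\mathcal{U}(\omega)$ if and only if there is $N$ such that for every $n\ge N$ there exists $k\in\{1,\dots,n\}$ with $|y-\omega_k|<r_n$ (distance on $\mathbb{T}$). $\dim_{\mathrm H}$ and $\overline{\dim}_{\mathrm B}$ denote the Hausdorff dimension and the upper box-counting dimension, respectively.
   Formalization: In part 1 the set A is assumed analytic (for instance Borel). For arbitrary A the claim fails under the continuum hypothesis: with ℓ_n = c ln n / n, 0<c<1, a Sierpiński set A has dimension 1, yet A∖U(ω) is almost surely countable. *)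

theory Defs
  imports "HOL-Probability.Probability"
begin

quotient_type circle = real / "\<lambda>x y :: real. x - y \<in> \<int>"
  morphisms circle_rep to_circle
proof (rule equivpI)
  show "reflp (\<lambda>x y :: real. x - y \<in> \<int>)"
    by (simp add: reflp_def)
  show "symp (\<lambda>x y :: real. x - y \<in> \<int>)"
    by (metis (no_types, lifting) Ints_minus minus_diff_eq symp_def)
  show "transp (\<lambda>x y :: real. x - y \<in> \<int>)"
  proof (rule transpI)
    fix x y z :: real
    assume "x - y \<in> \<int>" "y - z \<in> \<int>"
    then have "(x - y) + (y - z) \<in> \<int>" by (rule Ints_add)
    then show "x - z \<in> \<int>" by simp
  qed
qed

text \<open>Distance to the nearest integer.\<close>

definition dist_int :: "real \<Rightarrow> real" where
  "dist_int t = \<bar>t - of_int (round t)\<bar>"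

lemma dist_int_le: "dist_int t \<le> \<bar>t - of_int k\<bar>"
  unfolding dist_int_def using round_diff_minimal[of t k] by simp

lemma dist_int_add_of_int [simp]: "dist_int (t + of_int k) = dist_int t"
proof (rule antisym)
  show "dist_int (t + of_int k) \<le> dist_int t"
    using dist_int_le[of "t + of_int k" "round t + k"] by (simp add: dist_int_def)
  show "dist_int t \<le> dist_int (t + of_int k)"
    using dist_int_le[of t "round (t + of_int k) - k"] by (simp add: dist_int_def algebra_simps)
qed

lemma dist_int_minus: "dist_int (- t) = dist_int t"
proof -
  have le: "dist_int (- s) \<le> dist_int s" for s
    using dist_int_le[of "- s" "- round s"] by (simp add: dist_int_def abs_minus_commute)
  show ?thesis using le[of t] le[of "- t"] by simp
qed

lemma dist_int_triangle: "dist_int (s + t) \<le> dist_int s + dist_int t"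
  using dist_int_le[of "s + t" "round s + round t"]
  by (simp add: dist_int_def)

lemma dist_int_eq_0_iff: "dist_int t = 0 \<longleftrightarrow> t \<in> \<int>"
proof
  assume "dist_int t = 0"
  then have "t = of_int (round t)" by (simp add: dist_int_def)
  then show "t \<in> \<int>" by (metis Ints_of_int)
qed (auto simp: dist_int_def elim: Ints_cases)

instantiation circle :: metric_space
begin

lift_definition dist_circle :: "circle \<Rightarrow> circle \<Rightarrow> real" is "\<lambda>x y. dist_int (x - y)"
proof -
  fix a b c d :: real
  assume "a - b \<in> \<int>" "c - d \<in> \<int>"
  then obtain i j where "a - b = of_int i" "c - d = of_int j"
    by (auto elim!: Ints_cases)
  then have "a - c = (b - d) + of_int (i - j)" by simp
  then show "dist_int (a - c) = dist_int (b - d)" by (simp only: dist_int_add_of_int)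
qed

definition uniformity_circle :: "(circle \<times> circle) filter" where
  "uniformity_circle = (INF e\<in>{0<..}. principal {(x, y). dist x y < e})"

definition open_circle :: "circle set \<Rightarrow> bool" where
  "open_circle U \<longleftrightarrow> (\<forall>x\<in>U. eventually (\<lambda>(x', y). x' = x \<longrightarrow> y \<in> U) uniformity)"

instance
proof
  show "uniformity = (INF e\<in>{0<..}. principal {(x :: circle, y). dist x y < e})"
    by (rule uniformity_circle_def)
  show "open U \<longleftrightarrow> (\<forall>x\<in>U. eventually (\<lambda>(x', y). x' = x \<longrightarrow> y \<in> U) uniformity)" for U :: "circle set"
    by (rule open_circle_def)
  show "dist x y = 0 \<longleftrightarrow> x = y" for x y :: circle
    by transfer (simp add: dist_int_eq_0_iff)
  show "dist x y \<le> dist x z + dist y z" for x y z :: circle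
  proof transfer
    fix x y z :: real
    show "dist_int (x - y) \<le> dist_int (x - z) + dist_int (y - z)"
      using dist_int_triangle[of "x - z" "- (y - z)"] by (simp only: dist_int_minus) simp
  qed
qed

end

lemma dist_to_circle: "dist (to_circle x) (to_circle y) = dist_int (x - y)"
  by transfer simp

lemma continuous_on_to_circle: "continuous_on S to_circle"
proof (rule continuous_onI)
  fix x e :: real assume "0 < e"
  have "dist (to_circle y) (to_circle x) \<le> dist y x" for y
    using dist_int_le[of "y - x" 0] by (simp add: dist_to_circle dist_real_def)
  then show "\<exists>d>0. \<forall>y\<in>S. dist y x < d \<longrightarrow> dist (to_circle y) (to_circle x) \<le> e"
    using \<open>0 < e\<close> by (meson less_imp_le order.trans)
qed

lemma measurable_to_circle [measurable]: "to_circle \<in> borel_measurable borel"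
  by (intro borel_measurable_continuous_onI continuous_on_to_circle)

definition circle_uniform :: "circle measure" where
  "circle_uniform = distr (uniform_measure lborel {0..<1}) borel to_circle"

definition hausdorff_content :: "real \<Rightarrow> real \<Rightarrow> 'a::metric_space set \<Rightarrow> ennreal" where
  "hausdorff_content s \<rho> A =
     (INF U\<in>{U :: nat \<Rightarrow> 'a set. A \<subseteq> (\<Union>i. U i) \<and> (\<forall>i. bounded (U i) \<and> diameter (U i) \<le> \<rho>)}.
        \<Sum>i. ennreal (diameter (U i) powr s))"

definition hausdorff_measure :: "real \<Rightarrow> 'a::metric_space set \<Rightarrow> ennreal" where
  "hausdorff_measure s A = (SUP \<rho>\<in>{0<..}. hausdorff_content s \<rho> A)"

text \<open>
  Only exponents \<open>s > 0\<close> are used: \<open>0 powr 0 = 0\<close> would give singletons \<open>0\<close>-dimensional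
  measure \<open>0\<close>. Dropping \<open>s = 0\<close> does not change the infimum. The empty set has dimension \<open>0\<close>.
\<close>

definition hausdorff_dim :: "'a::metric_space set \<Rightarrow> ereal" where
  "hausdorff_dim A = (INF s\<in>{s. 0 < s \<and> hausdorff_measure s A = 0}. ereal s)"

text \<open>
  The circle is totally bounded, so for \<open>r > 0\<close> the infimum below is over a nonempty set.
\<close>

definition covering_number :: "circle set \<Rightarrow> real \<Rightarrow> nat" where
  "covering_number A r = Inf {card C | C. finite C \<and> A \<subseteq> (\<Union>c\<in>C. ball c r)}"

text \<open>
  With \<open>ln 0 = 0\<close> the empty set has upper box dimension \<open>0\<close>.
\<close>

definition upper_box_dim :: "circle set \<Rightarrow> ereal" where
  "upper_box_dim A =
     Limsup (at_right 0) (\<lambda>r. ereal (ln (real (covering_number A r)) / ln (1 / r)))"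

text \<open>
  Analytic (Suslin) sets: the empty set and the continuous images of Baire space. In a Polish
  space such as the circle these include all Borel sets.
\<close>

definition analytic_set :: "'a::topological_space set \<Rightarrow> bool" where
  "analytic_set A \<longleftrightarrow>
     A = {} \<or> (\<exists>f :: (nat \<Rightarrow> nat) \<Rightarrow> 'a. continuous_on UNIV f \<and> range f = A)"

text \<open>
  Sequences are indexed from \<open>1\<close>; the values of \<open>l\<close> and \<open>\<omega>\<close> at \<open>0\<close> are never used.
  The open arc \<open>B(x, r)\<close> is the metric ball of the circle.
\<close>

definition arcs_union :: "(nat \<Rightarrow> real) \<Rightarrow> (nat \<Rightarrow> circle) \<Rightarrow> nat \<Rightarrow> circle set" where
  "arcs_union l \<omega> n = (\<Union>k\<in>{1..n}. ball (\<omega> k) (l n / 2))"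

definition uniform_cover :: "(nat \<Rightarrow> real) \<Rightarrow> (nat \<Rightarrow> circle) \<Rightarrow> circle set" where
  "uniform_cover l \<omega> = (\<Union>N\<in>{1..}. \<Inter>n\<in>{N..}. arcs_union l \<omega> n)"

end

theory Submission
  imports Defs "HOL-Real_Asymp.Real_Asymp"
begin

text \<open>
  Part 1. The net content of dyadic arcs is continuous from below along arbitrary increasing
  sequences, so an analytic set \<open>A\<close> of dimension larger than \<open>s\<close> contains a compact set \<open>K\<close> of positive
  content, which carries a measure \<open>\<mu>\<close> with \<open>\<mu> (ball x r)\<close> of order at most \<open>r\<^sup>s\<close>. Along a sparse sequence of
  times \<open>N j\<close> with \<open>N j * l (N j) \<le> a * ln (N j)\<close>, where \<open>\<delta> < a < b\<close>, give all centres
  with index in the block \<open>{N (j - 1)<..N j}\<close> the radius \<open>l (N j) / 2\<close>. A point avoiding all these arcs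
  lies in none of the sets \<open>arcs_union l \<omega> (N j)\<close>, hence not in the uniform cover. Two points at distance
  \<open>d\<close> both avoid the first \<open>n\<close> arcs with probability at most \<open>d powr - b\<close> times the product of the
  single-point probabilities. The second moment method therefore yields, for each \<open>n\<close> and with probability
  close to 1, a measure on the uncovered part of \<open>K\<close> with bounded mass and bounded energy of order
  \<open>t < s - b\<close>, hence a lower bound on \<open>t\<close>-dimensional content which passes to the compact limit.

  Part 2. At time \<open>n\<close>, cover \<open>A\<close> by arcs of radius \<open>\<kappa> * l n / 2\<close> and ask that each of their
  centres is within \<open>(1 - \<kappa>) * l n / 2\<close> of some \<open>\<omega> k\<close>. Choosing \<open>1 - \<kappa>\<close> slightly larger than
  \<open>d\<close> absorbs the loss in the exponent \<open>\<beta>\<close>, and Borel-Cantelli applies.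
\<close>

section \<open>The circle\<close>

text \<open>Sparse times are forced by the interaction of the blocks: two points at distance d are
  correlated through every arc longer than d, so the product over all earlier blocks multiplies that
  of a new one. The earlier product is a constant when the next time is chosen, and the gap between
  \<open>a\<close> and \<open>b\<close> leaves a power of that time to absorb it.

  All arcs are also kept shorter than 2^(-j). Points at distance at least 2^(-j) are then not
  positively correlated, so the variance of the random mass comes from closer pairs and tends to 0
  with j. This makes the success probability close to 1, not merely positive, without a zero-one
  law. The random measures for different n need not converge: content bounds at infinitely many n
  suffice, because the uncovered compact sets decrease.

  Net content is used because dyadic cells are nested or disjoint: two covers merge into their
  maximal cells without paying twice for the common part. This gives continuity from below for sets
  that need not be measurable.\<close>

lemma dist_int_le_half: "dist_int t \<le> 1/2"
  unfolding dist_int_def using of_int_round_abs_le[of t] by (simp add: abs_minus_commute)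

lemma dist_int_eq_abs: "\<bar>t\<bar> \<le> 1/2 \<Longrightarrow> dist_int t = \<bar>t\<bar>"
proof (rule antisym)
  assume t: "\<bar>t\<bar> \<le> 1/2"
  show "dist_int t \<le> \<bar>t\<bar>" using dist_int_le[of t 0] by simp
  show "\<bar>t\<bar> \<le> dist_int t"
  proof (cases "round t = 0")
    case False
    then have "\<bar>real_of_int (round t)\<bar> \<ge> 1" by linarith
    then show ?thesis using t unfolding dist_int_def by linarith
  qed (simp add: dist_int_def)
qed

lemma circle_dist_le_half: "dist (x::circle) y \<le> 1/2"
  by transfer (rule dist_int_le_half)

lemma diameter_le_dist:
  fixes S :: "'a::metric_space set"
  assumes "0 \<le> r" "\<And>x y. x \<in> S \<Longrightarrow> y \<in> S \<Longrightarrow> dist x y \<le> r"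
  shows "diameter S \<le> r"
  unfolding diameter_def using assms by (auto intro!: cSUP_least)

lemma circle_bounded: "bounded (S :: circle set)"
  unfolding bounded_def using circle_dist_le_half by blast

lemma to_circle_eq_iff: "to_circle a = to_circle b \<longleftrightarrow> a - b \<in> \<int>"
  by transfer simp

lemma to_circle_add_of_int: "to_circle (a + of_int k) = to_circle a"
  by (simp add: to_circle_eq_iff)

lemma to_circle_rep: "to_circle (circle_rep x) = x"
  by (simp add: Quotient3_abs_rep[OF Quotient3_circle])

text \<open>Representatives are taken in (0,1], so that dyadic cells are open on the left and closed
  on the right, the shape of the intervals whose mass \<open>interval_measure\<close>
  prescribes.\<close>

definition arc_rep :: "circle \<Rightarrow> real" where
  "arc_rep x = circle_rep x - of_int \<lceil>circle_rep x\<rceil> + 1"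

lemma arc_rep_pos: "0 < arc_rep x"
  unfolding arc_rep_def by linarith

lemma arc_rep_le_1: "arc_rep x \<le> 1"
  unfolding arc_rep_def by linarith

lemma to_circle_arc_rep: "to_circle (arc_rep x) = x"
  using to_circle_add_of_int[of "circle_rep x" "1 - \<lceil>circle_rep x\<rceil>"]
  by (simp add: arc_rep_def to_circle_rep algebra_simps)

lemma arc_rep_to_circle:
  assumes "0 < a" "a \<le> 1" shows "arc_rep (to_circle a) = a"
proof -
  have "arc_rep (to_circle a) - a \<in> \<int>"
    using to_circle_arc_rep[of "to_circle a"] by (simp add: to_circle_eq_iff)
  then obtain k where k: "arc_rep (to_circle a) - a = of_int k" by (auto elim: Ints_cases)
  have "-1 < real_of_int k" "real_of_int k < 1"
    using k assms arc_rep_pos[of "to_circle a"] arc_rep_le_1[of "to_circle a"] by linarith+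
  then have "k = 0" by linarith
  with k show ?thesis by simp
qed

lemma compact_UNIV_circle: "compact (UNIV :: circle set)"
proof -
  have "to_circle ` {0..1} = UNIV"
    using to_circle_arc_rep arc_rep_pos arc_rep_le_1
    by (metis (no_types, lifting) UNIV_eq_I atLeastAtMost_iff image_eqI less_imp_le)
  then show ?thesis
    using compact_continuous_image[OF continuous_on_to_circle compact_Icc[of "0::real" 1]] by simp
qed

text \<open>With a countable base the distance is measurable for the product of two Borel
  sigma-algebras. The kernels, the random uncovered sets and the uses of Fubini rely on
  this.\<close>

instance circle :: second_countable_topology
proof
  define B :: "circle set set" where "B = (\<lambda>(q, n). ball (to_circle q) (inverse (Suc n))) ` (\<rat> \<times> UNIV)"
  have "countable B" unfolding B_def by (intro countable_image countable_SIGMA countable_rat) simp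
  moreover have "topological_basis B"
  proof (rule topological_basisI)
    fix U :: "circle set" and x assume "open U" "x \<in> U"
    then obtain e where e: "e > 0" "ball x e \<subseteq> U" using open_contains_ball by blast
    obtain n where n: "inverse (real (Suc n)) < e / 2" using reals_Archimedean[of "e/2"] e by auto
    obtain q where q: "q \<in> \<rat>" "arc_rep x < q" "q < arc_rep x + inverse (Suc n)"
      using Rats_dense_in_real[of "arc_rep x" "arc_rep x + inverse (Suc n)"] by auto
    have "dist (to_circle q) x < inverse (Suc n)"
      using dist_int_le[of "q - arc_rep x" 0] q dist_to_circle[of q "arc_rep x"]
      by (simp add: to_circle_arc_rep)
    moreover have "ball (to_circle q) (inverse (Suc n)) \<subseteq> U"
    proof
      fix y assume "y \<in> ball (to_circle q) (inverse (Suc n))"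
      then have "dist x y < e"
        using n calculation dist_triangle[of x y "to_circle q"] by (simp add: dist_commute)
      then show "y \<in> U" using e by auto
    qed
    ultimately show "\<exists>B'\<in>B. x \<in> B' \<and> B' \<subseteq> U"
      using q unfolding B_def by (intro bexI[of _ "ball (to_circle q) (inverse (Suc n))"]) auto
  qed (auto simp: B_def)
  ultimately show "\<exists>B::circle set set. countable B \<and> open = generate_topology B"
    using topological_basis_imp_subbasis by blast
qed

text \<open>A ball around a point near 0 wraps around in [0,1). Periodicity lets the window be
  centred at the ball instead: it is cut at the next integer and the two pieces are shifted by
  different integers.\<close>

lemma emeasure_lborel_period:
  fixes P :: "real set"
  assumes P[measurable]: "P \<in> sets borel" and per: "\<And>x. x + 1 \<in> P \<longleftrightarrow> x \<in> P"
  shows "emeasure lborel (P \<inter> {c..<c+1}) = emeasure lborel (P \<inter> {0..<1})"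
proof -
  have pern: "x + real n \<in> P \<longleftrightarrow> x \<in> P" for x and n :: nat
  proof (induction n)
    case (Suc n)
    then show ?case using per[of "x + real n"] by (simp add: algebra_simps)
  qed simp
  have per_int: "x + of_int m \<in> P \<longleftrightarrow> x \<in> P" for x and m :: int
  proof (cases "m \<ge> 0")
    case True then show ?thesis using pern[of x "nat m"] by simp
  next
    case False then show ?thesis using pern[of "x + of_int m" "nat (-m)"] by simp
  qed
  have shift: "emeasure lborel S = emeasure lborel ((+) k -` S)" if "S \<in> sets borel" for S and k :: real
    using emeasure_distr[of "(+) k" lborel borel S] that by (simp add: lborel_distr_plus)
  define m where "m = \<lfloor>c\<rfloor>"
  define \<theta> where "\<theta> = c - of_int m"
  have \<theta>: "0 \<le> \<theta>" "\<theta> < 1" unfolding \<theta>_def m_def by linarith+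
  have c: "c = of_int m + \<theta>" by (simp add: \<theta>_def)
  have "emeasure lborel (P \<inter> {c..<c+1})
      = emeasure lborel ((P \<inter> {c..<of_int m + 1}) \<union> (P \<inter> {of_int m + 1..<c+1}))"
    using \<theta> c by (intro arg_cong[where f="emeasure lborel"]) auto
  also have "\<dots> = emeasure lborel (P \<inter> {c..<of_int m + 1}) + emeasure lborel (P \<inter> {of_int m + 1..<c+1})"
    by (intro plus_emeasure[symmetric]) auto
  also have "emeasure lborel (P \<inter> {c..<of_int m + 1}) = emeasure lborel (P \<inter> {\<theta>..<1})"
  proof -
    have "(+) (of_int m) -` (P \<inter> {c..<of_int m + 1}) = P \<inter> {\<theta>..<1}"
      unfolding set_eq_iff
    proof (intro allI)
      fix x
      have "of_int m + x \<in> P \<longleftrightarrow> x \<in> P" using per_int[of x m] by (simp only: add.commute)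
      then show "x \<in> (+) (of_int m) -` (P \<inter> {c..<of_int m + 1}) \<longleftrightarrow> x \<in> P \<inter> {\<theta>..<1}"
        unfolding c by simp
    qed
    then show ?thesis using shift[of "P \<inter> {c..<of_int m + 1}" "of_int m"] by simp
  qed
  also have "emeasure lborel (P \<inter> {of_int m + 1..<c+1}) = emeasure lborel (P \<inter> {0..<\<theta>})"
  proof -
    have "(+) (of_int m + 1) -` (P \<inter> {of_int m + 1..<c+1}) = P \<inter> {0..<\<theta>}"
      unfolding set_eq_iff
    proof (intro allI)
      fix x
      have "of_int m + 1 + x \<in> P \<longleftrightarrow> x \<in> P"
        using per_int[of x "m + 1"] by (simp only: add.commute of_int_add of_int_1)
      then show "x \<in> (+) (of_int m + 1) -` (P \<inter> {of_int m + 1..<c+1}) \<longleftrightarrow> x \<in> P \<inter> {0..<\<theta>}"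
        unfolding c by simp
    qed
    then show ?thesis using shift[of "P \<inter> {of_int m + 1..<c+1}" "of_int m + 1"] by simp
  qed
  also have "emeasure lborel (P \<inter> {\<theta>..<1}) + emeasure lborel (P \<inter> {0..<\<theta>})
      = emeasure lborel ((P \<inter> {\<theta>..<1}) \<union> (P \<inter> {0..<\<theta>}))"
    by (intro plus_emeasure) auto
  also have "(P \<inter> {\<theta>..<1}) \<union> (P \<inter> {0..<\<theta>}) = P \<inter> {0..<1}"
    using \<theta> by auto
  finally show ?thesis .
qed

lemma prob_space_circle_uniform: "prob_space circle_uniform"
  unfolding circle_uniform_def
  by (intro prob_space.prob_space_distr prob_space_uniform_measure) auto

lemma sets_circle_uniform [simp, measurable_cong]: "sets circle_uniform = sets borel"
  by (simp add: circle_uniform_def)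

lemma measure_circle_uniform_ball:
  assumes r: "0 \<le> r" "r \<le> 1/2"
  shows "measure circle_uniform (ball x r) = 2 * r"
proof -
  define a where "a = arc_rep x"
  define P where "P = to_circle -` ball x r"
  have P[measurable]: "P \<in> sets borel"
    unfolding P_def using measurable_sets[OF measurable_to_circle, of "ball x r"] by simp
  have "emeasure circle_uniform (ball x r) = emeasure (uniform_measure lborel {0..<1}) P"
    unfolding circle_uniform_def P_def by (subst emeasure_distr) auto
  also have "\<dots> = emeasure lborel (P \<inter> {0..<1})"
    by (simp add: divide_ennreal_def Int_commute)
  also have "\<dots> = emeasure lborel (P \<inter> {a - 1/2..<a - 1/2 + 1})"
    using to_circle_add_of_int[of _ 1] by (intro emeasure_lborel_period[symmetric] P) (simp add: P_def)
  also have "P \<inter> {a - 1/2..<a - 1/2 + 1} = {a - r<..<a + r}"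
  proof (intro set_eqI)
    fix u
    have d: "dist x (to_circle u) = dist_int (a - u)"
      unfolding a_def using dist_to_circle[of "arc_rep x" u] by (simp add: to_circle_arc_rep)
    show "u \<in> P \<inter> {a - 1/2..<a - 1/2 + 1} \<longleftrightarrow> u \<in> {a - r<..<a + r}"
    proof (cases "\<bar>a - u\<bar> \<le> 1/2")
      case True
      then show ?thesis using r unfolding P_def
        by (auto simp: d dist_int_eq_abs abs_less_iff)
    next
      case False
      then show ?thesis using r by (auto simp: abs_if split: if_splits)
    qed
  qed
  also have "emeasure lborel {a - r<..<a + r} = ennreal (2 * r)"
    using r by simp
  finally show ?thesis using r by (simp add: measure_def)
qed

section \<open>Net content on dyadic arcs\<close>

definition addr :: "nat \<Rightarrow> circle \<Rightarrow> nat" where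
  "addr k x = nat (\<lceil>2 ^ k * arc_rep x\<rceil> - 1)"

text \<open>The pair consists of a level and a position. Positions from \<open>2 ^ k\<close> on give
  empty cells, so a family of cells may have empty members.\<close>

definition cell :: "nat \<times> nat \<Rightarrow> circle set" where
  "cell p = {x. addr (fst p) x = snd p}"

lemma addr_iff: "addr k x = i \<longleftrightarrow> real i < 2 ^ k * arc_rep x \<and> 2 ^ k * arc_rep x \<le> real i + 1"
proof -
  have "0 < 2 ^ k * arc_rep x" using arc_rep_pos by simp
  then have "\<lceil>2 ^ k * arc_rep x\<rceil> \<ge> 1" by (simp add: le_ceiling_iff)
  then have "addr k x = i \<longleftrightarrow> \<lceil>2 ^ k * arc_rep x\<rceil> = int i + 1" unfolding addr_def by linarith
  then show ?thesis by (simp add: ceiling_eq_iff)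
qed

lemma addr_bounds: "real (addr k x) < 2 ^ k * arc_rep x" "2 ^ k * arc_rep x \<le> real (addr k x) + 1"
  using addr_iff[of k x "addr k x"] by simp_all

lemma addr_Suc: "addr (Suc k) x div 2 = addr k x"
proof -
  define j where "j = addr (Suc k) x div 2"
  have "addr (Suc k) x = 2 * j \<or> addr (Suc k) x = 2 * j + 1" unfolding j_def by linarith
  then have "addr k x = j"
    using addr_bounds[of "Suc k" x] unfolding addr_iff[of k x j] by auto
  then show ?thesis by (simp add: j_def)
qed

lemma addr_mono:
  assumes "j \<le> k" "addr k x = addr k y" shows "addr j x = addr j y"
  using assms
proof (induction rule: inc_induct)
  case (step n)
  then show ?case using addr_Suc[of n] by metis
qed

lemma cell_split: "cell (k, i) = cell (Suc k, 2 * i) \<union> cell (Suc k, 2 * i + 1)"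
proof (intro set_eqI)
  fix x
  have "addr k x = i \<longleftrightarrow> addr (Suc k) x = 2 * i \<or> addr (Suc k) x = 2 * i + 1"
    using addr_Suc[of k x] by linarith
  then show "x \<in> cell (k, i) \<longleftrightarrow> x \<in> cell (Suc k, 2 * i) \<union> cell (Suc k, 2 * i + 1)"
    by (simp add: cell_def)
qed

lemma cell_0_0: "cell (0, 0) = UNIV"
  using arc_rep_pos arc_rep_le_1 by (auto simp: cell_def addr_iff)

lemma cell_subset_ball:
  assumes "y \<in> cell (k, i)" shows "cell (k, i) \<subseteq> ball y ((1/2) ^ k)"
proof
  fix x assume "x \<in> cell (k, i)"
  then have "\<bar>2 ^ k * arc_rep y - 2 ^ k * arc_rep x\<bar> < 1"
    using assms unfolding cell_def by (auto simp: addr_iff)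
  then have "2 ^ k * \<bar>arc_rep y - arc_rep x\<bar> < 1"
    by (simp add: abs_mult flip: right_diff_distrib)
  then have "\<bar>arc_rep y - arc_rep x\<bar> < (1/2) ^ k" by (simp add: field_simps)
  then show "x \<in> ball y ((1/2) ^ k)"
    using dist_to_circle[of "arc_rep y" "arc_rep x"] dist_int_le[of "arc_rep y - arc_rep x" 0]
    by (simp add: to_circle_arc_rep)
qed

text \<open>Two representatives in (0,1] are compared after a shift by -1, 0 or 1, and then their
  ceilings at level k differ by at most 1. The resulting 3 * 3 cells are more than necessary; only
  the boundedness of their number matters.\<close>

lemma ball_subset_cells:
  "\<exists>N. finite N \<and> card N \<le> 9 \<and> N \<subseteq> {k} \<times> UNIV \<and> ball y ((1/2) ^ k) \<subseteq> (\<Union>p\<in>N. cell p)"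
proof -
  define a where "a = arc_rep y"
  define h where "h = (\<lambda>(z, j). (k, nat (\<lceil>2 ^ k * (a - real_of_int z)\<rceil> - 1 + j)))"
  define N where "N = h ` ({-1, 0, 1} \<times> {-1, 0, 1})"
  have "card N \<le> card ({-1, 0, 1::int} \<times> {-1, 0, 1::int})"
    unfolding N_def by (rule card_image_le) simp
  moreover have "ball y ((1/2) ^ k) \<subseteq> (\<Union>p\<in>N. cell p)"
  proof
    fix x assume x: "x \<in> ball y ((1/2) ^ k)"
    define z where "z = round (a - arc_rep x)"
    have "dist y x = dist_int (a - arc_rep x)"
      using dist_to_circle[of a "arc_rep x"] by (simp add: a_def to_circle_arc_rep)
    with x have "\<bar>a - arc_rep x - of_int z\<bar> < (1/2) ^ k" by (simp add: dist_int_def z_def)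
    then have "2 ^ k * \<bar>a - of_int z - arc_rep x\<bar> < 1" by (simp add: field_simps)
    then have "\<bar>2 ^ k * (a - of_int z) - 2 ^ k * arc_rep x\<bar> < 1"
      by (simp add: abs_mult flip: right_diff_distrib)
    then have ce: "\<lceil>2 ^ k * arc_rep x\<rceil> - \<lceil>2 ^ k * (a - of_int z)\<rceil> \<in> {-1, 0, 1}"
      unfolding insert_iff empty_iff by linarith
    have z: "z \<in> {-1, 0, 1}"
      using arc_rep_pos[of y] arc_rep_le_1[of y] arc_rep_pos[of x] arc_rep_le_1[of x]
      unfolding z_def a_def round_def insert_iff empty_iff by linarith
    define j where "j = \<lceil>2 ^ k * arc_rep x\<rceil> - \<lceil>2 ^ k * (a - of_int z)\<rceil>"
    have "h (z, j) = (k, addr k x)"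
      unfolding h_def j_def addr_def by simp
    then have "(k, addr k x) \<in> N" unfolding N_def using z ce
      by (metis SigmaI image_eqI j_def)
    then show "x \<in> (\<Union>p\<in>N. cell p)" by (force simp: cell_def)
  qed
  moreover have "finite N" unfolding N_def by simp
  moreover have "card ({-1, 0, 1::int} \<times> {-1, 0, 1::int}) = 9" by simp
  moreover have "N \<subseteq> {k} \<times> UNIV" unfolding N_def h_def by auto
  ultimately show ?thesis by metis
qed

section \<open>Cost of families of cells and net content\<close>

definition wt :: "real \<Rightarrow> nat \<Rightarrow> real" where
  "wt s k = 2 powr (- s * real k)"

text \<open>Written as a measure on the countable set of all cells, so that modularity, countable
  subadditivity and continuity along increasing families are those of
  \<open>emeasure\<close>.\<close>

definition cost :: "real \<Rightarrow> (nat \<times> nat) set \<Rightarrow> ennreal" where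
  "cost s = emeasure (density (count_space UNIV) (\<lambda>p. ennreal (wt s (fst p))))"

text \<open>There is no bound on the size of the cells. The content is therefore at most 1 and can
  be cancelled in inequalities, yet its vanishing still implies that the Hausdorff measure
  vanishes.\<close>

definition net_content :: "real \<Rightarrow> circle set \<Rightarrow> ennreal" where
  "net_content s E = (INF S\<in>{S. E \<subseteq> (\<Union>p\<in>S. cell p)}. cost s S)"

lemma half_power_powr: "((1/2) ^ k) powr s = wt s k"
  by (simp add: wt_def powr_powr mult.commute power_divide powr_minus inverse_eq_divide
      powr_divide flip: powr_realpow)

lemma wt_pos: "wt s k > 0"
  by (simp add: wt_def)

lemma cost_suminf:
  "cost s S = (\<Sum>n. ennreal (wt s (fst (prod_decode n))) * indicator S (prod_decode n))"
proof -
  have "cost s S = (\<integral>\<^sup>+p. ennreal (wt s (fst p)) * indicator S p \<partial>count_space UNIV)"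
    unfolding cost_def by (subst emeasure_density) auto
  also have "\<dots> = (\<integral>\<^sup>+n. ennreal (wt s (fst (prod_decode n))) * indicator S (prod_decode n) \<partial>count_space UNIV)"
    by (rule nn_integral_bij_count_space[OF bij_prod_decode, symmetric])
  finally show ?thesis by (simp add: nn_integral_count_space_nat)
qed

lemma cost_mono: "S \<subseteq> T \<Longrightarrow> cost s S \<le> cost s T"
  unfolding cost_def by (intro emeasure_mono) auto

lemma cost_Un_Int: "cost s S + cost s T = cost s (S \<union> T) + cost s (S \<inter> T)"
  unfolding cost_def by (intro emeasure_Un_Int) auto

lemma cost_Un: "cost s (S \<union> T) \<le> cost s S + cost s T"
  using cost_Un_Int[of s S T] by simp

lemma cost_UN_le: "cost s (\<Union>n. S n) \<le> (\<Sum>n. cost s (S n))"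
  unfolding cost_def by (intro emeasure_subadditive_countably) auto

lemma cost_finite:
  assumes "finite N" "N \<subseteq> {k} \<times> UNIV"
  shows "cost s N = ennreal (real (card N) * wt s k)"
proof -
  have "cost s N = (\<integral>\<^sup>+p. ennreal (wt s (fst p)) * indicator N p \<partial>count_space UNIV)"
    unfolding cost_def by (subst emeasure_density) auto
  also have "\<dots> = (\<integral>\<^sup>+p. ennreal (wt s k) * indicator N p \<partial>count_space UNIV)"
    using assms by (intro nn_integral_cong) (auto simp: indicator_def split: if_splits)
  also have "\<dots> = ennreal (wt s k) * ennreal (real (card N))"
    using assms by (simp add: nn_integral_cmult_indicator ennreal_of_nat_eq_real_of_nat)
  finally show ?thesis by (simp add: ennreal_mult mult.commute wt_def)
qed

lemma cost_singleton: "cost s {p} = ennreal (wt s (fst p))"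
  using cost_finite[of "{p}" "fst p" s] by (cases p) auto

lemma net_content_le: "E \<subseteq> (\<Union>p\<in>S. cell p) \<Longrightarrow> net_content s E \<le> cost s S"
  unfolding net_content_def by (intro INF_lower) simp

lemma net_content_cell: "net_content s (E \<inter> cell p) \<le> ennreal (wt s (fst p))"
  using net_content_le[of "E \<inter> cell p" "{p}" s] by (simp add: cost_singleton)

lemma net_content_le_1: "net_content s E \<le> 1"
  using net_content_cell[of s E "(0,0)"] by (simp add: cell_0_0 wt_def)

lemma net_content_less_top: "net_content s E < top"
  using net_content_le_1[of s E] by (meson ennreal_one_less_top order.strict_trans1)

lemma net_content_approx:
  assumes "0 < e" obtains S where "E \<subseteq> (\<Union>p\<in>S. cell p)" "cost s S \<le> net_content s E + ennreal e"
proof -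
  have "net_content s E < net_content s E + ennreal e"
    using assms net_content_less_top[of s E] by (simp add: ennreal_add_left_cancel_less[of _ 0, simplified])
  then have "\<exists>S\<in>{S. E \<subseteq> (\<Union>p\<in>S. cell p)}. cost s S < net_content s E + ennreal e"
    unfolding net_content_def[of s E] INF_less_iff by blast
  then show ?thesis using that by force
qed

lemma net_content_Un: "net_content s (E \<union> F) \<le> net_content s E + net_content s F"
proof (rule ennreal_le_epsilon)
  fix e :: real assume e: "0 < e"
  obtain S where S: "E \<subseteq> (\<Union>p\<in>S. cell p)" "cost s S \<le> net_content s E + ennreal (e/2)"
    by (rule net_content_approx[of "e/2" E s]) (use e in auto)
  obtain T where T: "F \<subseteq> (\<Union>p\<in>T. cell p)" "cost s T \<le> net_content s F + ennreal (e/2)"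
    by (rule net_content_approx[of "e/2" F s]) (use e in auto)
  have "net_content s (E \<union> F) \<le> cost s (S \<union> T)"
    using S T by (intro net_content_le) auto
  also have "\<dots> \<le> cost s S + cost s T" by (rule cost_Un)
  also have "\<dots> \<le> (net_content s E + ennreal (e/2)) + (net_content s F + ennreal (e/2))"
    using S T by (intro add_mono)
  also have "\<dots> = net_content s E + net_content s F + (ennreal (e/2) + ennreal (e/2))"
    by (simp add: ac_simps)
  also have "ennreal (e/2) + ennreal (e/2) = ennreal e"
    using e by (simp flip: ennreal_plus)
  finally show "net_content s (E \<union> F) \<le> net_content s E + net_content s F + ennreal e" .
qed

text \<open>The maximal cells of a family: cells are nested or disjoint, so these cover as much as
  the whole family. A cell once discarded stays discarded when the family grows, which is what the
  passage to infinite unions uses.\<close>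

definition tops :: "(nat \<times> nat) set \<Rightarrow> (nat \<times> nat) set" where
  "tops S = {p\<in>S. \<forall>q\<in>S. fst q < fst p \<longrightarrow> \<not> cell p \<subseteq> cell q}"

lemma tops_cover: "(\<Union>p\<in>tops S. cell p) = (\<Union>p\<in>S. cell p)"
proof
  show "(\<Union>p\<in>S. cell p) \<subseteq> (\<Union>p\<in>tops S. cell p)"
  proof
    fix x assume "x \<in> (\<Union>p\<in>S. cell p)"
    then have ex: "\<exists>k. (k, addr k x) \<in> S" by (auto simp: cell_def)
    define k where "k = (LEAST k. (k, addr k x) \<in> S)"
    have k: "(k, addr k x) \<in> S" unfolding k_def using ex by (rule LeastI_ex)
    have "(k, addr k x) \<in> tops S" unfolding tops_def
    proof (intro CollectI conjI k ballI impI notI)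
      fix q assume q: "q \<in> S" "fst q < fst (k, addr k x)" "cell (k, addr k x) \<subseteq> cell q"
      have "x \<in> cell (k, addr k x)" by (simp add: cell_def)
      with q have "q = (fst q, addr (fst q) x)" by (auto simp: cell_def)
      with q show False unfolding k_def using not_less_Least by (metis fst_conv)
    qed
    then show "x \<in> (\<Union>p\<in>tops S. cell p)" by (force simp: cell_def)
  qed
qed (auto simp: tops_def)

lemma tops_mono: "S \<subseteq> T \<Longrightarrow> tops T \<inter> S \<subseteq> tops S"
  unfolding tops_def by auto

text \<open>
  Strong subadditivity: the cells discarded when passing to the maximal ones of two covers still cover
  everything that both of them cover.
\<close>

lemma cost_tops_Un:
  assumes P: "E \<subseteq> (\<Union>p\<in>P. cell p)" and U: "E \<subseteq> (\<Union>p\<in>U. cell p)"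
  shows "cost s (tops (P \<union> U)) + net_content s E \<le> cost s (tops P) + cost s U"
proof -
  define R where "R = (tops P \<inter> U) \<union> ((tops P \<union> U) - tops (P \<union> U))"
  have sub: "tops (P \<union> U) \<subseteq> tops P \<union> U" unfolding tops_def by auto
  have "E \<subseteq> (\<Union>p\<in>R. cell p)"
  proof
    fix x assume x: "x \<in> E"
    from x P obtain k where k: "(k, addr k x) \<in> tops P" using tops_cover[of P] by (force simp: cell_def)
    from x U obtain j where j: "(j, addr j x) \<in> U" by (force simp: cell_def)
    have nest: "cell (b, addr b x) \<subseteq> cell (a, addr a x)" if "a \<le> b" for a b
      by (auto simp: cell_def intro: addr_mono[OF that])
    have k': "(k, addr k x) \<in> P" using k by (simp add: tops_def)
    consider "j = k" | "j < k" | "k < j" by linarith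
    \<comment> \<open>Of the two cells around \<open>x\<close> the finer one is discarded, since it
      lies in the coarser one. If the levels agree, the cell belongs to both families.\<close>
    then have "(k, addr k x) \<in> R \<or> (j, addr j x) \<in> R"
    proof cases
      case 1 then show ?thesis using k j by (simp add: R_def)
    next
      case 2
      then have "(k, addr k x) \<notin> tops (P \<union> U)" using j nest[of j k] unfolding tops_def by force
      then show ?thesis using k by (simp add: R_def)
    next
      case 3
      then have "(j, addr j x) \<notin> tops (P \<union> U)" using k' nest[of k j] unfolding tops_def by force
      then show ?thesis using j by (simp add: R_def)
    qed
    then show "x \<in> (\<Union>p\<in>R. cell p)" by (force simp: cell_def)
  qed
  then have "net_content s E \<le> cost s R" by (rule net_content_le)
  also have "cost s R \<le> cost s (tops P \<inter> U) + cost s ((tops P \<union> U) - tops (P \<union> U))"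
    unfolding R_def by (rule cost_Un)
  finally have "cost s (tops (P \<union> U)) + net_content s E
     \<le> cost s (tops P \<inter> U) + (cost s (tops (P \<union> U)) + cost s ((tops P \<union> U) - tops (P \<union> U)))"
    by (metis (no_types, lifting) add.assoc add.commute add_left_mono)
  also have "cost s (tops (P \<union> U)) + cost s ((tops P \<union> U) - tops (P \<union> U)) = cost s (tops P \<union> U)"
    using sub cost_Un_Int[of s "tops (P \<union> U)" "(tops P \<union> U) - tops (P \<union> U)"]
    by (simp add: Un_absorb1 cost_def)
  finally show ?thesis using cost_Un_Int[of s "tops P" U] by (simp add: add.commute)
qed

text \<open>Take covers of the \<open>E i\<close> whose excess costs have sum at most
  \<open>e\<close>, and add them one after the other, keeping maximal cells only. The old family and
  the new cover both cover \<open>E m\<close>, so strong subadditivity saves the content of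
  \<open>E m\<close>, and the cost stays below the content of the current set plus the excesses so
  far.\<close>

lemma net_content_incseq:
  assumes E: "incseq E"
  shows "net_content s (\<Union>i. E i) \<le> (SUP i. net_content s (E i))"
proof (rule ennreal_le_epsilon)
  fix e :: real assume e: "0 < e"
  have "\<forall>i. \<exists>S. E i \<subseteq> (\<Union>p\<in>S. cell p) \<and> cost s S \<le> net_content s (E i) + ennreal (e * (1/2) ^ Suc i)"
  proof
    fix i
    have "0 < e * (1/2) ^ Suc i" using e by simp
    from net_content_approx[OF this, of "E i" s]
    show "\<exists>S. E i \<subseteq> (\<Union>p\<in>S. cell p) \<and> cost s S \<le> net_content s (E i) + ennreal (e * (1/2) ^ Suc i)"
      by blast
  qed
  from choice[OF this] obtain U where "\<forall>i. E i \<subseteq> (\<Union>p\<in>U i. cell p)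
      \<and> cost s (U i) \<le> net_content s (E i) + ennreal (e * (1/2) ^ Suc i)"
    by blast
  then have U: "E i \<subseteq> (\<Union>p\<in>U i. cell p)"
      "cost s (U i) \<le> net_content s (E i) + ennreal (e * (1/2) ^ Suc i)" for i
    by simp_all
  define P where "P m = (\<Union>i\<le>m. U i)" for m
  have P_Suc: "P (Suc m) = P m \<union> U (Suc m)" for m unfolding P_def by (auto simp: atMost_Suc)
  have bound: "cost s (tops (P m)) \<le> net_content s (E m) + ennreal (\<Sum>i\<le>m. e * (1/2) ^ Suc i)" for m
  proof (induction m)
    case 0
    have "cost s (tops (P 0)) \<le> cost s (U 0)" by (intro cost_mono) (auto simp: P_def tops_def)
    then show ?case using U(2)[of 0] by simp
  next
    case (Suc m)
    let ?S = "\<Sum>i\<le>m. e * (1/2) ^ Suc i"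
    have S0: "?S \<ge> 0" using e by (intro sum_nonneg) auto
    have "net_content s (E m) + cost s (tops (P (Suc m))) = cost s (tops (P m \<union> U (Suc m))) + net_content s (E m)"
      by (simp add: P_Suc add.commute)
    also have "\<dots> \<le> cost s (tops (P m)) + cost s (U (Suc m))"
    proof (rule cost_tops_Un)
      show "E m \<subseteq> (\<Union>p\<in>P m. cell p)" using U(1)[of m] by (auto simp: P_def)
      show "E m \<subseteq> (\<Union>p\<in>U (Suc m). cell p)" using U(1)[of "Suc m"] incseq_SucD[OF E, of m] by auto
    qed
    also have "\<dots> \<le> (net_content s (E m) + ennreal ?S) + (net_content s (E (Suc m)) + ennreal (e * (1/2) ^ Suc (Suc m)))"
      using Suc U(2)[of "Suc m"] by (intro add_mono)
    also have "\<dots> = net_content s (E m) + (net_content s (E (Suc m)) + (ennreal ?S + ennreal (e * (1/2) ^ Suc (Suc m))))"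
      by (simp add: ac_simps)
    also have "ennreal ?S + ennreal (e * (1/2) ^ Suc (Suc m)) = ennreal (\<Sum>i\<le>Suc m. e * (1/2) ^ Suc i)"
      using S0 e by (simp flip: ennreal_plus)
    \<comment> \<open>The content of \<open>E m\<close> occurs on both sides and is finite, so it
      cancels.\<close>
    finally show ?case
      using net_content_less_top[of s "E m"] by (subst (asm) ennreal_add_left_cancel_le) auto
  qed
  define V where "V = tops (\<Union>m. P m)"
  have geo: "(\<Sum>i\<le>m. e * (1/2) ^ Suc i) \<le> e" for m
  proof -
    have "(\<Sum>i\<le>m. e * (1/2) ^ Suc i) = e * (1 - (1/2) ^ Suc m)"
      by (induction m) (auto simp: field_simps)
    also have "\<dots> \<le> e" using e by (simp add: field_simps)
    finally show ?thesis .
  qed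
  have "net_content s (\<Union>i. E i) \<le> cost s V"
  proof (rule net_content_le)
    have UP: "U i \<subseteq> (\<Union>m. P m)" for i
      by (rule subset_trans[of _ "P i"]) (auto simp: P_def)
    have "E i \<subseteq> (\<Union>p\<in>(\<Union>m. P m). cell p)" for i
      using subset_trans[OF U(1)[of i] UN_mono[OF UP subset_refl]] .
    then show "(\<Union>i. E i) \<subseteq> (\<Union>p\<in>V. cell p)"
      unfolding V_def tops_cover by (rule UN_least)
  qed
  also have "cost s V = (SUP m. cost s (V \<inter> P m))"
  proof -
    have "incseq (\<lambda>m. V \<inter> P m)"
      unfolding incseq_def P_def by (auto intro: order_trans)
    then have "(SUP m. cost s (V \<inter> P m)) = cost s (\<Union>m. V \<inter> P m)"
      unfolding cost_def by (intro SUP_emeasure_incseq) auto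
    also have "(\<Union>m. V \<inter> P m) = V" unfolding V_def tops_def by auto
    finally show ?thesis by (rule sym)
  qed
  also have "\<dots> \<le> (SUP i. net_content s (E i)) + ennreal e"
  proof (rule SUP_least)
    fix m
    \<comment> \<open>A cell of \<open>P m\<close> that is maximal in the infinite family is maximal
      in \<open>P m\<close>, so the bound of stage \<open>m\<close> applies.\<close>
    have "cost s (V \<inter> P m) \<le> cost s (tops (P m))"
      unfolding V_def by (intro cost_mono tops_mono) auto
    also have "\<dots> \<le> net_content s (E m) + ennreal (\<Sum>i\<le>m. e * (1/2) ^ Suc i)" by (rule bound)
    also have "\<dots> \<le> (SUP i. net_content s (E i)) + ennreal e"
      using geo by (intro add_mono SUP_upper ennreal_leI) auto
    finally show "cost s (V \<inter> P m) \<le> (SUP i. net_content s (E i)) + ennreal e" .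
  qed
  finally show "net_content s (\<Union>i. E i) \<le> (SUP i. net_content s (E i)) + ennreal e" .
qed

text \<open>A cover of cost below \<open>\<rho> powr s\<close> cannot contain a cell of side larger
  than \<open>\<rho>\<close>. Hence covers of very small cost are automatically fine, and the
  unrestricted content controls the content at every scale.\<close>

lemma hausdorff_measure_eq_0_if_net_content:
  assumes s: "0 < s" and c: "net_content s A = 0"
  shows "hausdorff_measure s A = 0"
proof -
  have le: "hausdorff_content s \<rho> A \<le> 0 + ennreal e" if \<rho>: "0 < \<rho>" and e: "0 < e" for \<rho> e :: real
  proof -
    define e' where "e' = min e (\<rho> powr s) / 2"
    have e': "0 < e'" "e' < e" "e' < \<rho> powr s" using \<rho> e powr_gt_zero[of \<rho> s] unfolding e'_def by linarith+
    obtain S where S: "A \<subseteq> (\<Union>p\<in>S. cell p)" "cost s S \<le> ennreal e'"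
      using net_content_approx[OF e'(1), of A s] c by auto
    define U where "U n = (if prod_decode n \<in> S then cell (prod_decode n) else {})" for n
    have A: "A \<subseteq> (\<Union>n. U n)"
    proof
      fix x assume "x \<in> A"
      then obtain p where "p \<in> S" "x \<in> cell p" using S by auto
      then have "x \<in> U (prod_encode p)" by (simp add: U_def)
      then show "x \<in> (\<Union>n. U n)" by blast
    qed
    have diam_cell: "diameter (cell p) \<le> (1/2) ^ fst p" for p
    proof (rule diameter_le_dist)
      show "0 \<le> ((1/2) ^ fst p :: real)" by simp
      fix x y assume "x \<in> cell p" "y \<in> cell p"
      then show "dist x y \<le> (1/2) ^ fst p"
        using cell_subset_ball[of x "fst p" "snd p"] by auto
    qed
    have diam_powr: "diameter (cell p) powr s \<le> wt s (fst p)" for p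
    proof -
      have "diameter (cell p) powr s \<le> ((1/2) ^ fst p) powr s"
        using diam_cell s diameter_ge_0[OF circle_bounded] by (intro powr_mono2) auto
      also have "\<dots> = wt s (fst p)" by (rule half_power_powr)
      finally show ?thesis .
    qed
    have small: "(1/2) ^ fst p \<le> \<rho>" if "p \<in> S" for p
    proof (rule ccontr)
      assume "\<not> (1/2) ^ fst p \<le> \<rho>"
      then have "\<rho> powr s \<le> ((1/2) ^ fst p) powr s" using \<rho> s by (intro powr_mono2) auto
      also have "\<dots> = wt s (fst p)" by (rule half_power_powr)
      finally have "ennreal (\<rho> powr s) \<le> cost s {p}" by (simp add: cost_singleton ennreal_leI)
      also have "\<dots> \<le> cost s S" using that by (intro cost_mono) auto
      finally have "ennreal (\<rho> powr s) \<le> ennreal e'" using S by (meson order.trans)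
      then show False using e' by simp
    qed
    have "hausdorff_content s \<rho> A \<le> (\<Sum>n. ennreal (diameter (U n) powr s))"
      unfolding hausdorff_content_def
    proof (rule INF_lower, intro CollectI conjI A allI)
      fix n
      show "bounded (U n)" by (rule circle_bounded)
      show "diameter (U n) \<le> \<rho>"
        using \<rho> diam_cell[of "prod_decode n"] small[of "prod_decode n"] by (auto simp: U_def)
    qed
    also have "\<dots> \<le> (\<Sum>n. ennreal (wt s (fst (prod_decode n))) * indicator S (prod_decode n))"
      by (intro suminf_le) (auto simp: U_def intro: ennreal_leI diam_powr)
    also have "\<dots> = cost s S" by (rule cost_suminf[symmetric])
    also have "\<dots> \<le> ennreal e'" by (rule S(2))
    also have "\<dots> \<le> ennreal e" using e' by (intro ennreal_leI) simp
    finally show ?thesis by simp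
  qed
  have "hausdorff_content s \<rho> A \<le> 0" if "0 < \<rho>" for \<rho>
    by (rule ennreal_le_epsilon) (rule le[OF that])
  then have "hausdorff_measure s A \<le> 0"
    unfolding hausdorff_measure_def by (intro SUP_least) simp
  then show ?thesis by simp
qed

section \<open>Capacitability of analytic sets\<close>

text \<open>The price of making a cover open: each cell is replaced by at most nine cells of its
  level, whose union contains an open neighbourhood of it.\<close>

lemma cost_neighbours:
  assumes "\<And>p. p \<in> S \<Longrightarrow> finite (N p) \<and> card (N p) \<le> 9 \<and> N p \<subseteq> {fst p} \<times> UNIV"
  shows "cost s (\<Union>p\<in>S. N p) \<le> 9 * cost s S"
proof -
  define N' where "N' n = (if prod_decode n \<in> S then N (prod_decode n) else {})" for n
  have "(\<Union>p\<in>S. N p) = (\<Union>n. N' n)"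
  proof (intro equalityI subsetI)
    fix q assume "q \<in> (\<Union>p\<in>S. N p)"
    then obtain p where "p \<in> S" "q \<in> N p" by auto
    then have "q \<in> N' (prod_encode p)" by (simp add: N'_def)
    then show "q \<in> (\<Union>n. N' n)" by blast
  qed (auto simp: N'_def split: if_splits)
  also have "cost s (\<Union>n. N' n) \<le> (\<Sum>n. cost s (N' n))" by (rule cost_UN_le)
  also have "\<dots> \<le> (\<Sum>n. 9 * (ennreal (wt s (fst (prod_decode n))) * indicator S (prod_decode n)))"
  proof (rule suminf_le)
    fix n
    show "cost s (N' n) \<le> 9 * (ennreal (wt s (fst (prod_decode n))) * indicator S (prod_decode n))"
    proof (cases "prod_decode n \<in> S")
      case True
      then have "cost s (N' n) = ennreal (real (card (N (prod_decode n))) * wt s (fst (prod_decode n)))"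
        unfolding N'_def using assms[OF True] by (simp add: cost_finite)
      also have "\<dots> \<le> ennreal (9 * wt s (fst (prod_decode n)))"
        using assms[OF True] wt_pos[of s "fst (prod_decode n)"] by (intro ennreal_leI mult_right_mono) auto
      finally show ?thesis using True wt_pos[of s "fst (prod_decode n)"] by (simp add: ennreal_mult)
    qed (simp add: N'_def cost_def)
  qed auto
  also have "\<dots> = 9 * cost s S" by (simp add: cost_suminf)
  finally show ?thesis .
qed

section \<open>Compact boxes in Baire space\<close>

lemma compact_box: "compact {x :: nat \<Rightarrow> nat. \<forall>i. x i \<le> b i}"
proof -
  have "compactin (product_topology (\<lambda>i. euclidean) UNIV) (PiE UNIV (\<lambda>i. {..b i}))"
    unfolding compactin_PiE by (auto intro: finite_imp_compact)
  moreover have "PiE UNIV (\<lambda>i. {..b i}) = {x. \<forall>i. x i \<le> b i}" by (auto simp: PiE_def)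
  ultimately show ?thesis by (simp add: euclidean_product_topology)
qed

lemma nat_open: "open (S :: nat set)"
  by (rule discrete_topology_class.open_discrete)

lemma open_fun_cylinder:
  fixes x :: "nat \<Rightarrow> nat"
  assumes "open U" "x \<in> U" obtains m where "{z. \<forall>i<m. z i = x i} \<subseteq> U"
proof -
  have "openin (product_topology (\<lambda>i. euclidean) UNIV) U" using assms(1) by (simp only: open_fun_def)
  then obtain X where X: "x \<in> PiE UNIV X" "finite {i. X i \<noteq> UNIV}" "PiE UNIV X \<subseteq> U"
    using product_topology_open_contains_basis[of "\<lambda>i. euclidean" UNIV U x] assms by auto
  obtain m where m: "\<forall>i\<in>{i. X i \<noteq> UNIV}. i < m"
    using X(2) finite_nat_set_iff_bounded by blast
  have "{z. \<forall>i<m. z i = x i} \<subseteq> U"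
  proof (intro subsetI subsetD[OF X(3)])
    fix z assume z: "z \<in> {z. \<forall>i<m. z i = x i}"
    have "z i \<in> X i" for i
    proof (cases "i < m")
      case True then show ?thesis using z X(1) by (auto simp: PiE_def Pi_def)
    next
      case False then have "X i = UNIV" using m by blast
      then show ?thesis by simp
    qed
    then show "z \<in> PiE UNIV X" by (simp add: PiE_def)
  qed
  then show ?thesis by (rule that)
qed

text \<open>A tube lemma: compactness of the box reduces membership in \<open>U\<close> to finitely
  many cylinders, and these look at finitely many coordinates only.\<close>

lemma box_tube:
  fixes b :: "nat \<Rightarrow> nat"
  assumes "open U" "{x. \<forall>i. x i \<le> b i} \<subseteq> U"
  obtains k where "{x. \<forall>i<k. x i \<le> b i} \<subseteq> U"
proof -
  define cyl where "cyl m x = {z :: nat \<Rightarrow> nat. \<forall>i<m. z i = x i}" for m :: nat and x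
  have open_cyl: "open (cyl m x)" for m x
  proof -
    have "cyl m x = (\<Inter>i\<in>{..<m}. (\<lambda>z. z i) -` {x i})" by (auto simp: cyl_def)
    then show ?thesis
      by (auto intro!: open_INT open_vimage continuous_on_product_coordinates nat_open)
  qed
  have "\<forall>x\<in>{x. \<forall>i. x i \<le> b i}. \<exists>m. cyl m x \<subseteq> U"
  proof
    fix x assume "x \<in> {x. \<forall>i. x i \<le> b i}"
    then have "x \<in> U" using assms(2) by (rule subsetD[rotated])
    then obtain m where "{z. \<forall>i<m. z i = x i} \<subseteq> U" by (rule open_fun_cylinder[OF assms(1)])
    then show "\<exists>m. cyl m x \<subseteq> U" unfolding cyl_def by (rule exI)
  qed
  from bchoice[OF this] obtain m where m: "\<forall>x\<in>{x. \<forall>i. x i \<le> b i}. cyl (m x) x \<subseteq> U" by (rule exE)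
  have "{x. \<forall>i. x i \<le> b i} \<subseteq> (\<Union>x\<in>{x. \<forall>i. x i \<le> b i}. cyl (m x) x)"
    by (auto simp: cyl_def)
  then obtain F where F: "F \<subseteq> {x. \<forall>i. x i \<le> b i}" "finite F"
      "{x. \<forall>i. x i \<le> b i} \<subseteq> (\<Union>x\<in>F. cyl (m x) x)"
    by (rule compactE_image[OF compact_box open_cyl])
  define k where "k = Max (insert 0 (m ` F))"
  have k: "m x \<le> k" if "x \<in> F" for x using that F(2) by (auto simp: k_def)
  have "{x. \<forall>i<k. x i \<le> b i} \<subseteq> U"
  proof
    fix z assume z: "z \<in> {x. \<forall>i<k. x i \<le> b i}"
    \<comment> \<open>Coordinates from \<open>k\<close> on are set to 0, which is below every bound.
      The truncated point lies in the box and agrees with \<open>z\<close> on all coordinates seen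
      by the cylinders.\<close>
    define z' where "z' i = (if i < k then z i else 0)" for i
    have "z' \<in> {x. \<forall>i. x i \<le> b i}" using z by (auto simp: z'_def)
    then obtain x where x: "x \<in> F" "z' \<in> cyl (m x) x" using F(3) by auto
    then have "z \<in> cyl (m x) x" using k[OF x(1)] by (auto simp: cyl_def z'_def)
    then show "z \<in> U" using m F(1) x(1) by blast
  qed
  then show ?thesis by (rule that)
qed

text \<open>Choquet's argument. The coordinates of Baire space are bounded one at a time, and
  continuity from below keeps the content of the image above \<open>a\<close>. In the limit the
  parameters form a compact box. An open cover of its image already covers the image at some finite
  stage and so costs at least \<open>a\<close>; opening the cover loses a factor 9.\<close>

theorem analytic_capacitable:
  assumes A: "analytic_set A" and pos: "net_content s A > 0"
  shows "\<exists>K\<subseteq>A. compact K \<and> net_content s K > 0"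
proof -
  have "A \<noteq> {}" using pos net_content_le[of A "{}" s] by (auto simp: cost_def)
  then obtain f :: "(nat \<Rightarrow> nat) \<Rightarrow> circle" where f: "continuous_on UNIV f" "range f = A"
    using A unfolding analytic_set_def by auto
  obtain a where a: "0 < a" "a < net_content s A" using pos dense by blast
  \<comment> \<open>Only finitely many coordinates are bounded, so the images of these sets are in
    general not compact; this is where continuity from below along arbitrary sets is needed.\<close>
  define T where "T bs = {x :: nat \<Rightarrow> nat. \<forall>i<length bs. x i \<le> bs ! i}" for bs
  have ext: "\<exists>n. a < net_content s (f ` T (bs @ [n]))" if "a < net_content s (f ` T bs)" for bs
  proof -
    have "T bs = (\<Union>n. T (bs @ [n]))" by (auto simp: T_def nth_append less_Suc_eq)
    then have "f ` T bs = (\<Union>n. f ` T (bs @ [n]))" by auto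
    moreover have "incseq (\<lambda>n. f ` T (bs @ [n]))"
      unfolding incseq_def T_def
      by (intro allI impI image_mono) (auto simp: nth_append less_Suc_eq intro: order_trans)
    ultimately have "a < (SUP n. net_content s (f ` T (bs @ [n])))"
      using that net_content_incseq[of "\<lambda>n. f ` T (bs @ [n])" s] by simp
    then show ?thesis by (simp add: less_SUP_iff)
  qed
  define Q where "Q k bs \<longleftrightarrow> length bs = k \<and> a < net_content s (f ` T bs)" for k and bs :: "nat list"
  have "\<exists>B. \<forall>k. Q k (B k) \<and> (\<exists>n. B (Suc k) = B k @ [n])"
  proof (rule dependent_nat_choice)
    show "\<exists>bs. Q 0 bs" using a f by (intro exI[of _ "[]"]) (simp add: Q_def T_def)
    show "\<exists>bs'. Q (Suc k) bs' \<and> (\<exists>n. bs' = bs @ [n])"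
      if "Q k bs" for k bs
    proof -
      obtain n where "a < net_content s (f ` T (bs @ [n]))" using ext[of bs] \<open>Q k bs\<close> by (auto simp: Q_def)
      then show ?thesis using \<open>Q k bs\<close> by (intro exI[of _ "bs @ [n]"]) (simp add: Q_def)
    qed
  qed
  then obtain B where B: "\<And>k. Q k (B k)" "\<And>k. \<exists>n. B (Suc k) = B k @ [n]" by blast
  define b where "b i = B (Suc i) ! i" for i
  have Bb: "B k ! i = b i" if "i < k" for i k
    using that
  proof (induction k)
    case (Suc k)
    obtain n where n: "B (Suc k) = B k @ [n]" using B(2) by blast
    show ?case
    proof (cases "i = k")
      case False
      then show ?thesis using Suc n B(1)[of k] by (simp add: Q_def nth_append)
    qed (simp add: b_def)
  qed simp
  have T_B: "T (B k) = {x. \<forall>i<k. x i \<le> b i}" for k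
    using B(1)[of k] Bb by (auto simp: T_def Q_def)
  define K where "K = f ` {x. \<forall>i. x i \<le> b i}"
  have "compact K" unfolding K_def
    by (intro compact_continuous_image compact_box continuous_on_subset[OF f(1)]) auto
  moreover have "K \<subseteq> A" using f by (auto simp: K_def)
  moreover have "net_content s K > 0"
  proof -
    have "a \<le> 9 * cost s S" if S: "K \<subseteq> (\<Union>p\<in>S. cell p)" for S
    proof -
      \<comment> \<open>An empty cell has no point at which to centre a ball, so such cells are
        dropped.\<close>
      define S' where "S' = {p\<in>S. cell p \<noteq> {}}"
      have "\<forall>p\<in>S'. \<exists>V N. open V \<and> cell p \<subseteq> V \<and> finite N \<and> card N \<le> 9 \<and> N \<subseteq> {fst p} \<times> UNIV
          \<and> V \<subseteq> (\<Union>q\<in>N. cell q)"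
      proof
        fix p assume "p \<in> S'"
        then obtain y where y: "y \<in> cell p" by (auto simp: S'_def)
        have "cell p \<subseteq> ball y ((1/2) ^ fst p)" using cell_subset_ball[of y "fst p" "snd p"] y by simp
        then show "\<exists>V N. open V \<and> cell p \<subseteq> V \<and> finite N \<and> card N \<le> 9 \<and> N \<subseteq> {fst p} \<times> UNIV
          \<and> V \<subseteq> (\<Union>q\<in>N. cell q)"
          using ball_subset_cells[of "fst p" y] open_ball[of y "(1/2) ^ fst p"] by metis
      qed
      then obtain V N where VN: "\<And>p. p \<in> S' \<Longrightarrow> open (V p) \<and> cell p \<subseteq> V p \<and> finite (N p) \<and> card (N p) \<le> 9
          \<and> N p \<subseteq> {fst p} \<times> UNIV \<and> V p \<subseteq> (\<Union>q\<in>N p. cell q)"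
        by metis
      have "open (\<Union>p\<in>S'. V p)" using VN by blast
      then have op: "open (f -` (\<Union>p\<in>S'. V p))"
        using f(1) by (simp add: continuous_on_open_vimage)
      have "{x. \<forall>i. x i \<le> b i} \<subseteq> f -` (\<Union>p\<in>S'. V p)"
      proof
        fix x assume "x \<in> {x. \<forall>i. x i \<le> b i}"
        then have "f x \<in> K" by (auto simp: K_def)
        then obtain p where "p \<in> S" "f x \<in> cell p" using S by auto
        then have "p \<in> S'" "f x \<in> V p" using VN[of p] by (auto simp: S'_def)
        then show "x \<in> f -` (\<Union>p\<in>S'. V p)" by auto
      qed
      then obtain k where "{x. \<forall>i<k. x i \<le> b i} \<subseteq> f -` (\<Union>p\<in>S'. V p)"
        using box_tube[OF op] by blast
      then have "f ` T (B k) \<subseteq> (\<Union>p\<in>S'. V p)" by (auto simp: T_B)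
      also have "\<dots> \<subseteq> (\<Union>p\<in>S'. \<Union>q\<in>N p. cell q)" using VN by (intro UN_mono) auto
      also have "\<dots> = (\<Union>q\<in>(\<Union>p\<in>S'. N p). cell q)" by simp
      finally have "net_content s (f ` T (B k)) \<le> cost s (\<Union>p\<in>S'. N p)" by (rule net_content_le)
      also have "\<dots> \<le> 9 * cost s S'" using VN by (intro cost_neighbours) auto
      also have "\<dots> \<le> 9 * cost s S" by (intro mult_left_mono cost_mono) (auto simp: S'_def)
      finally show ?thesis using B(1)[of k] unfolding Q_def
        by (meson less_imp_le order_trans)
    qed
    then have "a / 9 \<le> cost s S" if "K \<subseteq> (\<Union>p\<in>S. cell p)" for S
      using that by (simp add: divide_le_posI_ennreal)
    then have "a / 9 \<le> net_content s K"
      unfolding net_content_def by (intro INF_greatest) auto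
    moreover have "0 < a / 9" using a by (simp add: ennreal_zero_less_divide)
    ultimately show ?thesis by simp
  qed
  ultimately show ?thesis by blast
qed

section \<open>Frostman measures\<close>

lemma wt_power: "wt s k = (2 powr (- s)) ^ k"
  by (simp add: wt_def powr_power mult.commute)

lemma two_powr_less_1: "0 < s \<Longrightarrow> 2 powr (- s) < (1::real)"
  using powr_less_mono[of "- s" 0 2] by simp

lemma wt_tendsto_0: "0 < s \<Longrightarrow> wt s \<longlonglongrightarrow> 0"
  unfolding wt_power[abs_def] by (intro LIMSEQ_realpow_zero two_powr_less_1) auto

text \<open>
  The two halves of a cell share its mass in proportion to their contents, which keeps the mass of each
  cell below its content.
\<close>

fun flow :: "(nat \<Rightarrow> nat \<Rightarrow> real) \<Rightarrow> nat \<Rightarrow> nat \<Rightarrow> real" where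
  "flow v 0 i = (if i = 0 then 1 else 0)"
| "flow v (Suc k) i = flow v k (i div 2) * v (Suc k) i /
     (v (Suc k) (2 * (i div 2)) + v (Suc k) (2 * (i div 2) + 1))"

lemma flow_nonneg:
  assumes "\<And>k i. 0 \<le> v k i" shows "0 \<le> flow v k i"
  by (induction k arbitrary: i) (auto intro!: divide_nonneg_nonneg mult_nonneg_nonneg add_nonneg_nonneg assms)

lemma flow_le:
  assumes v: "\<And>k i. 0 \<le> v k i" and sub: "\<And>k i. v k i \<le> v (Suc k) (2 * i) + v (Suc k) (2 * i + 1)"
  shows "v 0 0 * flow v k i \<le> v k i"
proof (induction k arbitrary: i)
  case 0
  then show ?case using v by simp
next
  case (Suc k)
  define j where "j = i div 2"
  define w where "w = v (Suc k) (2 * j) + v (Suc k) (2 * j + 1)"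
  have i: "v (Suc k) i \<le> w"
  proof -
    have "i = 2 * j \<or> i = 2 * j + 1" unfolding j_def by linarith
    then show ?thesis using v[of "Suc k" "2 * j"] v[of "Suc k" "2 * j + 1"] unfolding w_def by auto
  qed
  have *: "v 0 0 * flow v (Suc k) i = (v 0 0 * flow v k j) * v (Suc k) i / w"
    by (simp add: j_def w_def)
  show ?case
  proof (cases "w = 0")
    case True then show ?thesis unfolding * using v[of "Suc k" i] by simp
  next
    case False
    then have w: "0 < w" using i v[of "Suc k" i] by linarith
    have "(v 0 0 * flow v k j) * v (Suc k) i \<le> w * v (Suc k) i"
      using Suc[of j] sub[of k j] v by (intro mult_right_mono) (auto simp: w_def)
    then show ?thesis unfolding * using w by (simp add: divide_le_eq mult.commute)
  qed
qed

text \<open>If both halves have content 0, the quotients in \<open>flow\<close> are 0 by the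
  convention for division by 0. No mass is lost: the cell then has content 0 by subadditivity, and
  \<open>flow_le\<close> forces its mass to be 0 too.\<close>

lemma flow_additive:
  assumes v: "\<And>k i. 0 \<le> v k i" and sub: "\<And>k i. v k i \<le> v (Suc k) (2 * i) + v (Suc k) (2 * i + 1)"
    and pos: "0 < v 0 0"
  shows "flow v k i = flow v (Suc k) (2 * i) + flow v (Suc k) (2 * i + 1)"
proof -
  define w where "w = v (Suc k) (2 * i) + v (Suc k) (2 * i + 1)"
  have eq: "flow v (Suc k) (2 * i) + flow v (Suc k) (2 * i + 1) = flow v k i * w / w"
    by (simp add: w_def distrib_left add_divide_distrib)
  show ?thesis
  proof (cases "w = 0")
    case True
    then have "v 0 0 * flow v k i \<le> 0"
      using flow_le[of v k i, OF v sub] sub[of k i] by (simp add: w_def)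
    then have "flow v k i = 0"
      using pos flow_nonneg[of v k i, OF v] by (simp add: mult_le_0_iff)
    then show ?thesis using eq by simp
  next
    case False
    show ?thesis unfolding eq using False by simp
  qed
qed

text \<open>The distribution function at x is the supremum over k of the mass of the level-k
  intervals contained in (0,x]. It could fail to be right-continuous if mass accumulated just to the
  right of a point; \<open>B\<close> tending to 0 excludes this, and \<open>interval_measure\<close>
  applies.\<close>

lemma dyadic_mass_measure:
  fixes g :: "nat \<Rightarrow> nat \<Rightarrow> real"
  assumes g: "\<And>k i. 0 \<le> g k i" and add: "\<And>k i. g k i = g (Suc k) (2 * i) + g (Suc k) (2 * i + 1)"
    and B: "\<And>k i. g k i \<le> B k" "B \<longlonglongrightarrow> 0"
  shows "\<exists>\<mu>. sets \<mu> = sets borel \<and> (\<forall>k i. emeasure \<mu> {real i / 2 ^ k <.. (real i + 1) / 2 ^ k} = ennreal (g k i))"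
proof -
  define S where "S k n = (\<Sum>i<n. g k i)" for k n
  have S_mono: "S k m \<le> S k n" if "m \<le> n" for k m n
    unfolding S_def using that g by (intro sum_mono2) auto
  have S_Suc: "S (Suc k) (2 * n) = S k n" for k n
  proof (induction n)
    case (Suc n)
    then show ?case using add[of k n] by (simp add: S_def)
  qed (simp add: S_def)
  have S_ref: "S (k + m) (2 ^ m * n) = S k n" for k m n
  proof (induction m)
    case (Suc m)
    then show ?case using S_Suc[of "k + m" "2 ^ m * n"] by (simp add: mult.assoc)
  qed simp
  \<comment> \<open>\<open>nat\<close> sends negative values to 0, so the distribution function
    vanishes on the negative axis.\<close>
  define j where "j k x = nat \<lfloor>2 ^ k * x\<rfloor>" for k and x :: real
  have j_ref: "2 ^ m * j k x \<le> j (k + m) x" "j (k + m) x \<le> 2 ^ m * (j k x + 1)" for k m x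
  proof -
    have a: "2 ^ (k + m) * x = 2 ^ m * (2 ^ k * x)" by (simp add: power_add)
    show "2 ^ m * j k x \<le> j (k + m) x"
    proof (cases "0 \<le> x")
      case True
      then have "real (j k x) \<le> 2 ^ k * x" unfolding j_def by simp
      then have "2 ^ m * real (j k x) \<le> 2 ^ (k + m) * x" unfolding a by (intro mult_left_mono) auto
      then have "int (2 ^ m * j k x) \<le> \<lfloor>2 ^ (k + m) * x\<rfloor>" by (simp add: le_floor_iff)
      then show ?thesis unfolding j_def[of "k + m"] by linarith
    next
      case False
      then have "2 ^ k * x < 0" by (simp add: mult_less_0_iff)
      then show ?thesis unfolding j_def[of k] by simp
    qed
    have "2 ^ k * x < real (j k x) + 1" unfolding j_def by linarith
    then have "2 ^ (k + m) * x < 2 ^ m * (real (j k x) + 1)" unfolding a by (intro mult_strict_left_mono) auto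
    then have "\<lfloor>2 ^ (k + m) * x\<rfloor> < int (2 ^ m * (j k x + 1))"
      by (simp add: floor_less_iff distrib_left add.commute)
    then show "j (k + m) x \<le> 2 ^ m * (j k x + 1)" unfolding j_def[of "k + m"] by linarith
  qed
  define G where "G k x = S k (j k x)" for k x
  have lo: "S k (j k x) \<le> G (k + m) x" for k m x
    using S_mono[OF j_ref(1)[of m k x], of "k + m"] by (simp add: G_def S_ref)
  have up: "G (k + m) x \<le> S k (j k x + 1)" for k m x
    using S_mono[OF j_ref(2)[of k m x], of "k + m"] unfolding G_def S_ref by simp
  have up': "G l x \<le> S k (j k x + 1)" for l k x
  proof -
    have "G l x \<le> G (l + k) x" using lo[of l x k] by (simp add: G_def)
    also have "\<dots> \<le> S k (j k x + 1)" using up[of k l x] by (simp add: add.commute)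
    finally show ?thesis .
  qed
  then have bdd: "bdd_above (range (\<lambda>k. G k x))" for x by (intro bdd_aboveI2)
  define F where "F x = (SUP k. G k x)" for x
  have F_lo: "S k (j k x) \<le> F x" for k x
    unfolding F_def using lo[of k x 0] cSUP_upper[OF _ bdd, of k x] by simp
  have F_up: "F x \<le> S k (j k x + 1)" for k x
    unfolding F_def by (intro cSUP_least up') auto
  have F_mono: "mono F"
  proof (rule monoI)
    fix x y :: real assume xy: "x \<le> y"
    have "j k x \<le> j k y" for k
      unfolding j_def using xy by (intro nat_mono floor_mono mult_left_mono) auto
    then show "F x \<le> F y"
      unfolding F_def G_def by (intro cSUP_mono bdd[unfolded G_def]) (auto intro: S_mono)
  qed
  have F_dyadic: "F (real i / 2 ^ k) = S k i" for i k
  proof (rule antisym)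
    have jm: "j (k + m) (real i / 2 ^ k) = 2 ^ m * i" for m
    proof -
      have "2 ^ (k + m) * (real i / 2 ^ k) = real (2 ^ m * i)" by (simp add: power_add field_simps)
      then show ?thesis unfolding j_def by (simp only: floor_of_nat nat_int)
    qed
    show "S k i \<le> F (real i / 2 ^ k)" using F_lo[of k "real i / 2 ^ k"] jm[of 0] by simp
    have "G l (real i / 2 ^ k) \<le> S k i" for l
    proof -
      have "G l (real i / 2 ^ k) \<le> G (l + k) (real i / 2 ^ k)"
        using lo[of l _ k] by (simp add: G_def)
      also have "\<dots> = S k i" unfolding G_def using jm[of l] S_ref[of k l i] by (simp add: add.commute)
      finally show ?thesis .
    qed
    then show "F (real i / 2 ^ k) \<le> S k i" unfolding F_def by (intro cSUP_least) auto
  qed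
  have F_cont: "continuous (at_right a) F" for a
    unfolding continuous_within_eps_delta
  proof (intro allI impI)
    fix e :: real assume e: "0 < e"
    have "\<forall>\<^sub>F k in sequentially. B k < e" using order_tendstoD(2)[OF B(2) e] .
    then obtain k where k: "B k < e" by (auto simp: eventually_sequentially)
    \<comment> \<open>The distance from \<open>a\<close> to the right end of its dyadic interval of
      level \<open>k\<close>. Before that point \<open>F\<close> grows by at most
      \<open>g k (j k a)\<close>.\<close>
    define d where "d = (of_int \<lfloor>2 ^ k * a\<rfloor> + 1 - 2 ^ k * a) / 2 ^ k"
    have "0 < d" unfolding d_def by (intro divide_pos_pos) (linarith, simp)
    moreover have "dist (F y) (F a) < e" if y: "y \<in> {a<..}" "dist y a < d" for y
    proof -
      have "y - a < d" using y by (simp add: dist_real_def)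
      then have "2 ^ k * y < of_int \<lfloor>2 ^ k * a\<rfloor> + 1" unfolding d_def by (simp add: field_simps)
      moreover have "2 ^ k * a \<le> 2 ^ k * y" using y by simp
      ultimately have "\<lfloor>2 ^ k * y\<rfloor> = \<lfloor>2 ^ k * a\<rfloor>" by linarith
      then have "j k y = j k a" by (simp add: j_def)
      then have "F y \<le> S k (j k a + 1)" "S k (j k a) \<le> F a" "F a \<le> F y"
        using F_up[of y k] F_lo[of k a] monoD[OF F_mono, of a y] y by auto
      moreover have "S k (j k a + 1) = S k (j k a) + g k (j k a)" by (simp add: S_def)
      ultimately show ?thesis using B(1)[of k "j k a"] k by (simp add: dist_real_def)
    qed
    ultimately show "\<exists>d>0. \<forall>y\<in>{a<..}. dist y a < d \<longrightarrow> dist (F y) (F a) < e" by blast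
  qed
  have "emeasure (interval_measure F) {real i / 2 ^ k <.. (real i + 1) / 2 ^ k} = ennreal (g k i)" for k i
  proof -
    have "emeasure (interval_measure F) {real i / 2 ^ k <.. (real i + 1) / 2 ^ k}
        = ennreal (F (real (Suc i) / 2 ^ k) - F (real i / 2 ^ k))"
      using monoD[OF F_mono] F_cont
      by (subst emeasure_interval_measure_Ioc) (auto intro: divide_right_mono simp: add.commute)
    also have "\<dots> = ennreal (g k i)" unfolding F_dyadic by (simp add: S_def)
    finally show ?thesis .
  qed
  then show ?thesis by (intro exI[of _ "interval_measure F"]) auto
qed

lemma open_eq_UN_cells:
  assumes "open V" shows "V = (\<Union>p\<in>{p. cell p \<subseteq> V}. cell p)"
proof (intro equalityI subsetI)
  fix x assume x: "x \<in> V"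
  obtain e where e: "0 < e" "ball x e \<subseteq> V" using assms x open_contains_ball by blast
  obtain k where k: "(1/2) ^ k < e" using real_arch_pow_inv[of e "1/2"] e by auto
  have "x \<in> cell (k, addr k x)" by (simp add: cell_def)
  moreover have "cell (k, addr k x) \<subseteq> V"
    using cell_subset_ball[OF calculation] subset_ball[of "(1/2) ^ k" e x] k e by auto
  ultimately show "x \<in> (\<Union>p\<in>{p. cell p \<subseteq> V}. cell p)" by blast
qed blast

text \<open>The flow along the contents of the pieces of \<open>K\<close> gives a cell of level k
  mass at most \<open>wt s k\<close> divided by the content of \<open>K\<close>; nine cells cover a
  ball, hence the constant. Cells that miss \<open>K\<close> get mass 0, and they exhaust the open
  complement of \<open>K\<close>.\<close>

theorem frostman_compact:
  assumes s: "0 < s" and K: "compact K" and pos: "net_content s K > 0"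
  shows "\<exists>\<mu> C. prob_space \<mu> \<and> sets \<mu> = sets borel \<and> emeasure \<mu> (- K) = 0 \<and> 0 < C \<and>
           (\<forall>y k. measure \<mu> (ball y ((1/2) ^ k)) \<le> C * wt s k)"
proof -
  define v where "v k i = enn2real (net_content s (K \<inter> cell (k, i)))" for k i
  have v: "0 \<le> v k i" for k i by (simp add: v_def)
  have sub: "v k i \<le> v (Suc k) (2 * i) + v (Suc k) (2 * i + 1)" for k i
  proof -
    have "net_content s (K \<inter> cell (k, i)) \<le> net_content s (K \<inter> cell (Suc k, 2 * i)) + net_content s (K \<inter> cell (Suc k, 2 * i + 1))"
      by (subst cell_split) (simp only: Int_Un_distrib net_content_Un)
    then have "v k i \<le> enn2real (net_content s (K \<inter> cell (Suc k, 2 * i)) + net_content s (K \<inter> cell (Suc k, 2 * i + 1)))"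
      unfolding v_def by (intro enn2real_mono) (simp_all add: net_content_less_top)
    also have "\<dots> = v (Suc k) (2 * i) + v (Suc k) (2 * i + 1)"
      unfolding v_def by (intro enn2real_plus net_content_less_top)
    finally show ?thesis .
  qed
  have v_wt: "v k i \<le> wt s k" for k i
    unfolding v_def using net_content_cell[of s K "(k, i)"] wt_pos[of s k]
    by (simp add: enn2real_leI)
  have v0: "0 < v 0 0"
    unfolding v_def cell_0_0 using pos net_content_less_top[of s K] by (simp add: enn2real_positive_iff)
  define g where "g = flow v"
  have g_nonneg: "0 \<le> g k i" for k i unfolding g_def by (rule flow_nonneg) (rule v)
  have g_add: "g k i = g (Suc k) (2 * i) + g (Suc k) (2 * i + 1)" for k i
    unfolding g_def by (rule flow_additive) (rule v sub v0)+
  have g_le: "g k i \<le> v k i / v 0 0" for k i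
    using flow_le[of v k i, OF v sub] v0 unfolding g_def by (simp add: field_simps)
  have g_wt: "g k i \<le> wt s k / v 0 0" for k i
    using g_le[of k i] v_wt[of k i] v0 by (meson divide_right_mono less_imp_le order_trans)
  have "(\<lambda>k. wt s k) \<longlonglongrightarrow> 0" using wt_tendsto_0[OF s] .
  then have "(\<lambda>k. wt s k / v 0 0) \<longlonglongrightarrow> 0 / v 0 0" using v0 by (intro tendsto_divide) auto
  then have "(\<lambda>k. wt s k / v 0 0) \<longlonglongrightarrow> 0" by simp
  from dyadic_mass_measure[OF g_nonneg g_add g_wt this]
  obtain \<mu>0 where \<mu>0: "sets \<mu>0 = sets borel"
      "\<And>k i. emeasure \<mu>0 {real i / 2 ^ k <.. (real i + 1) / 2 ^ k} = ennreal (g k i)"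
    by blast
  have unit: "emeasure \<mu>0 {0<..1} = 1" using \<mu>0(2)[of 0 0] by (simp add: g_def)
  note [measurable_cong] = \<mu>0(1)
  \<comment> \<open>The measure \<open>\<mu>0\<close> lives on the line. The interval (0,1] has mass
    1, and there \<open>arc_rep\<close> inverts \<open>to_circle\<close>, so cells correspond to
    dyadic intervals.\<close>
  define \<nu> where "\<nu> = uniform_measure \<mu>0 {0<..1::real}"
  interpret \<nu>: prob_space \<nu> unfolding \<nu>_def
    using unit by (intro prob_space_uniform_measure) auto
  have sets_\<nu>[measurable_cong]: "sets \<nu> = sets borel" by (simp add: \<nu>_def \<mu>0)
  have tc: "to_circle \<in> \<nu> \<rightarrow>\<^sub>M borel" by measurable
  define \<mu> where "\<mu> = distr \<nu> borel to_circle"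
  have prob: "prob_space \<mu>" unfolding \<mu>_def using tc by (rule \<nu>.prob_space_distr)
  have em: "emeasure \<mu> V = emeasure \<mu>0 ({0<..1} \<inter> to_circle -` V)" if V: "V \<in> sets borel" for V
  proof -
    have "to_circle -` V \<in> sets borel" using measurable_sets[OF measurable_to_circle V] by simp
    then show ?thesis
      unfolding \<mu>_def using V tc by (subst emeasure_distr) (auto simp: \<nu>_def \<mu>0 unit sets_eq_imp_space_eq[OF \<mu>0(1)] divide_ennreal_def)
  qed
  define I where "I p = {real (snd p) / 2 ^ fst p <.. (real (snd p) + 1) / 2 ^ fst p}" for p :: "nat \<times> nat"
  have I: "emeasure \<mu>0 (I p) = ennreal (g (fst p) (snd p))" for p unfolding I_def by (rule \<mu>0(2))
  have cell_I: "{0<..1} \<inter> to_circle -` V \<subseteq> (\<Union>p\<in>N. I p)" if VN: "V \<subseteq> (\<Union>p\<in>N. cell p)" for V N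
  proof
    fix u :: real assume u: "u \<in> {0<..1} \<inter> to_circle -` V"
    then obtain p where p: "p \<in> N" "to_circle u \<in> cell p" using VN by blast
    have "u \<in> I p" using p(2) u unfolding cell_def I_def by (auto simp: addr_iff arc_rep_to_circle field_simps)
    then show "u \<in> (\<Union>p\<in>N. I p)" using p by blast
  qed
  have "emeasure \<mu> (- K) = 0"
  proof -
    define N where "N = {p. cell p \<subseteq> - K}"
    have op: "open (- K)" using K by (simp add: compact_imp_closed open_Compl)
    have "emeasure \<mu> (- K) \<le> emeasure \<mu>0 (\<Union>p\<in>N. I p)"
    proof -
      have "- K \<subseteq> (\<Union>p\<in>N. cell p)" using open_eq_UN_cells[OF op] unfolding N_def by simp
      moreover have "(\<Union>p\<in>N. I p) \<in> sets \<mu>0"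
        by (intro sets.countable_UN'' countableI_type) (auto simp: I_def \<mu>0)
      moreover have "- K \<in> sets borel" using op by simp
      ultimately show ?thesis unfolding em[OF \<open>- K \<in> sets borel\<close>] by (intro emeasure_mono cell_I)
    qed
    also have "(\<Union>p\<in>N. I p) \<in> null_sets \<mu>0"
    proof (rule null_sets_UN')
      fix p assume p: "p \<in> N"
      then have "K \<inter> cell (fst p, snd p) = {}" by (auto simp: N_def)
      then have "v (fst p) (snd p) = 0"
        using net_content_le[of "{}" "{}" s] by (simp add: v_def cost_def)
      then have "g (fst p) (snd p) = 0" using g_le[of "fst p" "snd p"] g_nonneg[of "fst p" "snd p"] by simp
      then show "I p \<in> null_sets \<mu>0" using I[of p] by (simp add: null_sets_def I_def \<mu>0)
    qed (rule countableI_type)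
    then have "emeasure \<mu>0 (\<Union>p\<in>N. I p) = 0" by (rule null_setsD1)
    finally show ?thesis by simp
  qed
  moreover have "measure \<mu> (ball y ((1/2) ^ k)) \<le> (9 / v 0 0) * wt s k" for y k
  proof -
    obtain N where N: "finite N" "card N \<le> 9" "N \<subseteq> {k} \<times> UNIV" "ball y ((1/2) ^ k) \<subseteq> (\<Union>p\<in>N. cell p)"
      using ball_subset_cells[of k y] by (elim exE conjE)
    have "emeasure \<mu> (ball y ((1/2) ^ k)) \<le> emeasure \<mu>0 (\<Union>p\<in>N. I p)"
    proof -
      have "(\<Union>p\<in>N. I p) \<in> sets \<mu>0"
        using N(1) by (intro sets.finite_UN) (auto simp: I_def \<mu>0)
      then show ?thesis
        unfolding em[OF borel_open[OF open_ball]] by (intro emeasure_mono cell_I N(4))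
    qed
    also have "\<dots> \<le> (\<Sum>p\<in>N. emeasure \<mu>0 (I p))"
      using N(1) by (intro emeasure_subadditive_finite) (auto simp: I_def \<mu>0)
    also have "\<dots> \<le> (\<Sum>p\<in>N. ennreal (wt s k / v 0 0))"
      using N(3) g_wt[of k] unfolding I by (intro sum_mono ennreal_leI) auto
    also have "\<dots> = ennreal (real (card N) * (wt s k / v 0 0))"
      by (simp add: ennreal_of_nat_eq_real_of_nat flip: ennreal_mult')
    also have "\<dots> \<le> ennreal (9 / v 0 0 * wt s k)"
      using N(2) wt_pos[of s k] v0 by (intro ennreal_leI) (simp add: divide_right_mono mult_right_mono)
    finally show ?thesis
      using wt_pos[of s k] v0 by (simp add: measure_def enn2real_leI)
  qed
  moreover have "sets \<mu> = sets borel" by (simp add: \<mu>_def)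
  ultimately show ?thesis using prob v0 by (intro exI[of _ \<mu>] exI[of _ "9 / v 0 0"]) simp
qed

section \<open>Energy, content and the choice of block radii\<close>

lemma dyadic_scale:
  assumes "0 < d" "d < 1" shows "\<exists>m. (1/2) ^ Suc m \<le> d \<and> d < ((1/2) ^ m :: real)"
proof -
  define n where "n = (LEAST n. (1/2) ^ n \<le> d)"
  have ex: "\<exists>n. (1/2) ^ n \<le> d" using real_arch_pow_inv[of d "1/2"] assms by (auto intro: less_imp_le)
  have n: "(1/2) ^ n \<le> d" unfolding n_def using ex by (rule LeastI_ex)
  then have "n \<noteq> 0" using assms by (cases n) auto
  then obtain m where m: "n = Suc m" using not0_implies_Suc by blast
  then have "\<not> (1/2) ^ m \<le> d" using not_less_Least[of m "\<lambda>n. (1/2) ^ n \<le> d"] by (simp add: n_def)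
  then show ?thesis using n m by auto
qed

text \<open>
  A dyadic substitute for \<open>dist x y powr - t\<close> at scales up to \<open>(1/2) ^ j\<close>. In contrast to \<open>powr\<close>, which
  is \<open>0\<close> at base \<open>0\<close>, it is infinite on the diagonal.
\<close>

definition kern :: "nat \<Rightarrow> real \<Rightarrow> circle \<Rightarrow> circle \<Rightarrow> ennreal" where
  "kern j t x y = (\<Sum>m. ennreal (2 powr (t * real (m + j))) * indicator {y. dist x y < (1/2) ^ (m + j)} y)"

lemma measurable_dist_less [measurable]:
  "Measurable.pred (borel \<Otimes>\<^sub>M borel) (\<lambda>(x::circle, y). dist x y < r)"
  by measurable

lemma measurable_kern [measurable]:
  "(\<lambda>(x, y). kern j t x y) \<in> borel_measurable (borel \<Otimes>\<^sub>M borel)"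
  unfolding kern_def by measurable

lemma kern_ge:
  assumes "dist x y < (1/2) ^ (m + j)"
  shows "ennreal (2 powr (t * real (m + j))) \<le> kern j t x y"
proof -
  have "(\<Sum>i\<in>{m}. ennreal (2 powr (t * real (i + j))) * indicator {y. dist x y < (1/2) ^ (i + j)} y) \<le> kern j t x y"
    unfolding kern_def by (intro sum_le_suminf) auto
  then show ?thesis using assms by simp
qed

text \<open>By Markov's inequality, points outside a set of mass at most 1/4 have potential at most
  4 M, hence balls of radius 2^(-m) around them have mass at most \<open>4 * M * wt t m\<close>. The
  remaining mass of at least 1/4 is paid by the covering sets, each at most 4 M 2^t times the t-th
  power of its diameter; 2^t comes from rounding the diameter to a dyadic radius.\<close>

lemma energy_content_bound:
  fixes \<nu> :: "circle measure"
  assumes \<nu>: "finite_measure \<nu>" "sets \<nu> = sets borel" and t: "0 < t" and M: "0 < M"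
    and E: "E \<in> sets borel" "emeasure \<nu> (- E) = 0"
    and mass: "ennreal (1/2) \<le> emeasure \<nu> UNIV"
    and energy: "(\<integral>\<^sup>+x. \<integral>\<^sup>+y. kern 0 t x y \<partial>\<nu> \<partial>\<nu>) \<le> ennreal M"
    and cov: "E \<subseteq> (\<Union>i. U i)"
  shows "ennreal (1 / (16 * M * 2 powr t)) \<le> (\<Sum>i. ennreal (diameter (U i) powr t))"
proof -
  interpret finite_measure \<nu> by fact
  note [measurable_cong] = \<nu>(2)
  have space: "space \<nu> = UNIV" using sets_eq_imp_space_eq[OF \<nu>(2)] by simp
  define pot where "pot x = (\<integral>\<^sup>+y. kern 0 t x y \<partial>\<nu>)" for x
  have pot_meas[measurable]: "pot \<in> borel_measurable borel" unfolding pot_def by measurable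
  define bad where "bad = {x\<in>space \<nu>. 1 \<le> ennreal (1 / (4 * M)) * pot x}"
  have bad_meas: "bad \<in> sets \<nu>" unfolding bad_def by measurable
  have "emeasure \<nu> bad \<le> ennreal (1 / (4 * M)) * (\<integral>\<^sup>+x. pot x \<partial>\<nu>)"
    unfolding bad_def using nn_integral_Markov_inequality[of pot "space \<nu>" \<nu> "ennreal (1 / (4 * M))"]
    by (auto simp: space)
  also have "\<dots> \<le> ennreal (1 / (4 * M)) * ennreal M"
    using energy unfolding pot_def by (intro mult_left_mono) auto
  also have "\<dots> = ennreal (1/4)" using M by (simp flip: ennreal_mult)
  finally have bad: "emeasure \<nu> bad \<le> ennreal (1/4)" .
  have ball_le: "emeasure \<nu> (ball x ((1/2) ^ m)) \<le> ennreal (4 * M * wt t m)" if x: "x \<notin> bad" for x m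
  proof -
    have "\<not> 1 \<le> ennreal (1 / (4 * M)) * pot x" using x by (simp add: bad_def space)
    then have "ennreal (1 / (4 * M)) * pot x \<le> 1" by simp
    then have "ennreal (4 * M) * (ennreal (1 / (4 * M)) * pot x) \<le> ennreal (4 * M) * 1"
      by (intro mult_left_mono) auto
    moreover have "ennreal (4 * M) * ennreal (1 / (4 * M)) = 1" using M by (simp flip: ennreal_mult)
    ultimately have pot: "pot x \<le> ennreal (4 * M)" by (simp flip: mult.assoc)
    have "ennreal (2 powr (t * real m)) * emeasure \<nu> (ball x ((1/2) ^ m))
        = (\<integral>\<^sup>+y. ennreal (2 powr (t * real m)) * indicator (ball x ((1/2) ^ m)) y \<partial>\<nu>)"
      by (rule nn_integral_cmult_indicator[symmetric]) (simp add: \<nu>)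
    also have "\<dots> \<le> pot x" unfolding pot_def
      using kern_ge[of x _ m 0 t] by (intro nn_integral_mono) (auto simp: indicator_def)
    also have "\<dots> \<le> ennreal (4 * M)" by (rule pot)
    finally have "ennreal (wt t m) * (ennreal (2 powr (t * real m)) * emeasure \<nu> (ball x ((1/2) ^ m)))
       \<le> ennreal (wt t m) * ennreal (4 * M)" by (intro mult_left_mono) auto
    moreover have "ennreal (wt t m) * ennreal (2 powr (t * real m)) = 1"
      by (simp add: wt_def flip: ennreal_mult powr_add)
    moreover have "ennreal (wt t m) * ennreal (4 * M) = ennreal (4 * M * wt t m)"
      using M wt_pos[of t m] by (simp add: mult.commute flip: ennreal_mult)
    ultimately show ?thesis by (simp only: mult.assoc[symmetric] mult_1_left)
  qed
  \<comment> \<open>Covering sets need not be measurable. One with a point outside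
    \<open>bad\<close> is replaced by a ball around that point, or by the point itself; the others
    contribute nothing.\<close>
  have "\<exists>V. V \<in> sets \<nu> \<and> S - bad \<subseteq> V \<and> emeasure \<nu> V \<le> ennreal (4 * M * 2 powr t * diameter S powr t)" for S
  proof (cases "S - bad = {}")
    case True then show ?thesis by (intro exI[of _ "{}"]) auto
  next
    case False
    then obtain x where x: "x \<in> S" "x \<notin> bad" by auto
    have dS: "dist x y \<le> diameter S" if "y \<in> S" for y
      using diameter_bounded_bound[OF circle_bounded x(1) that] .
    show ?thesis
    proof (cases "diameter S = 0")
      case True
      \<comment> \<open>Since \<open>0 powr t = 0\<close>, a one-point covering set is free, so it
        has to be shown that points outside \<open>bad\<close> are not atoms.\<close>
      have "emeasure \<nu> {x} \<le> ennreal (4 * M * wt t m)" for m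
        by (rule order_trans[OF emeasure_mono ball_le[OF x(2), of m]]) (auto simp: \<nu>)
      moreover have "(\<lambda>m. ennreal (4 * M * wt t m)) \<longlonglongrightarrow> ennreal (4 * M * 0)"
        by (intro tendsto_intros wt_tendsto_0 t)
      ultimately have "emeasure \<nu> {x} \<le> ennreal (4 * M * 0)"
        by (intro LIMSEQ_le_const) auto
      moreover have "S \<subseteq> {x}" using dS True by auto
      ultimately show ?thesis using True by (intro exI[of _ "{x}"]) (auto simp: \<nu>)
    next
      case False
      have "0 < diameter S" using False diameter_ge_0[OF circle_bounded, of S] by simp
      moreover have "diameter S \<le> 1/2" by (intro diameter_le_dist circle_dist_le_half) simp
      ultimately obtain m where m: "(1/2) ^ Suc m \<le> diameter S" "diameter S < (1/2) ^ m"
        using dyadic_scale[of "diameter S"] by auto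
      have "wt t m = 2 powr t * wt t (Suc m)"
        by (simp add: wt_def algebra_simps flip: powr_add)
      also have "wt t (Suc m) \<le> diameter S powr t"
        unfolding half_power_powr[symmetric] using m t by (intro powr_mono2) auto
      finally have "4 * M * wt t m \<le> 4 * M * 2 powr t * diameter S powr t" using M by simp
      moreover have "S \<subseteq> ball x ((1/2) ^ m)" using dS m by force
      ultimately show ?thesis
        using order_trans[OF ball_le[OF x(2), of m] ennreal_leI]
        by (intro exI[of _ "ball x ((1/2) ^ m)"]) (auto simp: \<nu>)
    qed
  qed
  then have "\<forall>i. \<exists>V. V \<in> sets \<nu> \<and> U i - bad \<subseteq> V \<and> emeasure \<nu> V \<le> ennreal (4 * M * 2 powr t * diameter (U i) powr t)"
    by blast
  from choice[OF this] obtain V where V: "\<forall>i. V i \<in> sets \<nu> \<and> U i - bad \<subseteq> V i \<and>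
      emeasure \<nu> (V i) \<le> ennreal (4 * M * 2 powr t * diameter (U i) powr t)" by blast
  let ?\<Sigma> = "\<Sum>i. ennreal (diameter (U i) powr t)"
  have "ennreal (1/4) + ennreal (1/4) = ennreal (1/2)" by (simp flip: ennreal_plus)
  also have "\<dots> \<le> emeasure \<nu> UNIV" by (rule mass)
  also have "\<dots> \<le> emeasure \<nu> (bad \<union> (- E) \<union> (\<Union>i. V i))"
  proof (rule emeasure_mono)
    show "UNIV \<subseteq> bad \<union> (- E) \<union> (\<Union>i. V i)" using cov V by blast
    show "bad \<union> (- E) \<union> (\<Union>i. V i) \<in> sets \<nu>"
      using bad_meas E V \<nu>(2) by (intro sets.Un sets.countable_UN) auto
  qed
  also have "\<dots> \<le> emeasure \<nu> (bad \<union> (- E)) + emeasure \<nu> (\<Union>i. V i)"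
    using bad_meas E V \<nu>(2) by (intro emeasure_subadditive sets.Un sets.countable_UN) auto
  also have "\<dots> \<le> (emeasure \<nu> bad + emeasure \<nu> (- E)) + (\<Sum>i. emeasure \<nu> (V i))"
    using bad_meas E V \<nu>(2)
    by (intro add_mono emeasure_subadditive emeasure_subadditive_countably) auto
  also have "\<dots> \<le> (ennreal (1/4) + 0) + (\<Sum>i. ennreal (4 * M * 2 powr t) * ennreal (diameter (U i) powr t))"
    using bad E V M by (intro add_mono suminf_le) (auto simp flip: ennreal_mult)
  also have "\<dots> = ennreal (1/4) + ennreal (4 * M * 2 powr t) * ?\<Sigma>" by simp
  finally have "ennreal (1/4) \<le> ennreal (4 * M * 2 powr t) * ?\<Sigma>"
    by (subst (asm) ennreal_add_left_cancel_le) auto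
  then have "ennreal (1 / (4 * M * 2 powr t)) * ennreal (1/4)
      \<le> ennreal (1 / (4 * M * 2 powr t)) * (ennreal (4 * M * 2 powr t) * ?\<Sigma>)"
    by (intro mult_left_mono) auto
  moreover have "ennreal (1 / (4 * M * 2 powr t)) * ennreal (4 * M * 2 powr t) = 1"
    using M by (simp flip: ennreal_mult)
  moreover have "ennreal (1 / (4 * M * 2 powr t)) * ennreal (1/4) = ennreal (1 / (16 * M * 2 powr t))"
    using M by (simp flip: ennreal_mult)
  ultimately show ?thesis by (simp only: mult.assoc[symmetric] mult_1_left)
qed


section \<open>Dimension bounds from content, and their passage to compact limits\<close>

lemma hausdorff_measure_0_mono:
  fixes E :: "circle set"
  assumes "0 < s" "s \<le> t" "hausdorff_measure s E = 0"
  shows "hausdorff_measure t E = 0"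
proof -
  have diam: "diameter U powr t \<le> diameter U powr s" for U :: "circle set"
  proof (rule powr_mono')
    show "0 \<le> diameter U" by (rule diameter_ge_0[OF circle_bounded])
    have "diameter U \<le> 1/2" by (intro diameter_le_dist circle_dist_le_half) simp
    then show "diameter U \<le> 1" by simp
  qed (rule assms)
  have "hausdorff_content t \<rho> E \<le> hausdorff_content s \<rho> E" for \<rho>
    unfolding hausdorff_content_def
    by (intro INF_mono) (auto intro!: suminf_le ennreal_leI diam)
  then have "hausdorff_measure t E \<le> hausdorff_measure s E"
    unfolding hausdorff_measure_def by (intro SUP_mono) auto
  then show ?thesis using assms by simp
qed

lemma hausdorff_dim_geI:
  fixes E :: "circle set"
  assumes t: "0 < t" and c: "0 < c"
    and cov: "\<And>U :: nat \<Rightarrow> circle set. E \<subseteq> (\<Union>i. U i) \<Longrightarrow> c \<le> (\<Sum>i. ennreal (diameter (U i) powr t))"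
  shows "ereal t \<le> hausdorff_dim E"
  unfolding hausdorff_dim_def
proof (rule INF_greatest)
  fix s assume "s \<in> {s. 0 < s \<and> hausdorff_measure s E = 0}"
  then have s: "0 < s" "hausdorff_measure s E = 0" by auto
  have "c \<le> hausdorff_content t 1 E"
    unfolding hausdorff_content_def by (intro INF_greatest cov) auto
  also have "\<dots> \<le> hausdorff_measure t E"
    unfolding hausdorff_measure_def by (intro SUP_upper) auto
  finally have "hausdorff_measure t E \<noteq> 0" using c by auto
  then have "\<not> s \<le> t" using hausdorff_measure_0_mono[OF s(1) _ s(2)] by blast
  then show "ereal t \<le> ereal s" by simp
qed

lemma hausdorff_dim_mono: "A \<subseteq> B \<Longrightarrow> hausdorff_dim A \<le> hausdorff_dim B"
proof -
  assume AB: "A \<subseteq> B"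
  have "hausdorff_content s \<rho> A \<le> hausdorff_content s \<rho> B" for s \<rho>
    unfolding hausdorff_content_def using AB by (intro INF_superset_mono) auto
  then have le: "hausdorff_measure s A \<le> hausdorff_measure s B" for s
    unfolding hausdorff_measure_def by (intro SUP_mono) auto
  have "hausdorff_measure s A = 0" if "hausdorff_measure s B = 0" for s
    using le[of s] that by simp
  then show ?thesis
    unfolding hausdorff_dim_def by (intro INF_superset_mono) auto
qed

text \<open>Prepares a cover for a compactness argument: open sets at an arbitrarily small extra
  cost, obtained by a small uniform thickening.\<close>

lemma enlarge_open:
  fixes S :: "circle set"
  assumes t: "0 < t" and e: "0 < e"
  shows "\<exists>V. open V \<and> S \<subseteq> V \<and> diameter V powr t \<le> diameter S powr t + e"
proof -
  have d0: "0 \<le> diameter S" by (rule diameter_ge_0[OF circle_bounded])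
  have "((\<lambda>\<eta>. (diameter S + 2 * \<eta>) powr t) \<longlongrightarrow> (diameter S + 2 * 0) powr t) (at_right 0)"
  proof (rule tendsto_powr')
    \<comment> \<open>When the diameter is 0, continuity of the power at base 0 comes from
      \<open>0 < t\<close> and nonnegative bases.\<close>
    show "diameter S + 2 * 0 \<noteq> 0 \<or> 0 < t \<and> (\<forall>\<^sub>F \<eta> in at_right 0. 0 \<le> diameter S + 2 * \<eta>)"
      using t d0 by (auto intro!: eventually_at_rightI[of 0 1])
  qed (auto intro!: tendsto_eq_intros)
  then have "\<forall>\<^sub>F \<eta> in at_right 0. (diameter S + 2 * \<eta>) powr t < diameter S powr t + e"
    using e by (intro order_tendstoD(2)) auto
  then have "\<forall>\<^sub>F \<eta> in at_right 0. 0 < \<eta> \<and> (diameter S + 2 * \<eta>) powr t < diameter S powr t + e"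
    by (intro eventually_conj eventually_at_right_less)
  then obtain \<eta> where \<eta>: "0 < \<eta>" "(diameter S + 2 * \<eta>) powr t < diameter S powr t + e"
    using eventually_happens[of _ "at_right (0::real)"] by auto
  define V where "V = (\<Union>u\<in>S. ball u \<eta>)"
  have "diameter V \<le> diameter S + 2 * \<eta>"
  proof (rule diameter_le_dist)
    show "0 \<le> diameter S + 2 * \<eta>" using d0 \<eta> by simp
    fix x y assume "x \<in> V" "y \<in> V"
    then obtain u v where "u \<in> S" "v \<in> S" "dist u x < \<eta>" "dist v y < \<eta>" by (auto simp: V_def)
    moreover have "dist u v \<le> diameter S"
      using diameter_bounded_bound[OF circle_bounded] calculation by blast
    moreover have "dist x y \<le> dist u x + dist u v + dist v y"
      using dist_triangle[of x y u] dist_triangle[of u y v] by (simp add: dist_commute)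
    ultimately show "dist x y \<le> diameter S + 2 * \<eta>" by linarith
  qed
  then have "diameter V powr t \<le> (diameter S + 2 * \<eta>) powr t"
    using t by (intro powr_mono2 diameter_ge_0[OF circle_bounded]) auto
  moreover have "open V" "S \<subseteq> V" using \<eta> by (auto simp: V_def)
  ultimately show ?thesis using \<eta>(2) by (intro exI[of _ V]) auto
qed

text \<open>Once thickened to an open cover, a cover of the intersection covers some
  \<open>F m\<close> by compactness, and the content bound for \<open>F m\<close> applies. The bound
  must therefore have the same constant for all n.\<close>

lemma hausdorff_dim_INT_compact:
  fixes F :: "nat \<Rightarrow> circle set"
  assumes t: "0 < t" and c: "0 < c" and F: "\<And>n. compact (F n)" "decseq F"
    and cov: "\<And>n U. F n \<subseteq> (\<Union>i::nat. U i) \<Longrightarrow> c \<le> (\<Sum>i. ennreal (diameter (U i) powr t))"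
  shows "ereal t \<le> hausdorff_dim (\<Inter>n. F n)"
proof (rule hausdorff_dim_geI[OF t c])
  fix U :: "nat \<Rightarrow> circle set" assume U: "(\<Inter>n. F n) \<subseteq> (\<Union>i. U i)"
  show "c \<le> (\<Sum>i. ennreal (diameter (U i) powr t))"
  proof (rule ennreal_le_epsilon)
    fix e :: real assume e: "0 < e"
    have "\<forall>i. \<exists>V. open V \<and> U i \<subseteq> V \<and> diameter V powr t \<le> diameter (U i) powr t + e * (1/2) ^ Suc i"
      using e by (intro allI enlarge_open[OF t]) auto
    from choice[OF this] obtain V where V: "\<forall>i. open (V i) \<and> U i \<subseteq> V i \<and>
        diameter (V i) powr t \<le> diameter (U i) powr t + e * (1/2) ^ Suc i" by blast
    define W where "W = (\<Union>i. V i)"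
    have W: "open W" using V unfolding W_def by blast
    have "F 0 \<subseteq> (\<Union>n\<in>UNIV. W \<union> - F n)"
      using U V unfolding W_def by blast
    then obtain C where C: "finite C" "F 0 \<subseteq> (\<Union>n\<in>C. W \<union> - F n)"
      using compactE_image[OF F(1)[of 0], of UNIV "\<lambda>n. W \<union> - F n"] W F(1)
      by (metis (no_types, lifting) compact_imp_closed open_Compl open_Un)
    define m where "m = Max (insert 0 C)"
    have "F m \<subseteq> F n" if "n \<in> C" for n
      using decseqD[OF F(2), of n m] that C(1) by (auto simp: m_def)
    then have "F m \<subseteq> W" using C(2) decseqD[OF F(2), of 0 m] by blast
    then have "F m \<subseteq> (\<Union>i. V i)" unfolding W_def by blast
    then have "c \<le> (\<Sum>i. ennreal (diameter (V i) powr t))" by (rule cov)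
    also have "\<dots> \<le> (\<Sum>i. ennreal (diameter (U i) powr t) + ennreal (e * (1/2) ^ Suc i))"
    proof (intro suminf_le)
      fix i
      have "ennreal (diameter (V i) powr t) \<le> ennreal (diameter (U i) powr t + e * (1/2) ^ Suc i)"
        using V by (intro ennreal_leI) blast
      also have "\<dots> = ennreal (diameter (U i) powr t) + ennreal (e * (1/2) ^ Suc i)"
        using e by (intro ennreal_plus) auto
      finally show "ennreal (diameter (V i) powr t) \<le> \<dots>" .
    qed auto
    also have "\<dots> = (\<Sum>i. ennreal (diameter (U i) powr t)) + (\<Sum>i. ennreal (e * (1/2) ^ Suc i))"
      by (rule suminf_add[symmetric]) auto
    also have "(\<Sum>i. ennreal (e * (1/2) ^ Suc i)) = ennreal e"
      using e sums_mult[OF power_half_series, of e] by (intro suminf_ennreal_eq) auto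
    finally show "c \<le> (\<Sum>i. ennreal (diameter (U i) powr t)) + ennreal e" .
  qed
qed


section \<open>Sparse times and block radii\<close>

lemma frequently_of_liminf_less:
  assumes "liminf (\<lambda>n. ereal (u n)) < ereal a" shows "\<exists>\<^sub>F n in sequentially. u n < a"
proof (rule ccontr)
  assume "\<not> (\<exists>\<^sub>F n in sequentially. u n < a)"
  then have "\<forall>\<^sub>F n in sequentially. ereal a \<le> ereal (u n)"
    by (simp add: not_frequently not_less)
  then have "ereal a \<le> liminf (\<lambda>n. ereal (u n))" by (rule Liminf_bounded)
  then show False using assms by simp
qed

text \<open>At the infinitely many n with n * l n < a * ln n, the factor (1 - l n)^(-n) is of order
  at most n^a, whereas \<open>l n powr (- b)\<close> is at least (n / (a * ln n))^b. As a < b, a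
  power of n is left over, which beats any prescribed \<open>w\<close>.\<close>

lemma exists_good_radius:
  fixes l :: "nat \<Rightarrow> real"
  assumes l: "\<And>n. 1 \<le> n \<Longrightarrow> 0 < l n \<and> l n < 1"
    and liminf: "liminf (\<lambda>n. ereal (real n * l n / ln (real n))) < ereal a"
    and ab: "0 < a" "a < b" and \<eta>: "0 < \<eta>"
  shows "\<exists>n>n0. l n \<le> \<eta> \<and> w * (1 / (1 - l n)) ^ n \<le> l n powr (- b)"
proof -
  define L where "L n = a * ln (real n) / real n" for n
  have "L \<longlonglongrightarrow> 0" unfolding L_def[abs_def] by real_asymp
  then have 1: "\<forall>\<^sub>F n in sequentially. L n < min \<eta> (1/2)" using \<eta> by (intro order_tendstoD) auto
  \<comment> \<open>At the chosen n this bounds \<open>(1 / (1 - l n)) ^ n * L n powr b\<close>. The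
    exponential collects the error in \<open>- ln (1 - x) \<le> x + 2 * x\<^sup>2\<close>, valid for
    x up to 1/2.\<close>
  have "(\<lambda>n::nat. a powr b * ln (real n) powr b * (real n powr (a - b)) * exp (2 * a\<^sup>2 * ln (real n) ^ 2 / real n)) \<longlonglongrightarrow> 0"
    using ab by real_asymp
  then have "(\<lambda>n::nat. w * (a powr b * ln (real n) powr b * (real n powr (a - b)) * exp (2 * a\<^sup>2 * ln (real n) ^ 2 / real n))) \<longlonglongrightarrow> w * 0"
    by (intro tendsto_intros)
  then have 2: "\<forall>\<^sub>F n in sequentially. w * (a powr b * ln (real n) powr b * (real n powr (a - b)) * exp (2 * a\<^sup>2 * ln (real n) ^ 2 / real n)) < 1"
    by (rule order_tendstoD) simp
  have 3: "\<forall>\<^sub>F n in sequentially. n > max n0 2" by (rule eventually_gt_at_top)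
  obtain n where n: "real n * l n / ln (real n) < a" "L n < min \<eta> (1/2)" "n > max n0 2"
      "w * (a powr b * ln (real n) powr b * (real n powr (a - b)) * exp (2 * a\<^sup>2 * ln (real n) ^ 2 / real n)) < 1"
    using frequently_eventually_frequently[OF frequently_of_liminf_less[OF liminf]
        eventually_conj[OF 1 eventually_conj[OF 2 3]]] by (auto dest!: frequently_ex)
  have ln: "0 < ln (real n)" using n by simp
  have ln_le: "l n \<le> L n" using n ln unfolding L_def by (simp add: field_simps)
  have l0: "0 < l n" "l n < 1" using l[of n] n by auto
  have L0: "0 < L n" using l0 ln_le by linarith
  have "(1 / (1 - l n)) ^ n = exp (real n * (- ln (1 - l n)))"
    using l0 by (simp add: exp_minus exp_of_nat_mult power_one_over inverse_eq_divide)
  also have "\<dots> \<le> exp (real n * (L n + 2 * (L n)\<^sup>2))"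
  proof -
    have "- ln (1 - l n) \<le> l n + 2 * (l n)\<^sup>2"
      using ln_one_minus_pos_lower_bound[of "l n"] l0 ln_le n(2) by simp
    also have "\<dots> \<le> L n + 2 * (L n)\<^sup>2" using ln_le l0 by (intro add_mono mult_left_mono power_mono) auto
    finally have "real n * (- ln (1 - l n)) \<le> real n * (L n + 2 * (L n)\<^sup>2)"
      by (intro mult_left_mono) auto
    then show ?thesis by (simp only: exp_le_cancel_iff)
  qed
  also have "\<dots> = real n powr a * exp (2 * a\<^sup>2 * ln (real n) ^ 2 / real n)"
    using n by (simp add: L_def powr_def power2_eq_square field_simps flip: exp_add)
  finally have A: "(1 / (1 - l n)) ^ n \<le> real n powr a * exp (2 * a\<^sup>2 * ln (real n) ^ 2 / real n)" .
  have B: "L n powr (- b) \<le> l n powr (- b)"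
    using l0 ln_le ab by (intro powr_mono2') auto
  have Lb: "L n powr b = a powr b * ln (real n) powr b * real n powr (- b)"
    using ab ln n by (simp add: L_def powr_divide powr_mult powr_minus_divide)
  have "w * (1 / (1 - l n)) ^ n \<le> l n powr (- b)"
  proof (cases "w \<le> 0")
    case True
    have "0 \<le> (1 / (1 - l n)) ^ n" using l0 by simp
    then have "w * (1 / (1 - l n)) ^ n \<le> 0" using True by (simp add: mult_nonpos_nonneg)
    then show ?thesis by (rule order_trans) simp
  next
    case False
    then have "w * (1 / (1 - l n)) ^ n \<le> w * (real n powr a * exp (2 * a\<^sup>2 * ln (real n) ^ 2 / real n))"
      using A by (intro mult_left_mono) auto
    also have "\<dots> = (w * (a powr b * ln (real n) powr b * (real n powr (a - b)) * exp (2 * a\<^sup>2 * ln (real n) ^ 2 / real n))) * L n powr (- b)"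
    proof -
      have "L n powr b * L n powr (- b) = 1" using L0 by (simp flip: powr_add)
      moreover have "real n powr (a - b) = real n powr a * real n powr (- b)" by (simp flip: powr_add)
      ultimately show ?thesis unfolding Lb by (simp add: ac_simps)
    qed
    also have "\<dots> \<le> 1 * L n powr (- b)" using n(4) by (intro mult_right_mono) auto
    finally show ?thesis using B by simp
  qed
  then show ?thesis using n ln_le by (intro exI[of _ n]) auto
qed

text \<open>Times are chosen recursively together with a number \<open>W j\<close> that bounds the
  product of all factors up to \<open>N j\<close> and is at most \<open>l (N j) powr (- b)\<close>.
  The next time is taken so late that \<open>W j\<close>, in the role of the prescribed factor, is
  absorbed.\<close>

lemma block_radii:
  fixes l :: "nat \<Rightarrow> real"
  assumes l: "\<And>n. 1 \<le> n \<Longrightarrow> 0 < l n \<and> l n < 1"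
    and decr: "\<And>m n. 1 \<le> m \<Longrightarrow> m \<le> n \<Longrightarrow> l n \<le> l m"
    and liminf: "liminf (\<lambda>n. ereal (real n * l n / ln (real n))) < ereal a"
    and ab: "0 < a" "a < b" and \<eta>: "0 < \<eta>"
  shows "\<exists>lam N. strict_mono (N :: nat \<Rightarrow> nat) \<and> (\<forall>j. 1 \<le> N j) \<and> (\<forall>k. 0 < lam k \<and> lam k < 1 \<and> lam k \<le> \<eta>)
    \<and> (\<forall>j k. k \<le> N j \<longrightarrow> l (N j) \<le> lam k)
    \<and> (\<forall>n d. 0 < d \<longrightarrow> (\<Prod>k\<in>{k\<in>{1..n}. d < lam k}. 1 / (1 - lam k)) \<le> max 1 (d powr (- b)))"
proof -
  define q where "q n = (1 / (1 - l n)) ^ n" for n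
  have step: "\<exists>n>n0. l n \<le> \<eta> \<and> w * q n \<le> l n powr (- b)" for n0 w
    unfolding q_def by (rule exists_good_radius[OF l liminf ab \<eta>])
  define P where "P p \<longleftrightarrow> 1 \<le> fst p \<and> l (fst p) \<le> \<eta> \<and> 0 < snd p \<and> snd p \<le> l (fst p) powr (- b)" for p :: "nat \<times> real"
  define Q where "Q p p' \<longleftrightarrow> fst p < fst p' \<and> snd p' = snd p * q (fst p')" for p p' :: "nat \<times> real"
  have q_pos: "0 < q n" if "1 \<le> n" for n using l[OF that] by (simp add: q_def)
  obtain n where n: "n > 0" "l n \<le> \<eta>" "1 * q n \<le> l n powr (- b)" using step by blast
  \<comment> \<open>The recursion must start exactly at \<open>q n\<close>: the base case of
    \<open>prod_W\<close> needs this value, which \<open>P\<close> alone would not fix.\<close>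
  define R where "R j p \<longleftrightarrow> P p \<and> (j = 0 \<longrightarrow> p = (n, q n))" for j :: nat and p
  have "\<exists>s. \<forall>j. R j (s j) \<and> Q (s j) (s (Suc j))"
  proof (rule dependent_nat_choice)
    show "\<exists>p. R 0 p" using n q_pos[of n] by (intro exI[of _ "(n, q n)"]) (simp add: P_def R_def)
    show "\<exists>p'. R (Suc j) p' \<and> Q p p'" if "R j p" for p j
    proof -
      obtain m where "m > fst p" "l m \<le> \<eta>" "snd p * q m \<le> l m powr (- b)" using step by blast
      then show ?thesis
        using \<open>R j p\<close> q_pos[of m] by (intro exI[of _ "(m, snd p * q m)"]) (auto simp: P_def Q_def R_def)
    qed
  qed
  then obtain s where s: "s 0 = (n, q n)" "\<And>j. P (s j)" "\<And>j. Q (s j) (s (Suc j))"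
    unfolding R_def by blast
  define N where "N j = fst (s j)" for j
  define W where "W j = snd (s j)" for j
  have N: "strict_mono N" unfolding strict_mono_Suc_iff N_def using s(3) by (simp add: Q_def)
  have N1: "1 \<le> N j" for j using s(2)[of j] by (simp add: P_def N_def)
  have W_le: "W j \<le> l (N j) powr (- b)" for j using s(2)[of j] by (simp add: P_def N_def W_def)
  have W_Suc: "W (Suc j) = W j * q (N (Suc j))" for j using s(3)[of j] by (simp add: Q_def N_def W_def)
  have W_pos: "0 < W j" for j using s(2)[of j] by (simp add: P_def W_def)
  define i where "i k = (LEAST j. k \<le> N j)" for k
  have i: "k \<le> N (i k)" for k unfolding i_def
    by (rule LeastI[of _ k]) (rule strict_mono_imp_increasing[OF N])
  have i_le: "i k \<le> j" if "k \<le> N j" for k j unfolding i_def using that by (rule Least_le)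
  define lam where "lam k = l (N (i k))" for k
  have lam: "0 < lam k" "lam k < 1" "lam k \<le> \<eta>" for k
    using l[OF N1] s(2)[of "i k"] by (auto simp: lam_def P_def N_def)
  have lam_ge: "l (N j) \<le> lam k" if "k \<le> N j" for j k
    unfolding lam_def using i_le[OF that] N1 N by (intro decr) (auto simp: strict_mono_less_eq)
  have fac: "1 \<le> 1 / (1 - lam k)" for k using lam[of k] by simp
  have prod_W: "(\<Prod>k\<in>{1..N j}. 1 / (1 - lam k)) \<le> W j" for j
  proof (induction j)
    case 0
    have "(\<Prod>k\<in>{1..N 0}. 1 / (1 - lam k)) = (\<Prod>k\<in>{1..N 0}. 1 / (1 - l (N 0)))"
    proof (intro prod.cong refl)
      fix k assume "k \<in> {1..N 0}"
      then have "i k = 0" using i_le[of k 0] by simp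
      then show "1 / (1 - lam k) = 1 / (1 - l (N 0))" by (simp add: lam_def)
    qed
    then show ?case using s(1) by (simp add: W_def N_def q_def)
  next
    case (Suc j)
    have lt: "N j < N (Suc j)" using N by (simp add: strict_mono_Suc_iff)
    have "{1..N (Suc j)} = {1..N j} \<union> {N j<..N (Suc j)}" using lt by auto
    then have "(\<Prod>k\<in>{1..N (Suc j)}. 1 / (1 - lam k))
        = (\<Prod>k\<in>{1..N j}. 1 / (1 - lam k)) * (\<Prod>k\<in>{N j<..N (Suc j)}. 1 / (1 - lam k))"
      by (simp only:) (intro prod.union_disjoint, auto)
    also have "(\<Prod>k\<in>{N j<..N (Suc j)}. 1 / (1 - lam k)) = (\<Prod>k\<in>{N j<..N (Suc j)}. 1 / (1 - l (N (Suc j))))"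
    proof (intro prod.cong refl)
      fix k assume k: "k \<in> {N j<..N (Suc j)}"
      then have "i k \<le> Suc j" using i_le[of k "Suc j"] by simp
      moreover have "\<not> i k \<le> j"
      proof
        assume "i k \<le> j"
        then have "N (i k) \<le> N j" using N by (simp add: strict_mono_less_eq)
        then show False using i[of k] k by simp
      qed
      ultimately have "i k = Suc j" by simp
      then show "1 / (1 - lam k) = 1 / (1 - l (N (Suc j)))" by (simp add: lam_def)
    qed
    \<comment> \<open>The block has at most \<open>N (Suc j)\<close> members and each factor is at
      least 1, so the full power in \<open>q\<close> is an upper bound.\<close>
    also have "\<dots> \<le> q (N (Suc j))"
      unfolding q_def prod_constant using l[OF N1, of "Suc j"] by (intro power_increasing) auto
    finally have "(\<Prod>k\<in>{1..N (Suc j)}. 1 / (1 - lam k)) \<le> (\<Prod>k\<in>{1..N j}. 1 / (1 - lam k)) * q (N (Suc j))"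
      using lam by (simp add: mult_left_mono prod_nonneg less_imp_le)
    also have "\<dots> \<le> W (Suc j)"
      unfolding W_Suc using Suc q_pos[OF N1] by (intro mult_right_mono) (auto intro: less_imp_le)
    finally show ?case .
  qed
  have "(\<Prod>k\<in>{k\<in>{1..n}. d < lam k}. 1 / (1 - lam k)) \<le> max 1 (d powr (- b))" if d: "0 < d" for n d
  proof (cases "{k\<in>{1..n}. d < lam k} = {}")
    case True
    show ?thesis unfolding True by simp
  next
    case False
    define S where "S = {k\<in>{1..n}. d < lam k}"
    have S: "finite S" "S \<noteq> {}" using False by (auto simp: S_def)
    \<comment> \<open>The last arc longer than \<open>d\<close>. The product is extended to the end
      of its block, where it is at most \<open>lam m powr (- b)\<close>, and \<open>lam m\<close>
      exceeds \<open>d\<close>.\<close>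
    define m where "m = Max S"
    have m: "m \<in> S" unfolding m_def using S by (rule Max_in)
    have "S \<subseteq> {1..N (i m)}"
    proof
      fix k assume "k \<in> S"
      then have "1 \<le> k" "k \<le> m" using S by (auto simp: m_def S_def)
      then show "k \<in> {1..N (i m)}" using i[of m] by simp
    qed
    then have "(\<Prod>k\<in>S. 1 / (1 - lam k)) \<le> (\<Prod>k\<in>{1..N (i m)}. 1 / (1 - lam k))"
      using fac lam by (intro prod_mono2) (auto simp: less_imp_le)
    also have "\<dots> \<le> lam m powr (- b)" using prod_W[of "i m"] W_le[of "i m"] by (simp add: lam_def)
    also have "\<dots> \<le> d powr (- b)" using m d ab by (intro powr_mono2') (auto simp: S_def)
    finally show ?thesis unfolding S_def by simp
  qed
  then show ?thesis using N N1 lam lam_ge by blast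
qed

section \<open>Random uncovered sets\<close>

locale iid_uniform = prob_space M for M :: "'w measure" +
  fixes X :: "nat \<Rightarrow> 'w \<Rightarrow> circle"
  assumes indep: "indep_vars (\<lambda>_. borel) X {1..}"
    and unif: "\<And>n. n \<ge> 1 \<Longrightarrow> distr M borel (X n) = circle_uniform"
begin

lemma measurable_X: "1 \<le> k \<Longrightarrow> X k \<in> M \<rightarrow>\<^sub>M borel"
  using indep by (auto simp: indep_vars_def)

lemma measurable_X_Suc [measurable]: "X (Suc k) \<in> M \<rightarrow>\<^sub>M borel"
  by (rule measurable_X) simp

lemma prob_all_in:
  assumes B: "\<And>k. k \<in> {1..n} \<Longrightarrow> B k \<in> sets borel"
  shows "prob {w\<in>space M. \<forall>k\<in>{1..n}. X k w \<in> B k} = (\<Prod>k\<in>{1..n}. measure circle_uniform (B k))"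
proof (cases "n = 0")
  case True then show ?thesis by (simp add: prob_space)
next
  case False
  have "{w\<in>space M. \<forall>k\<in>{1..n}. X k w \<in> B k} = (\<Inter>k\<in>{1..n}. X k -` B k \<inter> space M)"
    using False by auto
  also have "prob \<dots> = (\<Prod>k\<in>{1..n}. prob (X k -` B k \<inter> space M))"
    using False B by (intro indep_varsD[OF indep]) auto
  also have "\<dots> = (\<Prod>k\<in>{1..n}. measure circle_uniform (B k))"
  proof (intro prod.cong refl)
    fix k assume k: "k \<in> {1..n}"
    then have "measure circle_uniform (B k) = measure (distr M borel (X k)) (B k)" using unif by simp
    also have "\<dots> = prob (X k -` B k \<inter> space M)"
      using k B by (intro measure_distr measurable_X) auto
    finally show "prob (X k -` B k \<inter> space M) = measure circle_uniform (B k)" by simp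
  qed
  finally show ?thesis .
qed

text \<open>The parameters are arc lengths, like the values of \<open>l\<close>, so radii are their
  halves. Removing open arcs leaves a closed set, as the compactness argument requires.\<close>

definition uncov :: "(nat \<Rightarrow> real) \<Rightarrow> nat \<Rightarrow> 'w \<Rightarrow> circle set" where
  "uncov lam n w = {x. \<forall>k\<in>{1..n}. lam k / 2 \<le> dist (X k w) x}"

text \<open>The shift makes measurability proofs meet only variables of the form
  \<open>X (Suc k)\<close>; nothing is assumed about \<open>X 0\<close>.\<close>

lemma uncov_Suc: "uncov lam n w = {x. \<forall>k<n. lam (Suc k) / 2 \<le> dist (X (Suc k) w) x}"
  unfolding uncov_def image_Suc_lessThan[symmetric] by auto

lemma measurable_uncov [measurable]:
  "Measurable.pred (M \<Otimes>\<^sub>M borel) (\<lambda>(w, x). x \<in> uncov lam n w)"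
  unfolding uncov_Suc mem_Collect_eq by measurable

lemma closed_uncov: "closed (uncov lam n w)"
proof -
  have "uncov lam n w = (\<Inter>k\<in>{1..n}. {x. lam k / 2 \<le> dist (X k w) x})" by (auto simp: uncov_def)
  then show ?thesis by (auto intro!: closed_INT closed_Collect_le continuous_intros)
qed

lemma circle_uniform_not_ball:
  assumes "0 \<le> r" "r \<le> 1/2"
  shows "measure circle_uniform (- ball x r) = 1 - 2 * r"
proof -
  interpret U: prob_space circle_uniform by (rule prob_space_circle_uniform)
  have "space circle_uniform = UNIV" using sets_eq_imp_space_eq[OF sets_circle_uniform] by simp
  then show ?thesis
    using U.prob_compl[of "ball x r"] measure_circle_uniform_ball[OF assms]
    by (simp add: Compl_eq_Diff_UNIV)
qed

lemma circle_uniform_not_two_balls: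
  assumes "0 \<le> r" "r \<le> 1/2" "2 * r \<le> dist x y"
  shows "measure circle_uniform (- (ball x r \<union> ball y r)) = 1 - 4 * r"
proof -
  interpret U: prob_space circle_uniform by (rule prob_space_circle_uniform)
  have sp: "space circle_uniform = UNIV" using sets_eq_imp_space_eq[OF sets_circle_uniform] by simp
  have "ball x r \<inter> ball y r = {}"
  proof (rule ccontr)
    assume "ball x r \<inter> ball y r \<noteq> {}"
    then obtain z where "dist x z < r" "dist y z < r" by auto
    then show False using dist_triangle[of x y z] assms(3) by (simp add: dist_commute)
  qed
  then have "measure circle_uniform (ball x r \<union> ball y r) = 2 * r + 2 * r"
    using measure_circle_uniform_ball[OF assms(1,2)] by (subst U.finite_measure_Union) auto
  then show ?thesis
    using U.prob_compl[of "ball x r \<union> ball y r"] sp by (simp add: Compl_eq_Diff_UNIV)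
qed

lemma prob_uncov:
  assumes lam: "\<And>k. 0 < lam k \<and> lam k < 1"
  shows "prob {w\<in>space M. x \<in> uncov lam n w} = (\<Prod>k\<in>{1..n}. 1 - lam k)"
proof -
  have "{w\<in>space M. x \<in> uncov lam n w} = {w\<in>space M. \<forall>k\<in>{1..n}. X k w \<in> - ball x (lam k / 2)}"
    by (auto simp: uncov_def dist_commute not_less)
  also have "prob \<dots> = (\<Prod>k\<in>{1..n}. measure circle_uniform (- ball x (lam k / 2)))"
    by (rule prob_all_in) auto
  also have "\<dots> = (\<Prod>k\<in>{1..n}. 1 - lam k)"
    using lam by (intro prod.cong refl) (simp add: circle_uniform_not_ball less_imp_le)
  finally show ?thesis .
qed

text \<open>Each factor is compared with (1 - lam k)^2. If the two forbidden arcs for the centre are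
  disjoint, 1 - 2 * lam k is smaller; if they may overlap, one of them is ignored, at the cost of
  the factor 1 / (1 - lam k).\<close>

lemma prob_uncov_two:
  assumes lam: "\<And>k. 0 < lam k \<and> lam k < 1"
  shows "prob {w\<in>space M. x \<in> uncov lam n w \<and> y \<in> uncov lam n w}
    \<le> (\<Prod>k\<in>{1..n}. 1 - lam k)\<^sup>2 * (\<Prod>k\<in>{k\<in>{1..n}. dist x y < lam k}. 1 / (1 - lam k))"
proof -
  interpret U: prob_space circle_uniform by (rule prob_space_circle_uniform)
  have "{w\<in>space M. x \<in> uncov lam n w \<and> y \<in> uncov lam n w}
      = {w\<in>space M. \<forall>k\<in>{1..n}. X k w \<in> - (ball x (lam k / 2) \<union> ball y (lam k / 2))}"
    by (auto simp: uncov_def dist_commute not_less)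
  also have "prob \<dots> = (\<Prod>k\<in>{1..n}. measure circle_uniform (- (ball x (lam k / 2) \<union> ball y (lam k / 2))))"
    by (rule prob_all_in) auto
  also have "\<dots> \<le> (\<Prod>k\<in>{1..n}. (1 - lam k)\<^sup>2 * (if dist x y < lam k then 1 / (1 - lam k) else 1))"
  proof (intro prod_mono conjI measure_nonneg)
    fix k
    show "measure circle_uniform (- (ball x (lam k / 2) \<union> ball y (lam k / 2)))
        \<le> (1 - lam k)\<^sup>2 * (if dist x y < lam k then 1 / (1 - lam k) else 1)"
    proof (cases "dist x y < lam k")
      case True
      have "measure circle_uniform (- (ball x (lam k / 2) \<union> ball y (lam k / 2)))
          \<le> measure circle_uniform (- ball x (lam k / 2))"
        by (intro U.finite_measure_mono) auto
      also have "\<dots> = 1 - lam k" using lam[of k] by (simp add: circle_uniform_not_ball)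
      also have "\<dots> = (1 - lam k)\<^sup>2 * (1 / (1 - lam k))" using lam[of k] by (simp add: power2_eq_square)
      finally show ?thesis using True by simp
    next
      case False
      then have "measure circle_uniform (- (ball x (lam k / 2) \<union> ball y (lam k / 2))) = 1 - 2 * lam k"
        using lam[of k] circle_uniform_not_two_balls[of "lam k / 2" x y] by simp
      also have "\<dots> \<le> (1 - lam k)\<^sup>2" by (simp add: power2_eq_square algebra_simps)
      finally show ?thesis using False by simp
    qed
  qed
  also have "\<dots> = (\<Prod>k\<in>{1..n}. 1 - lam k)\<^sup>2 * (\<Prod>k\<in>{k\<in>{1..n}. dist x y < lam k}. 1 / (1 - lam k))"
    by (subst prod.inter_filter) (simp_all only: prod.distrib prod_power_distrib finite_atLeastAtMost)
  finally show ?thesis .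
qed

end

section \<open>Integrals of the dyadic kernel against a Frostman measure\<close>

lemma ennreal_eq_top_if_unbounded:
  assumes "\<And>m::nat. ennreal (r ^ m) \<le> z" "1 < r" shows "z = top"
proof (rule ccontr)
  assume "z \<noteq> top"
  then obtain u where u: "z = ennreal u" "0 \<le> u" by (cases z) auto
  obtain m where "u < r ^ m" using real_arch_pow[OF assms(2)] by blast
  then have "z < ennreal (r ^ m)" using u by (simp add: ennreal_less_iff)
  then show False using assms(1)[of m] by simp
qed

lemma kern_diag: "0 < b \<Longrightarrow> kern j b x x = top"
proof (rule ennreal_eq_top_if_unbounded)
  assume b: "0 < b"
  show "1 < 2 powr b" using b by simp
  fix m
  have "(2 powr b) ^ m = 2 powr (b * real m)" by (simp add: powr_power mult.commute)
  also have "\<dots> \<le> 2 powr (b * real (m + j))" using b by (intro powr_mono) auto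
  finally have "ennreal ((2 powr b) ^ m) \<le> ennreal (2 powr (b * real (m + j)))" by (rule ennreal_leI)
  also have "\<dots> \<le> kern j b x x" by (rule kern_ge) simp
  finally show "ennreal ((2 powr b) ^ m) \<le> kern j b x x" .
qed

text \<open>Three ranges: far pairs are covered by the summand 1, on the diagonal the kernel is
  infinite, and for close pairs one dyadic term of index at least j suffices, up to the factor 2^b.
  The excess over 1 is thus carried by pairs closer than 2^(-j).\<close>

lemma max_powr_le_kern:
  assumes b: "0 < b"
    and le: "0 < dist x y \<Longrightarrow> p \<le> max 1 (dist x y powr (- b))"
    and far: "(1/2) ^ j \<le> dist x y \<Longrightarrow> p \<le> 1"
  shows "ennreal p \<le> 1 + ennreal (2 powr b) * kern j b x y"
proof (cases "(1/2) ^ j \<le> dist x y")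
  case True
  then have "ennreal p \<le> 1" using far by simp
  then show ?thesis by (rule order_trans) simp
next
  case False
  show ?thesis
  proof (cases "dist x y = 0")
    case True
    then have "kern j b x y = top" using kern_diag[OF b] by simp
    then show ?thesis by (simp add: ennreal_mult_top)
  next
    case d: False
    then have d: "0 < dist x y" by simp
    have "dist x y < 1" using circle_dist_le_half[of x y] by simp
    then obtain m where m: "(1/2) ^ Suc m \<le> dist x y" "dist x y < (1/2) ^ m" using dyadic_scale[OF d] by blast
    have jm: "j \<le> m"
    proof (rule ccontr)
      assume "\<not> j \<le> m"
      then have "(1/2) ^ j \<le> ((1/2) ^ Suc m :: real)" by (intro power_decreasing) auto
      then show False using m False by simp
    qed
    have "dist x y powr (- b) \<le> ((1/2) ^ Suc m) powr (- b)" using m b by (intro powr_mono2') auto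
    also have "\<dots> = 2 powr b * 2 powr (b * real m)"
      unfolding half_power_powr wt_def by (simp add: algebra_simps flip: powr_add)
    finally have "dist x y powr (- b) \<le> 2 powr b * 2 powr (b * real m)" .
    then have "p \<le> 1 + 2 powr b * 2 powr (b * real m)"
      using le[OF d] by (auto simp: max_def split: if_splits intro: order_trans)
    then have "ennreal p \<le> 1 + ennreal (2 powr b) * ennreal (2 powr (b * real m))"
      using ennreal_leI by (fastforce simp: ennreal_plus ennreal_mult)
    also have "ennreal (2 powr (b * real m)) \<le> kern j b x y"
      using kern_ge[of x y "m - j" j b] m jm by simp
    finally show ?thesis by (simp add: mult_left_mono add_left_mono)
  qed
qed


text \<open>The smaller ball has exponent s at its own scale; splitting s = s1 + s2 charges one part
  to each of the two scales. This bounds the double series for a product of two kernels by a product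
  of two series.\<close>

lemma emeasure_ball_bounds:
  fixes \<mu> :: "circle measure"
  assumes ball: "\<And>x k. emeasure \<mu> (ball x ((1/2) ^ k)) \<le> ennreal (C * wt s k)"
    and C: "0 \<le> C" and s: "0 \<le> s1" "0 \<le> s2" "s = s1 + s2" and \<mu>: "sets \<mu> = sets borel"
  shows "emeasure \<mu> ({y. dist x y < (1/2) ^ m} \<inter> {y. dist x y < (1/2) ^ k}) \<le> ennreal (C * (wt s1 k * wt s2 m))"
proof -
  have "{y. dist x y < (1/2) ^ m} \<inter> {y. dist x y < (1/2) ^ k} \<subseteq> ball x ((1/2) ^ max m k)"
    by (auto simp: max_def)
  then have "emeasure \<mu> ({y. dist x y < (1/2) ^ m} \<inter> {y. dist x y < (1/2) ^ k}) \<le> emeasure \<mu> (ball x ((1/2) ^ max m k))"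
    by (intro emeasure_mono) (auto simp: \<mu>)
  also have "\<dots> \<le> ennreal (C * wt s (max m k))" by (rule ball)
  also have "wt s (max m k) = wt s1 (max m k) * wt s2 (max m k)"
    by (simp add: wt_def s algebra_simps flip: powr_add)
  also have "ennreal (C * (wt s1 (max m k) * wt s2 (max m k))) \<le> ennreal (C * (wt s1 k * wt s2 m))"
  proof -
    have "wt s1 (max m k) \<le> wt s1 k" "wt s2 (max m k) \<le> wt s2 m"
      unfolding wt_def using s by (auto intro!: powr_mono mult_left_mono)
    then show ?thesis using C wt_pos by (intro ennreal_leI mult_left_mono mult_mono) (auto intro: less_imp_le)
  qed
  finally show ?thesis .
qed

lemma powr_wt: "2 powr (b * real k) * wt s k = wt (s - b) k"
  by (simp add: wt_def algebra_simps flip: powr_add)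

lemma wt_0: "wt s 0 = 1"
  by (simp add: wt_def)

lemma suminf_wt:
  assumes "0 < s" shows "(\<Sum>m. ennreal (wt s (m + j))) = ennreal (wt s j / (1 - 2 powr (- s)))"
proof (rule suminf_ennreal_eq)
  have "(\<lambda>m. (2 powr (- s)) ^ j * (2 powr (- s)) ^ m) sums ((2 powr (- s)) ^ j * (1 / (1 - 2 powr (- s))))"
    using two_powr_less_1[OF assms] by (intro sums_mult geometric_sums) simp
  then show "(\<lambda>m. wt s (m + j)) sums (wt s j / (1 - 2 powr (- s)))"
    by (simp add: wt_power power_add mult.commute)
qed (simp add: wt_def)

text \<open>A geometric tail starting at \<open>j\<close>. That it tends to 0 with \<open>j\<close>
  is what makes the variance of the random mass small.\<close>

lemma kern_integral_le:
  fixes \<mu> :: "circle measure"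
  assumes ball: "\<And>x k. emeasure \<mu> (ball x ((1/2) ^ k)) \<le> ennreal (C * wt s k)"
    and C: "0 \<le> C" and b: "b < s" and \<mu>: "sets \<mu> = sets borel"
  shows "(\<integral>\<^sup>+y. kern j b x y \<partial>\<mu>) \<le> ennreal (C * (wt (s - b) j / (1 - 2 powr (- (s - b)))))"
proof -
  note [measurable_cong] = \<mu>
  have "(\<integral>\<^sup>+y. kern j b x y \<partial>\<mu>)
      = (\<Sum>m. \<integral>\<^sup>+y. ennreal (2 powr (b * real (m + j))) * indicator {y. dist x y < (1/2) ^ (m + j)} y \<partial>\<mu>)"
    unfolding kern_def by (rule nn_integral_suminf) measurable
  also have "\<dots> \<le> (\<Sum>m. ennreal C * ennreal (wt (s - b) (m + j)))"
  proof (intro suminf_le)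
    fix m
    have "(\<integral>\<^sup>+y. ennreal (2 powr (b * real (m + j))) * indicator {y. dist x y < (1/2) ^ (m + j)} y \<partial>\<mu>)
        = ennreal (2 powr (b * real (m + j))) * emeasure \<mu> (ball x ((1/2) ^ (m + j)))"
      using \<mu> by (subst nn_integral_cmult_indicator) (auto simp: ball_def)
    also have "\<dots> \<le> ennreal (2 powr (b * real (m + j))) * ennreal (C * wt s (m + j))"
      by (intro mult_left_mono ball) simp
    also have "\<dots> = ennreal C * ennreal (wt (s - b) (m + j))"
      using C wt_pos by (simp add: powr_wt[symmetric] ac_simps less_imp_le flip: ennreal_mult)
    finally show "(\<integral>\<^sup>+y. ennreal (2 powr (b * real (m + j))) * indicator {y. dist x y < (1/2) ^ (m + j)} y \<partial>\<mu>)
        \<le> ennreal C * ennreal (wt (s - b) (m + j))" .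
  qed auto
  also have "\<dots> = ennreal C * ennreal (wt (s - b) j / (1 - 2 powr (- (s - b))))"
    using b by (simp add: suminf_wt)
  also have "\<dots> = ennreal (C * (wt (s - b) j / (1 - 2 powr (- (s - b)))))"
    using C by (rule ennreal_mult'[symmetric])
  finally show ?thesis .
qed

text \<open>One kernel is the energy to be bounded, the other the pair correlation. As s exceeds b +
  t, it splits into s1 > b and s2 > t, and both geometric series converge.\<close>

lemma kern_kern_integral_le:
  fixes \<mu> :: "circle measure"
  assumes ball: "\<And>x k. emeasure \<mu> (ball x ((1/2) ^ k)) \<le> ennreal (C * wt s k)"
    and C: "0 \<le> C" and s: "0 < b" "0 < t" "b < s1" "t < s2" "s = s1 + s2" and \<mu>: "sets \<mu> = sets borel"
  shows "(\<integral>\<^sup>+y. kern 0 t x y * kern 0 b x y \<partial>\<mu>)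
     \<le> ennreal (C * (1 / (1 - 2 powr (- (s1 - b)))) * (1 / (1 - 2 powr (- (s2 - t)))))"
proof -
  note [measurable_cong] = \<mu>
  let ?I = "\<lambda>m y. indicator {y. dist x y < (1/2) ^ m} y :: ennreal"
  have "(\<integral>\<^sup>+y. kern 0 t x y * kern 0 b x y \<partial>\<mu>)
      = (\<integral>\<^sup>+y. (\<Sum>m. \<Sum>k. (ennreal (2 powr (t * real m)) * ?I m y) * (ennreal (2 powr (b * real k)) * ?I k y)) \<partial>\<mu>)"
    unfolding kern_def by simp
  also have "\<dots> = (\<Sum>m. \<Sum>k. \<integral>\<^sup>+y. (ennreal (2 powr (t * real m)) * ?I m y) * (ennreal (2 powr (b * real k)) * ?I k y) \<partial>\<mu>)"
    by (subst nn_integral_suminf, measurable, subst nn_integral_suminf, measurable)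
  also have "\<dots> \<le> (\<Sum>m. \<Sum>k. ennreal C * (ennreal (wt (s2 - t) m) * ennreal (wt (s1 - b) k)))"
  proof (intro suminf_le)
    fix m k
    have "(\<integral>\<^sup>+y. (ennreal (2 powr (t * real m)) * ?I m y) * (ennreal (2 powr (b * real k)) * ?I k y) \<partial>\<mu>)
        = (\<integral>\<^sup>+y. ennreal (2 powr (t * real m) * 2 powr (b * real k)) *
             indicator ({y. dist x y < (1/2) ^ m} \<inter> {y. dist x y < (1/2) ^ k}) y \<partial>\<mu>)"
      by (intro nn_integral_cong) (auto simp: indicator_def ennreal_mult)
    also have "\<dots> = ennreal (2 powr (t * real m) * 2 powr (b * real k)) *
        emeasure \<mu> ({y. dist x y < (1/2) ^ m} \<inter> {y. dist x y < (1/2) ^ k})"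
      by (rule nn_integral_cmult_indicator) measurable
    also have "\<dots> \<le> ennreal (2 powr (t * real m) * 2 powr (b * real k)) * ennreal (C * (wt s1 k * wt s2 m))"
      using s by (intro mult_left_mono emeasure_ball_bounds[OF ball C _ _ _ \<mu>]) auto
    also have "\<dots> = ennreal C * (ennreal (wt (s2 - t) m) * ennreal (wt (s1 - b) k))"
      using C wt_pos by (simp add: powr_wt[symmetric] ac_simps less_imp_le flip: ennreal_mult)
    finally show "(\<integral>\<^sup>+y. (ennreal (2 powr (t * real m)) * ?I m y) * (ennreal (2 powr (b * real k)) * ?I k y) \<partial>\<mu>)
       \<le> ennreal C * (ennreal (wt (s2 - t) m) * ennreal (wt (s1 - b) k))" .
  qed auto
  also have "\<dots> = ennreal C * ((\<Sum>m. ennreal (wt (s2 - t) m)) * (\<Sum>k. ennreal (wt (s1 - b) k)))"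
    by simp
  also have "(\<Sum>m. ennreal (wt (s2 - t) m)) = ennreal (1 / (1 - 2 powr (- (s2 - t))))"
    using suminf_wt[of "s2 - t" 0] s by (simp add: wt_0)
  also have "(\<Sum>k. ennreal (wt (s1 - b) k)) = ennreal (1 / (1 - 2 powr (- (s1 - b))))"
    using suminf_wt[of "s1 - b" 0] s by (simp add: wt_0)
  also have "ennreal C * (ennreal (1 / (1 - 2 powr (- (s2 - t)))) * ennreal (1 / (1 - 2 powr (- (s1 - b)))))
      = ennreal (C * (1 / (1 - 2 powr (- (s1 - b)))) * (1 / (1 - 2 powr (- (s2 - t)))))"
  proof -
    have "0 \<le> 1 / (1 - 2 powr (- (s2 - t)))" "0 \<le> 1 / (1 - 2 powr (- (s1 - b)))"
      using two_powr_less_1[of "s2 - t"] two_powr_less_1[of "s1 - b"] s by simp_all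
    moreover have "ennreal c * (ennreal u * ennreal v) = ennreal (c * v * u)"
      if "0 \<le> c" "0 \<le> u" "0 \<le> v" for c u v :: real
      using that by (simp add: ennreal_mult ac_simps)
    ultimately show ?thesis using C by blast
  qed
  finally show ?thesis .
qed

lemma kern_mono: "kern j b x y \<le> kern 0 b x y"
proof -
  define u where "u m = ennreal (2 powr (b * real m)) * indicator {y. dist x y < (1/2) ^ m} y" for m
  have "(\<Sum>m. u (m + j)) \<le> (\<Sum>m. u (m + j)) + (\<Sum>m<j. u m)" by simp
  also have "\<dots> = (\<Sum>m. u m)" using suminf_offset[of u j] by (simp add: add.commute)
  finally show ?thesis unfolding kern_def u_def by simp
qed

section \<open>The second moment method\<close>

context iid_uniform begin

text \<open>Give the uncovered points the density 1 / q with respect to \<open>\<mu>\<close>, where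
  q is the probability that a fixed point is uncovered. The total mass has mean 1 and variance at
  most \<open>\<tau>\<close>, so Chebyshev bounds the probability of mass below 1/2 by
  \<open>4 * \<tau>\<close>; Markov bounds that of energy at least \<open>Mb\<close>. Neither bound
  depends on \<open>n\<close>, and the event is fixed before the cover \<open>U\<close>, so it
  serves all covers.\<close>

lemma good_event:
  fixes \<mu> :: "circle measure"
  assumes \<mu>: "prob_space \<mu>" "sets \<mu> = sets borel"
    and ball: "\<And>x k. emeasure \<mu> (ball x ((1/2) ^ k)) \<le> ennreal (C * wt s k)"
    and K: "closed K" "emeasure \<mu> (- K) = 0"
    and C: "0 \<le> C" and s: "0 < b" "0 < t" "b < s1" "t < s2" "s = s1 + s2"
    and lam: "\<And>k. 0 < lam k \<and> lam k < 1 \<and> lam k \<le> (1/2) ^ j"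
    and prod_le: "\<And>n d. 0 < d \<Longrightarrow> (\<Prod>k\<in>{k\<in>{1..n}. d < lam k}. 1 / (1 - lam k)) \<le> max 1 (d powr (- b))"
    and Mb: "0 < Mb"
  defines "\<tau> \<equiv> 2 powr b * (C * (wt (s - b) j / (1 - 2 powr (- (s - b)))))"
    and "\<Lambda> \<equiv> C * (1 / (1 - 2 powr (- (s - t)))) +
       2 powr b * (C * (1 / (1 - 2 powr (- (s1 - b)))) * (1 / (1 - 2 powr (- (s2 - t)))))"
  shows "\<exists>A\<in>sets M. prob A \<le> 4 * \<tau> + \<Lambda> / Mb \<and>
    (\<forall>w\<in>space M - A. \<forall>U::nat \<Rightarrow> circle set. K \<inter> uncov lam n w \<subseteq> (\<Union>i. U i) \<longrightarrow>
       ennreal (1 / (16 * Mb * 2 powr t)) \<le> (\<Sum>i. ennreal (diameter (U i) powr t)))"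
proof -
  interpret \<mu>: prob_space \<mu> by fact
  interpret P: pair_sigma_finite M \<mu> by unfold_locales
  note [measurable_cong] = \<mu>(2)
  have space_\<mu>: "space \<mu> = UNIV" using sets_eq_imp_space_eq[OF \<mu>(2)] by simp
  have \<tau>0: "0 \<le> \<tau>" unfolding \<tau>_def
    using C wt_pos[of "s - b" j] two_powr_less_1[of "s - b"] s
    by (intro mult_nonneg_nonneg divide_nonneg_nonneg) auto
  have \<Lambda>0: "0 \<le> \<Lambda>" unfolding \<Lambda>_def
    using C two_powr_less_1[of "s - t"] two_powr_less_1[of "s1 - b"] two_powr_less_1[of "s2 - t"] s
    by (intro add_nonneg_nonneg mult_nonneg_nonneg divide_nonneg_nonneg) auto
  define q where "q = (\<Prod>k\<in>{1..n}. 1 - lam k)"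
  have q: "0 < q" unfolding q_def using lam by (intro prod_pos) auto
  define f where "f w x = (if x \<in> uncov lam n w then ennreal (1 / q) else 0)" for w x
  have f_meas[measurable]: "(\<lambda>(w, x). f w x) \<in> borel_measurable (M \<Otimes>\<^sub>M borel)"
    unfolding f_def by measurable
  \<comment> \<open>The bound for the pair correlation of the density: 1 as for independent points,
    plus the excess from pairs that one arc may affect together.\<close>
  define H where "H x y = 1 + ennreal (2 powr b) * kern j b x y" for x y
  have H_meas[measurable]: "(\<lambda>(x, y). H x y) \<in> borel_measurable (borel \<Otimes>\<^sub>M borel)"
    unfolding H_def by measurable
  have mean: "(\<integral>\<^sup>+w. f w x \<partial>M) = 1" for x
  proof -
    have "(\<integral>\<^sup>+w. f w x \<partial>M) = (\<integral>\<^sup>+w. ennreal (1 / q) * indicator {w\<in>space M. x \<in> uncov lam n w} w \<partial>M)"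
      by (intro nn_integral_cong) (auto simp: f_def indicator_def)
    also have "\<dots> = ennreal (1 / q) * ennreal (prob {w\<in>space M. x \<in> uncov lam n w})"
      by (subst nn_integral_cmult_indicator) (auto simp: emeasure_eq_measure)
    also have "prob {w\<in>space M. x \<in> uncov lam n w} = q"
      unfolding q_def using lam by (intro prob_uncov) auto
    finally show ?thesis using q by (simp flip: ennreal_mult)
  qed
  have corr: "(\<integral>\<^sup>+w. f w x * f w y \<partial>M) \<le> H x y" for x y
  proof -
    let ?S = "{w\<in>space M. x \<in> uncov lam n w \<and> y \<in> uncov lam n w}"
    let ?p = "\<Prod>k\<in>{k\<in>{1..n}. dist x y < lam k}. 1 / (1 - lam k)"
    have "(\<integral>\<^sup>+w. f w x * f w y \<partial>M) = (\<integral>\<^sup>+w. ennreal (1 / q\<^sup>2) * indicator ?S w \<partial>M)"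
      using q by (intro nn_integral_cong) (auto simp: f_def indicator_def power2_eq_square simp flip: ennreal_mult)
    also have "\<dots> = ennreal (1 / q\<^sup>2) * ennreal (prob ?S)"
      by (subst nn_integral_cmult_indicator) (auto simp: emeasure_eq_measure)
    also have "\<dots> = ennreal (1 / q\<^sup>2 * prob ?S)" by (intro ennreal_mult[symmetric]) auto
    also have "\<dots> \<le> ennreal ?p"
    proof (rule ennreal_leI)
      have "1 / q\<^sup>2 * prob ?S \<le> 1 / q\<^sup>2 * (q\<^sup>2 * ?p)"
        using lam prob_uncov_two[of lam x n y] unfolding q_def by (intro mult_left_mono) auto
      then show "1 / q\<^sup>2 * prob ?S \<le> ?p" using q by simp
    qed
    also have "\<dots> \<le> H x y" unfolding H_def
    proof (rule max_powr_le_kern[OF s(1) prod_le])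
      assume "(1/2) ^ j \<le> dist x y"
      then have "lam k \<le> dist x y" for k using lam[of k] by linarith
      then have "{k\<in>{1..n}. dist x y < lam k} = {}" by (simp add: not_less)
      then show "?p \<le> 1" by (simp only: prod.empty order_refl)
    qed
    finally show ?thesis .
  qed
  \<comment> \<open>Fubini for an arbitrary kernel. It is used with \<open>g = 1\<close> for the
    second moment of the mass and with \<open>kern 0 t\<close> for the mean energy.\<close>
  have second: "(\<integral>\<^sup>+w. \<integral>\<^sup>+x. \<integral>\<^sup>+y. g x y * (f w x * f w y) \<partial>\<mu> \<partial>\<mu> \<partial>M) \<le> (\<integral>\<^sup>+x. \<integral>\<^sup>+y. g x y * H x y \<partial>\<mu> \<partial>\<mu>)"
    if g[measurable]: "(\<lambda>(x, y). g x y) \<in> borel_measurable (borel \<Otimes>\<^sub>M borel)" for g :: "circle \<Rightarrow> circle \<Rightarrow> ennreal"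
  proof -
    have "(\<integral>\<^sup>+w. \<integral>\<^sup>+x. \<integral>\<^sup>+y. g x y * (f w x * f w y) \<partial>\<mu> \<partial>\<mu> \<partial>M)
        = (\<integral>\<^sup>+x. \<integral>\<^sup>+w. \<integral>\<^sup>+y. g x y * (f w x * f w y) \<partial>\<mu> \<partial>M \<partial>\<mu>)"
      by (rule P.Fubini'[symmetric]) measurable
    also have "\<dots> = (\<integral>\<^sup>+x. \<integral>\<^sup>+y. \<integral>\<^sup>+w. g x y * (f w x * f w y) \<partial>M \<partial>\<mu> \<partial>\<mu>)"
      by (intro nn_integral_cong P.Fubini'[symmetric]) measurable
    also have "\<dots> = (\<integral>\<^sup>+x. \<integral>\<^sup>+y. g x y * (\<integral>\<^sup>+w. f w x * f w y \<partial>M) \<partial>\<mu> \<partial>\<mu>)"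
      by (intro nn_integral_cong nn_integral_cmult) measurable
    also have "\<dots> \<le> (\<integral>\<^sup>+x. \<integral>\<^sup>+y. g x y * H x y \<partial>\<mu> \<partial>\<mu>)"
      by (intro nn_integral_mono mult_left_mono corr) auto
    finally show ?thesis .
  qed
  define Z where "Z w = (\<integral>\<^sup>+x. f w x \<partial>\<mu>)" for w
  have Z_meas[measurable]: "Z \<in> borel_measurable M" unfolding Z_def by measurable
  define Y where "Y w = (\<integral>\<^sup>+x. \<integral>\<^sup>+y. kern 0 t x y * (f w x * f w y) \<partial>\<mu> \<partial>\<mu>)" for w
  have Y_meas[measurable]: "Y \<in> borel_measurable M" unfolding Y_def by measurable
  have EZ: "(\<integral>\<^sup>+w. Z w \<partial>M) = 1"
  proof -
    have "(\<integral>\<^sup>+w. Z w \<partial>M) = (\<integral>\<^sup>+x. \<integral>\<^sup>+w. f w x \<partial>M \<partial>\<mu>)"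
      unfolding Z_def by (rule P.Fubini'[symmetric]) measurable
    then show ?thesis by (simp add: mean \<mu>.emeasure_space_1)
  qed
  have EZ2: "(\<integral>\<^sup>+w. Z w * Z w \<partial>M) \<le> ennreal (1 + \<tau>)"
  proof -
    have "(\<integral>\<^sup>+w. Z w * Z w \<partial>M) = (\<integral>\<^sup>+w. \<integral>\<^sup>+x. \<integral>\<^sup>+y. 1 * (f w x * f w y) \<partial>\<mu> \<partial>\<mu> \<partial>M)"
      unfolding Z_def
      by (intro nn_integral_cong) (simp add: nn_integral_cmult nn_integral_multc)
    also have "\<dots> \<le> (\<integral>\<^sup>+x. \<integral>\<^sup>+y. 1 * H x y \<partial>\<mu> \<partial>\<mu>)" by (rule second) measurable
    also have "\<dots> = (\<integral>\<^sup>+x. 1 + ennreal (2 powr b) * (\<integral>\<^sup>+y. kern j b x y \<partial>\<mu>) \<partial>\<mu>)"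
      unfolding H_def by (simp add: nn_integral_add nn_integral_cmult \<mu>.emeasure_space_1)
    also have "\<dots> \<le> (\<integral>\<^sup>+x. 1 + ennreal (2 powr b) * ennreal (C * (wt (s - b) j / (1 - 2 powr (- (s - b))))) \<partial>\<mu>)"
      using s by (intro nn_integral_mono add_left_mono mult_left_mono kern_integral_le[OF ball C _ \<mu>(2)]) auto
    also have "\<dots> = (\<integral>\<^sup>+x. 1 + ennreal \<tau> \<partial>\<mu>)"
      unfolding \<tau>_def ennreal_mult'[OF powr_ge_zero, of 2 b] ..
    also have "\<dots> = ennreal (1 + \<tau>)" using \<tau>0 by (simp add: \<mu>.emeasure_space_1)
    finally show ?thesis .
  qed
  have EY: "(\<integral>\<^sup>+w. Y w \<partial>M) \<le> ennreal \<Lambda>"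
  proof -
    let ?c = "C * (1 / (1 - 2 powr (- (s1 - b)))) * (1 / (1 - 2 powr (- (s2 - t))))"
    have "(\<integral>\<^sup>+w. Y w \<partial>M) \<le> (\<integral>\<^sup>+x. \<integral>\<^sup>+y. kern 0 t x y * H x y \<partial>\<mu> \<partial>\<mu>)"
      unfolding Y_def by (rule second) measurable
    also have "\<dots> \<le> (\<integral>\<^sup>+x. \<integral>\<^sup>+y. kern 0 t x y + ennreal (2 powr b) * (kern 0 t x y * kern 0 b x y) \<partial>\<mu> \<partial>\<mu>)"
    proof (intro nn_integral_mono)
      fix x y
      have "kern 0 t x y * H x y = kern 0 t x y + ennreal (2 powr b) * (kern 0 t x y * kern j b x y)"
        by (simp add: H_def distrib_left mult.left_commute)
      also have "\<dots> \<le> kern 0 t x y + ennreal (2 powr b) * (kern 0 t x y * kern 0 b x y)"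
        by (intro add_left_mono mult_left_mono kern_mono) auto
      finally show "kern 0 t x y * H x y \<le> kern 0 t x y + ennreal (2 powr b) * (kern 0 t x y * kern 0 b x y)" .
    qed
    also have "\<dots> = (\<integral>\<^sup>+x. (\<integral>\<^sup>+y. kern 0 t x y \<partial>\<mu>) + ennreal (2 powr b) * (\<integral>\<^sup>+y. kern 0 t x y * kern 0 b x y \<partial>\<mu>) \<partial>\<mu>)"
      by (simp add: nn_integral_add nn_integral_cmult)
    also have "\<dots> \<le> (\<integral>\<^sup>+x. ennreal (C * (wt (s - t) 0 / (1 - 2 powr (- (s - t))))) + ennreal (2 powr b) * ennreal ?c \<partial>\<mu>)"
      using s by (intro nn_integral_mono add_mono mult_left_mono kern_integral_le[OF ball C _ \<mu>(2)]
          kern_kern_integral_le[OF ball C _ _ _ _ _ \<mu>(2)]) auto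
    also have "\<dots> = ennreal (C * (1 / (1 - 2 powr (- (s - t))))) + ennreal (2 powr b) * ennreal ?c"
      by (simp add: \<mu>.emeasure_space_1 wt_0)
    also have "\<dots> = ennreal \<Lambda>"
    proof -
      have "0 \<le> C * (1 / (1 - 2 powr (- (s - t))))" "0 \<le> ?c"
        using C two_powr_less_1[of "s - t"] two_powr_less_1[of "s1 - b"] two_powr_less_1[of "s2 - t"] s by auto
      then show ?thesis unfolding \<Lambda>_def ennreal_mult'[OF powr_ge_zero, of 2 b, symmetric]
        by (intro ennreal_plus[symmetric] mult_nonneg_nonneg[OF powr_ge_zero])
    qed
    finally show ?thesis .
  qed
  define A1 where "A1 = {w\<in>space M. Z w < ennreal (1/2)}"
  define A2 where "A2 = {w\<in>space M. 1 \<le> ennreal (1 / Mb) * Y w}"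
  have A_meas: "A1 \<in> sets M" "A2 \<in> sets M" unfolding A1_def A2_def by measurable
  have "emeasure M A1 \<le> ennreal (4 * \<tau>)"
  proof -
    \<comment> \<open>The indicator of \<open>z < 1/2\<close> is at most \<open>4 * (z - 1)\<^sup>2\<close>; all terms are moved to avoid subtraction in \<open>ennreal\<close>.\<close>
    have pw: "indicator A1 w + 8 * Z w \<le> 4 * (Z w * Z w) + 4" for w
    proof (cases "Z w")
      case (real z)
      have sq: "8 * z \<le> 4 * (z * z) + 4" using zero_le_power2[of "z - 1"] by (simp add: power2_eq_square algebra_simps)
      have sq2: "1 + 8 * z \<le> 4 * (z * z) + 4" if "z < 1/2"
      proof -
        have "(1/2) * (1/2) \<le> (1 - z) * (1 - z)" using that by (intro mult_mono) auto
        then show ?thesis by (simp add: algebra_simps)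
      qed
      have "indicator A1 w \<le> (if z < 1/2 then 1 else 0 :: ennreal)"
      proof -
        have "z < 1/2" if "w \<in> A1"
          using that real unfolding A1_def mem_Collect_eq by (simp only: ennreal_less_iff)
        then show ?thesis by (auto simp: indicator_def)
      qed
      then have "indicator A1 w + 8 * Z w \<le> (if z < 1/2 then 1 else 0) + 8 * Z w" by (intro add_right_mono)
      also have "\<dots> = ennreal ((if z < 1/2 then 1 else 0) + 8 * z)"
        using real by (simp add: ennreal_plus ennreal_mult)
      also have "\<dots> \<le> ennreal (4 * (z * z) + 4)" using sq sq2 by (intro ennreal_leI) auto
      also have "\<dots> = 4 * (Z w * Z w) + 4" using real by (simp add: ennreal_plus ennreal_mult)
      finally show ?thesis .
    qed (simp add: ennreal_mult_top)
    have "emeasure M A1 + 8 * (\<integral>\<^sup>+w. Z w \<partial>M) = (\<integral>\<^sup>+w. indicator A1 w + 8 * Z w \<partial>M)"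
      using A_meas by (simp add: nn_integral_add nn_integral_cmult)
    also have "\<dots> \<le> (\<integral>\<^sup>+w. 4 * (Z w * Z w) + 4 \<partial>M)" by (intro nn_integral_mono pw)
    also have "\<dots> = 4 * (\<integral>\<^sup>+w. Z w * Z w \<partial>M) + 4"
      by (simp add: nn_integral_add nn_integral_cmult emeasure_space_1)
    also have "\<dots> \<le> 4 * ennreal (1 + \<tau>) + 4" by (intro add_right_mono mult_left_mono EZ2) auto
    also have "\<dots> = 8 + ennreal (4 * \<tau>)"
      using \<tau>0 by (simp add: ennreal_plus ennreal_mult distrib_left)
    finally have "8 + emeasure M A1 \<le> 8 + ennreal (4 * \<tau>)" by (simp add: EZ add.commute)
    then show ?thesis by (subst (asm) ennreal_add_left_cancel_le) auto
  qed
  then have A1: "prob A1 \<le> 4 * \<tau>" using \<tau>0 by (simp add: emeasure_eq_measure)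
  have "emeasure M A2 \<le> ennreal (1 / Mb) * (\<integral>\<^sup>+w. Y w \<partial>M)"
    unfolding A2_def using nn_integral_Markov_inequality[of Y "space M" M "ennreal (1 / Mb)"]
    by (auto cong: nn_integral_cong)
  also have "\<dots> \<le> ennreal (1 / Mb) * ennreal \<Lambda>" by (intro mult_left_mono EY) auto
  also have "\<dots> = ennreal (\<Lambda> / Mb)" using \<Lambda>0 Mb by (simp flip: ennreal_mult)
  finally have A2: "prob A2 \<le> \<Lambda> / Mb" using \<Lambda>0 Mb by (simp add: emeasure_eq_measure)
  have "prob (A1 \<union> A2) \<le> 4 * \<tau> + \<Lambda> / Mb"
    using measure_Un_le[OF A_meas] A1 A2 by linarith
  moreover have "ennreal (1 / (16 * Mb * 2 powr t)) \<le> (\<Sum>i. ennreal (diameter (U i) powr t))"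
    if w: "w \<in> space M - (A1 \<union> A2)" and U: "K \<inter> uncov lam n w \<subseteq> (\<Union>i. U i)" for w and U :: "nat \<Rightarrow> circle set"
  proof -
    have fw[measurable]: "f w \<in> borel_measurable borel"
      unfolding f_def[abs_def] by (intro measurable_If_set) (auto intro: borel_closed closed_uncov)
    define \<nu> where "\<nu> = density \<mu> (f w)"
    have sets_\<nu>: "sets \<nu> = sets borel" by (simp add: \<nu>_def \<mu>)
    have mass: "emeasure \<nu> UNIV = Z w"
      unfolding \<nu>_def Z_def using space_\<mu> by (subst emeasure_density) (auto simp: \<mu>)
    have "Z w \<le> (\<integral>\<^sup>+x. ennreal (1 / q) \<partial>\<mu>)" unfolding Z_def f_def by (intro nn_integral_mono) auto
    then have Z_fin: "Z w < top" by (simp add: \<mu>.emeasure_space_1 le_less_trans)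
    let ?E = "K \<inter> uncov lam n w"
    have E: "closed ?E" using K(1) closed_uncov by blast
    show ?thesis
    proof (rule energy_content_bound[OF _ sets_\<nu> s(2) Mb])
      show "finite_measure \<nu>"
        using Z_fin mass sets_eq_imp_space_eq[OF sets_\<nu>] by (intro finite_measureI) auto
      show "?E \<in> sets borel" using E by simp
      show "emeasure \<nu> (- ?E) = 0"
      proof -
        have "emeasure \<nu> (- ?E) = (\<integral>\<^sup>+x. f w x * indicator (- ?E) x \<partial>\<mu>)"
          unfolding \<nu>_def using borel_comp[OF borel_closed[OF E]] fw
          by (subst emeasure_density) (simp_all add: \<mu> cong: measurable_cong_sets)
        also have "\<dots> \<le> (\<integral>\<^sup>+x. ennreal (1 / q) * indicator (- K) x \<partial>\<mu>)"
          by (intro nn_integral_mono) (auto simp: f_def indicator_def)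
        also have "\<dots> = 0" using K by (subst nn_integral_cmult_indicator) (auto simp: \<mu>)
        finally show ?thesis by simp
      qed
      show "ennreal (1/2) \<le> emeasure \<nu> UNIV" using w by (auto simp: mass A1_def not_less)
      have "ennreal (1 / Mb) * Y w \<le> 1" using w by (auto simp: A2_def not_le intro: less_imp_le)
      then have "ennreal Mb * (ennreal (1 / Mb) * Y w) \<le> ennreal Mb * 1" by (intro mult_left_mono) auto
      moreover have "ennreal Mb * ennreal (1 / Mb) = 1" using Mb by (simp flip: ennreal_mult)
      ultimately have "Y w \<le> ennreal Mb" by (simp flip: mult.assoc)
      moreover have "(\<integral>\<^sup>+x. \<integral>\<^sup>+y. kern 0 t x y \<partial>\<nu> \<partial>\<nu>) = Y w"
        unfolding \<nu>_def Y_def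
        by (simp add: nn_integral_density nn_integral_cmult[symmetric] ac_simps)
      ultimately show "(\<integral>\<^sup>+x. \<integral>\<^sup>+y. kern 0 t x y \<partial>\<nu> \<partial>\<nu>) \<le> ennreal Mb" by simp
    qed (rule U)
  qed
  ultimately show ?thesis using A_meas by (intro bexI[of _ "A1 \<union> A2"]) auto
qed

end

section \<open>Dimension of the uncovered set\<close>

context iid_uniform begin

lemma uncov_antimono: "m \<le> n \<Longrightarrow> uncov lam n w \<subseteq> uncov lam m w"
  unfolding uncov_def by auto

lemma uncovered_outside_uniform_cover:
  fixes N :: "nat \<Rightarrow> nat"
  assumes N: "strict_mono N" and le: "\<And>j k. k \<le> N j \<Longrightarrow> l (N j) \<le> lam k"
  shows "(\<Inter>n. K \<inter> uncov lam n w) \<subseteq> K - uniform_cover l (\<lambda>n. X n w)"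
proof (intro subsetI DiffI notI)
  fix x assume x: "x \<in> (\<Inter>n. K \<inter> uncov lam n w)"
  then show "x \<in> K" by blast
  assume "x \<in> uniform_cover l (\<lambda>n. X n w)"
  then obtain N0 where N0: "\<And>n. n \<ge> N0 \<Longrightarrow> x \<in> arcs_union l (\<lambda>n. X n w) n"
    by (auto simp: uniform_cover_def)
  have "x \<in> arcs_union l (\<lambda>n. X n w) (N N0)"
    using strict_mono_imp_increasing[OF N, of N0] by (rule N0)
  then obtain k where k: "k \<in> {1..N N0}" "dist (X k w) x < l (N N0) / 2"
    by (auto simp: arcs_union_def)
  moreover have "lam k / 2 \<le> dist (X k w) x" using x k by (auto simp: uncov_def)
  ultimately show False using le[of k N0] by auto
qed

text \<open>The event that all but finitely many \<open>A n\<close> occur is an increasing limit of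
  intersections, each no likelier than a single \<open>A n\<close>. Outside it, infinitely many
  \<open>A n\<close> fail.\<close>

lemma prob_eventually_le:
  fixes A :: "nat \<Rightarrow> 'w set"
  assumes A: "\<And>n. A n \<in> sets M" "\<And>n. prob (A n) \<le> e"
  shows "prob (\<Union>m. \<Inter>n. A (m + n)) \<le> e"
proof -
  have "(\<Inter>n. A (m + n)) \<in> sets M" for m
    by (rule sets.countable_INT) (use A(1) in blast, simp)
  then have "range (\<lambda>m. \<Inter>n. A (m + n)) \<subseteq> sets M" by blast
  moreover have "incseq (\<lambda>m. \<Inter>n. A (m + n))"
  proof (rule incseq_SucI)
    fix m show "(\<Inter>n. A (m + n)) \<subseteq> (\<Inter>n. A (Suc m + n))"
    proof
      fix x assume "x \<in> (\<Inter>n. A (m + n))"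
      then have "x \<in> A (m + Suc n)" for n by blast
      then show "x \<in> (\<Inter>n. A (Suc m + n))" by simp
    qed
  qed
  ultimately have "(\<lambda>m. prob (\<Inter>n. A (m + n))) \<longlonglongrightarrow> prob (\<Union>m. \<Inter>n. A (m + n))"
    by (rule finite_Lim_measure_incseq)
  moreover have "prob (\<Inter>n. A (m + n)) \<le> e" for m
  proof -
    have "prob (\<Inter>n. A (m + n)) \<le> prob (A (m + 0))"
      by (rule finite_measure_mono) (blast, rule A(1))
    also have "\<dots> \<le> e" by (rule A(2))
    finally show ?thesis .
  qed
  ultimately show ?thesis by (intro LIMSEQ_le_const2) auto
qed

text \<open>First \<open>j\<close> is fixed to make the variance small, then radii below 2^(-j). The
  exceptional event consists of the outcomes that are bad for all but finitely many n. Any other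
  outcome is good infinitely often, which suffices because the uncovered sets decrease.\<close>

lemma uncovered_dim_with_error:
  fixes \<mu> :: "circle measure"
  assumes l: "\<And>n. 1 \<le> n \<Longrightarrow> 0 < l n \<and> l n < 1"
    and decr: "\<And>m n. 1 \<le> m \<Longrightarrow> m \<le> n \<Longrightarrow> l n \<le> l m"
    and liminf: "liminf (\<lambda>n. ereal (real n * l n / ln (real n))) < ereal a"
    and ab: "0 < a" "a < b" and t: "0 < t" "b + t < s"
    and \<mu>: "prob_space \<mu>" "sets \<mu> = sets borel" and K: "compact K" "emeasure \<mu> (- K) = 0"
    and ball: "\<And>x k. measure \<mu> (ball x ((1/2) ^ k)) \<le> C * wt s k" and C: "0 \<le> C"
    and e: "0 < e"
  shows "\<exists>L\<in>sets M. prob L \<le> e \<and>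
    (\<forall>w\<in>space M - L. ereal t \<le> hausdorff_dim (K - uniform_cover l (\<lambda>n. X n w)))"
proof -
  interpret \<mu>: prob_space \<mu> by fact
  \<comment> \<open>The positive slack s - b - t is shared equally by the correlation exponent and
    the energy exponent.\<close>
  define s1 where "s1 = b + (s - b - t) / 2"
  define s2 where "s2 = t + (s - b - t) / 2"
  have s: "b < s1" "t < s2" "s = s1 + s2" using t by (auto simp: s1_def s2_def field_simps)
  have b: "0 < b" using ab by simp
  define \<tau> where "\<tau> j = 2 powr b * (C * (wt (s - b) j / (1 - 2 powr (- (s - b)))))" for j
  define \<Lambda> where "\<Lambda> = C * (1 / (1 - 2 powr (- (s - t)))) +
       2 powr b * (C * (1 / (1 - 2 powr (- (s1 - b)))) * (1 / (1 - 2 powr (- (s2 - t)))))"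
  \<comment> \<open>Makes the Markov term at most e / 2; the absolute value and the summand 1 ensure
    positivity.\<close>
  define Mb where "Mb = 2 * (\<bar>\<Lambda>\<bar> + 1) / e"
  have Mb: "0 < Mb" using e by (simp add: Mb_def)
  have "\<Lambda> / Mb \<le> (\<bar>\<Lambda>\<bar> + 1) / Mb" using Mb by (intro divide_right_mono) auto
  also have "\<dots> = e / 2" using e by (simp add: Mb_def field_simps)
  finally have \<Lambda>: "\<Lambda> / Mb \<le> e / 2" .
  have "(\<lambda>j. 4 * \<tau> j) \<longlonglongrightarrow> 4 * (2 powr b * (C * (0 / (1 - 2 powr (- (s - b))))))"
    unfolding \<tau>_def using two_powr_less_1[of "s - b"] t
    by (intro tendsto_intros wt_tendsto_0) auto
  then have "(\<lambda>j. 4 * \<tau> j) \<longlonglongrightarrow> 0" by (simp only: mult_zero_right div_0)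
  then have "\<forall>\<^sub>F j in sequentially. 4 * \<tau> j < e / 2" 
    by (rule order_tendstoD(2)) (use e in simp)
  then obtain j where j: "4 * \<tau> j < e / 2" by (auto simp: eventually_sequentially)
  have "0 < (1/2::real) ^ j" by simp
  from block_radii[OF l decr liminf ab this] obtain lam N where N: "strict_mono (N :: nat \<Rightarrow> nat)" "\<And>j. 1 \<le> N j"
    and lam: "\<And>k. 0 < lam k \<and> lam k < 1 \<and> lam k \<le> (1/2) ^ j"
    and le: "\<And>j k. k \<le> N j \<Longrightarrow> l (N j) \<le> lam k"
    and prod_le: "\<And>n d. 0 < d \<Longrightarrow> (\<Prod>k\<in>{k\<in>{1..n}. d < lam k}. 1 / (1 - lam k)) \<le> max 1 (d powr (- b))"
    by blast
  have ball': "emeasure \<mu> (ball x ((1/2) ^ k)) \<le> ennreal (C * wt s k)" for x k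
    unfolding \<mu>.emeasure_eq_measure by (intro ennreal_leI ball)
  let ?c = "ennreal (1 / (16 * Mb * 2 powr t))"
  have "\<forall>n. \<exists>A. A \<in> sets M \<and> prob A \<le> 4 * \<tau> j + \<Lambda> / Mb \<and>
    (\<forall>w\<in>space M - A. \<forall>U::nat \<Rightarrow> circle set. K \<inter> uncov lam n w \<subseteq> (\<Union>i. U i) \<longrightarrow>
       ?c \<le> (\<Sum>i. ennreal (diameter (U i) powr t)))"
    using good_event[OF \<mu> ball' compact_imp_closed[OF K(1)] K(2) C b t(1) s lam prod_le Mb]
    unfolding \<tau>_def \<Lambda>_def Bex_def by blast
  from choice[OF this] obtain A where A: "\<forall>n. A n \<in> sets M \<and> prob (A n) \<le> 4 * \<tau> j + \<Lambda> / Mb \<and>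
    (\<forall>w\<in>space M - A n. \<forall>U::nat \<Rightarrow> circle set. K \<inter> uncov lam n w \<subseteq> (\<Union>i. U i) \<longrightarrow>
       ?c \<le> (\<Sum>i. ennreal (diameter (U i) powr t)))" by blast
  define L where "L = (\<Union>m. \<Inter>n. A (m + n))"
  have "(\<Inter>n. A (m + n)) \<in> sets M" for m
    by (rule sets.countable_INT) (use A in blast, simp)
  then have "L \<in> sets M" unfolding L_def by (intro sets.countable_UN) blast
  moreover have "prob L \<le> e"
    unfolding L_def
  proof (rule prob_eventually_le)
    fix n
    show "A n \<in> sets M" using A by blast
    have "prob (A n) \<le> 4 * \<tau> j + \<Lambda> / Mb" using A by blast
    then show "prob (A n) \<le> e" using \<Lambda> j by linarith
  qed
  moreover have "ereal t \<le> hausdorff_dim (K - uniform_cover l (\<lambda>n. X n w))" if w: "w \<in> space M - L" for w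
  proof -
    have "ereal t \<le> hausdorff_dim (\<Inter>n. K \<inter> uncov lam n w)"
    proof (rule hausdorff_dim_INT_compact[OF t(1)])
      show "0 < ?c" using Mb by simp
      show "compact (K \<inter> uncov lam n w)" for n using K(1) closed_uncov by (rule compact_Int_closed)
      show "decseq (\<lambda>n. K \<inter> uncov lam n w)" unfolding decseq_def using uncov_antimono by blast
      \<comment> \<open>A cover of the set at time \<open>m\<close> covers all later ones, so a
        single good time from \<open>m\<close> on is enough.\<close>
      fix m and U :: "nat \<Rightarrow> circle set" assume U: "K \<inter> uncov lam m w \<subseteq> (\<Union>i. U i)"
      obtain i where "w \<in> space M - A (m + i)" using w unfolding L_def by blast
      then obtain n where n: "m \<le> n" "w \<in> space M - A n" using le_add1 by blast
      have "K \<inter> uncov lam n w \<subseteq> (\<Union>i. U i)" using uncov_antimono[OF n(1)] U by blast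
      then show "?c \<le> (\<Sum>i. ennreal (diameter (U i) powr t))" using A n(2) by blast
    qed
    also have "\<dots> \<le> hausdorff_dim (K - uniform_cover l (\<lambda>n. X n w))"
      by (rule hausdorff_dim_mono, rule uncovered_outside_uniform_cover) (use N le in auto)
    finally show ?thesis .
  qed
  ultimately show ?thesis by blast
qed

text \<open>The set where \<open>P\<close> fails need not be measurable. It is contained in the
  intersection of countably many measurable exceptional sets, which is a null set.\<close>

lemma AE_if_small_exceptional_sets:
  assumes "\<And>e::real. 0 < e \<Longrightarrow> \<exists>L\<in>sets M. prob L \<le> e \<and> (\<forall>w\<in>space M - L. P w)"
  shows "AE w in M. P w"
proof -
  have "\<forall>i::nat. \<exists>L. L \<in> sets M \<and> prob L \<le> inverse (Suc i) \<and> (\<forall>w\<in>space M - L. P w)"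
  proof
    fix i :: nat
    have "0 < inverse (real (Suc i))" by simp
    from assms[OF this] show "\<exists>L. L \<in> sets M \<and> prob L \<le> inverse (Suc i) \<and> (\<forall>w\<in>space M - L. P w)" by blast
  qed
  from choice[OF this] obtain L where L: "\<forall>i. L i \<in> sets M \<and> prob (L i) \<le> inverse (Suc i) \<and> (\<forall>w\<in>space M - L i. P w)"
    by blast
  have meas: "(\<Inter>i. L i) \<in> sets M" using L by (intro sets.countable_INT) auto
  have "prob (\<Inter>i. L i) \<le> inverse (real (Suc i))" for i
  proof -
    have "prob (\<Inter>i. L i) \<le> prob (L i)" by (rule finite_measure_mono) (use L in auto)
    then show ?thesis using L by (meson order_trans)
  qed
  then have "prob (\<Inter>i. L i) \<le> 0"
    by (intro LIMSEQ_le_const[OF LIMSEQ_inverse_real_of_nat]) auto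
  then have "prob (\<Inter>i. L i) = 0" by (rule antisym) simp
  then have "(\<Inter>i. L i) \<in> null_sets M"
    using meas by (intro null_setsI) (auto simp: emeasure_eq_measure)
  moreover have "{w\<in>space M. \<not> P w} \<subseteq> (\<Inter>i. L i)" using L by blast
  ultimately show ?thesis by (intro AE_I[of _ _ "\<Inter>i. L i"]) auto
qed

end

section \<open>From fixed exponents to the dimension of the uncovered set\<close>

lemma hausdorff_dim_nonneg: "0 \<le> hausdorff_dim A"
  unfolding hausdorff_dim_def by (intro INF_greatest) auto

lemma hausdorff_dim_empty: "hausdorff_dim ({} :: 'a::metric_space set) = 0"
proof (rule antisym)
  have "hausdorff_content s \<rho> ({} :: 'a set) \<le> 0" if "0 < \<rho>" for s \<rho>
    unfolding hausdorff_content_def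
    using that by (intro INF_lower2[of "\<lambda>i. {}"]) auto
  then have "hausdorff_measure s ({} :: 'a set) \<le> 0" for s
    unfolding hausdorff_measure_def by (intro SUP_least) auto
  then have "hausdorff_measure s ({} :: 'a set) = 0" for s by simp
  then have le: "hausdorff_dim ({} :: 'a set) \<le> ereal s" if "0 < s" for s
    unfolding hausdorff_dim_def using that by (intro INF_lower) simp
  show "hausdorff_dim ({} :: 'a set) \<le> 0"
  proof (rule ccontr)
    assume "\<not> hausdorff_dim ({} :: 'a set) \<le> 0"
    then obtain s where "0 < ereal s" "ereal s < hausdorff_dim ({} :: 'a set)"
      using ereal_dense2[of 0 "hausdorff_dim ({} :: 'a set)"] by (auto simp: not_le)
    then show False using le[of s] by simp
  qed
qed (rule hausdorff_dim_nonneg)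

lemma liminf_ratio_nonneg:
  assumes "\<And>n. 1 \<le> n \<Longrightarrow> 0 < l n"
  shows "0 \<le> liminf (\<lambda>n. ereal (real n * l n / ln (real n)))"
proof (rule Liminf_bounded)
  have "0 \<le> ereal (real n * l n / ln (real n))" if "1 \<le> n" for n
    using assms[OF that] that by (auto intro!: divide_nonneg_nonneg mult_nonneg_nonneg)
  then show "\<forall>\<^sub>F n in sequentially. 0 \<le> ereal (real n * l n / ln (real n))"
    by (auto simp: eventually_sequentially)
qed

context iid_uniform begin

lemma uncovered_dim_ge:
  assumes l: "\<And>n. 1 \<le> n \<Longrightarrow> 0 < l n \<and> l n < 1"
    and decr: "\<And>m n. 1 \<le> m \<Longrightarrow> m \<le> n \<Longrightarrow> l n \<le> l m"
    and \<delta>: "ereal \<delta> = liminf (\<lambda>n. ereal (real n * l n / ln (real n)))"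
    and A: "analytic_set A" and t: "0 < t" "ereal (t + \<delta>) < hausdorff_dim A"
  shows "AE w in M. ereal t \<le> hausdorff_dim (A - uniform_cover l (\<lambda>n. X n w))"
proof -
  have \<delta>0: "0 \<le> \<delta>" using liminf_ratio_nonneg[of l] l \<delta> by (metis ereal_less_eq(5))
  obtain s where s: "t + \<delta> < s" "ereal s < hausdorff_dim A"
    using ereal_dense2[OF t(2)] by auto
  \<comment> \<open>\<open>a\<close> and \<open>b\<close> divide the interval from
    \<open>\<delta>\<close> to \<open>s - t\<close> into thirds, so that both
    \<open>\<delta> < a < b\<close> and \<open>b + t < s\<close> hold.\<close>
  define a where "a = \<delta> + (s - t - \<delta>) / 3"
  define b where "b = \<delta> + 2 * (s - t - \<delta>) / 3"
  have ab: "0 < a" "a < b" "b + t < s" "\<delta> < a"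
    using \<delta>0 s by (auto simp: a_def b_def field_simps)
  have liminf: "liminf (\<lambda>n. ereal (real n * l n / ln (real n))) < ereal a"
    using ab \<delta> by (metis less_ereal.simps(1))
  have s0: "0 < s" using t \<delta>0 s by linarith
  have "hausdorff_measure s A \<noteq> 0"
  proof
    assume "hausdorff_measure s A = 0"
    then have "hausdorff_dim A \<le> ereal s" unfolding hausdorff_dim_def using s0 by (intro INF_lower) auto
    then show False using s by simp
  qed
  then have "net_content s A > 0"
    using hausdorff_measure_eq_0_if_net_content[OF s0, of A] by (auto simp: zero_less_iff_neq_zero)
  from analytic_capacitable[OF A this] obtain K where K: "K \<subseteq> A" "compact K" "net_content s K > 0" by blast
  from frostman_compact[OF s0 K(2,3)] obtain \<mu> C where \<mu>: "prob_space \<mu>" "sets \<mu> = sets borel"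
    "emeasure \<mu> (- K) = 0" "0 < C" "\<And>y k. measure \<mu> (ball y ((1/2) ^ k)) \<le> C * wt s k" by blast
  have "AE w in M. ereal t \<le> hausdorff_dim (K - uniform_cover l (\<lambda>n. X n w))"
    using uncovered_dim_with_error[OF l decr liminf ab(1,2) t(1) ab(3) \<mu>(1,2) K(2) \<mu>(3,5)] \<mu>(4)
    by (intro AE_if_small_exceptional_sets) auto
  then show ?thesis
  proof eventually_elim
    case (elim w)
    also have "hausdorff_dim (K - uniform_cover l (\<lambda>n. X n w)) \<le> hausdorff_dim (A - uniform_cover l (\<lambda>n. X n w))"
      using K(1) by (intro hausdorff_dim_mono) auto
    finally show ?case .
  qed
qed

text \<open>The null set for an exponent depends on the exponent. Rational exponents keep the union
  null and come arbitrarily close to \<open>hausdorff_dim A - \<delta>\<close>.\<close>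

theorem uncovered_dim:
  assumes l: "\<And>n. 1 \<le> n \<Longrightarrow> 0 < l n \<and> l n < 1"
    and decr: "\<And>m n. 1 \<le> m \<Longrightarrow> m \<le> n \<Longrightarrow> l n \<le> l m"
    and \<delta>: "\<delta> = liminf (\<lambda>n. ereal (real n * l n / ln (real n)))" "\<delta> < 1"
    and A: "analytic_set A" and dim: "\<delta> < hausdorff_dim A"
  shows "AE w in M. hausdorff_dim (A - uniform_cover l (\<lambda>n. X n w)) \<ge> hausdorff_dim A - \<delta>"
proof -
  have "0 \<le> \<delta>" using liminf_ratio_nonneg[of l] l \<delta>(1) by simp
  then obtain d where d: "\<delta> = ereal d" using \<delta>(2) by (cases \<delta>) auto
  have "AE w in M. \<forall>r::rat. 0 < real_of_rat r \<and> ereal (real_of_rat r + d) < hausdorff_dim A \<longrightarrow>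
      ereal (real_of_rat r) \<le> hausdorff_dim (A - uniform_cover l (\<lambda>n. X n w))"
    unfolding AE_all_countable
  proof
    fix r :: rat
    show "AE w in M. 0 < real_of_rat r \<and> ereal (real_of_rat r + d) < hausdorff_dim A \<longrightarrow>
      ereal (real_of_rat r) \<le> hausdorff_dim (A - uniform_cover l (\<lambda>n. X n w))"
    proof (cases "0 < real_of_rat r \<and> ereal (real_of_rat r + d) < hausdorff_dim A")
      case True
      have "AE w in M. ereal (real_of_rat r) \<le> hausdorff_dim (A - uniform_cover l (\<lambda>n. X n w))"
        using True \<delta>(1) d by (intro uncovered_dim_ge[OF l decr _ A]) auto
      then show ?thesis by eventually_elim simp
    next
      case False
      show ?thesis by (rule AE_I2) (use False in blast)
    qed
  qed
  then show ?thesis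
  proof eventually_elim
    case (elim w)
    show ?case
    proof (rule ccontr)
      assume "\<not> hausdorff_dim A - \<delta> \<le> hausdorff_dim (A - uniform_cover l (\<lambda>n. X n w))"
      then obtain r :: rat where r: "hausdorff_dim (A - uniform_cover l (\<lambda>n. X n w)) < ereal (real_of_rat r)"
          "ereal (real_of_rat r) < hausdorff_dim A - \<delta>"
        using ereal_dense3[of "hausdorff_dim (A - uniform_cover l (\<lambda>n. X n w))" "hausdorff_dim A - \<delta>"] by (auto simp: not_le)
      have "0 < ereal (real_of_rat r)" using hausdorff_dim_nonneg r(1) by (rule le_less_trans)
      moreover have "ereal (real_of_rat r + d) < hausdorff_dim A"
        using r(2) d by (cases "hausdorff_dim A") auto
      ultimately show False using elim r(1) by (auto simp: not_le[symmetric])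
    qed
  qed
qed

corollary not_covered:
  assumes l: "\<And>n. 1 \<le> n \<Longrightarrow> 0 < l n \<and> l n < 1"
    and decr: "\<And>m n. 1 \<le> m \<Longrightarrow> m \<le> n \<Longrightarrow> l n \<le> l m"
    and \<delta>: "\<delta> = liminf (\<lambda>n. ereal (real n * l n / ln (real n)))" "\<delta> < 1"
    and A: "analytic_set A" and dim: "\<delta> < hausdorff_dim A"
  shows "AE w in M. \<not> A \<subseteq> uniform_cover l (\<lambda>n. X n w)"
proof -
  have "AE w in M. hausdorff_dim (A - uniform_cover l (\<lambda>n. X n w)) \<ge> hausdorff_dim A - \<delta>"
    by (rule uncovered_dim) (use assms in auto)
  then show ?thesis
  proof eventually_elim
    case (elim w)
    show ?case
    proof
      assume "A \<subseteq> uniform_cover l (\<lambda>n. X n w)"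
      then have "A - uniform_cover l (\<lambda>n. X n w) = {}" by blast
      then have "hausdorff_dim A - \<delta> \<le> 0" using elim hausdorff_dim_empty by metis
      moreover have "0 < hausdorff_dim A - \<delta>" using dim by (rule ereal_diff_gr0)
      ultimately show False by simp
    qed
  qed
qed

end

section \<open>Almost sure covering\<close>

lemma covering_number_attained:
  assumes "0 < r"
  obtains C where "finite C" "A \<subseteq> (\<Union>c\<in>C. ball c r)" "card C = covering_number A r"
proof -
  have "(UNIV :: circle set) \<subseteq> (\<Union>c\<in>UNIV. ball c r)" using assms by auto
  then obtain C where "finite C" "(UNIV :: circle set) \<subseteq> (\<Union>c\<in>C. ball c r)"
    using compactE_image[OF compact_UNIV_circle, of UNIV "\<lambda>c. ball c r"] by (metis open_ball)
  then have "{card C | C. finite C \<and> A \<subseteq> (\<Union>c\<in>C. ball c r)} \<noteq> {}" by blast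
  from Inf_nat_def1[OF this] show ?thesis using that unfolding covering_number_def by auto
qed

lemma covering_number_le:
  assumes "finite C" "A \<subseteq> (\<Union>c\<in>C. ball c r)" shows "covering_number A r \<le> card C"
  unfolding covering_number_def using assms by (intro cInf_lower) auto

lemma covering_number_antimono:
  assumes "0 < r" "r \<le> r'" shows "covering_number A r' \<le> covering_number A r"
proof -
  obtain C where C: "finite C" "A \<subseteq> (\<Union>c\<in>C. ball c r)" "card C = covering_number A r"
    using covering_number_attained[OF assms(1)] .
  have "A \<subseteq> (\<Union>c\<in>C. ball c r')" using order_trans[OF C(2) UN_mono[OF subset_refl subset_ball[OF assms(2)]]] .
  then show ?thesis using covering_number_le[OF C(1)] C(3) by metis
qed

lemma covering_number_pos:
  assumes "0 < r" "A \<noteq> {}" shows "1 \<le> covering_number A r"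
proof -
  obtain C where C: "finite C" "A \<subseteq> (\<Union>c\<in>C. ball c r)" "card C = covering_number A r"
    using covering_number_attained[OF assms(1)] .
  then have "C \<noteq> {}" using assms by auto
  then show ?thesis using C by (metis One_nat_def Suc_leI card_gt_0_iff)
qed

text \<open>Brings both alternatives to one form. A box dimension bound gives a power bound only
  after an arbitrarily small increase of the exponent.\<close>

lemma covering_number_bound:
  assumes A: "upper_box_dim A \<le> ereal \<beta> \<or>
      (\<forall>\<^sub>F r in at_right 0. real (covering_number A r) \<le> r powr (- \<beta>))"
    and e: "0 < e"
  shows "\<forall>\<^sub>F r in at_right 0. real (covering_number A r) \<le> r powr (- (\<beta> + e))"
proof -
  have small: "\<forall>\<^sub>F r in at_right (0::real). 0 < r \<and> r < 1"
    by (intro eventually_at_rightI[of 0 1]) auto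
  from A show ?thesis
  proof
    assume "upper_box_dim A \<le> ereal \<beta>"
    also have "ereal \<beta> < ereal (\<beta> + e)" using e by simp
    finally have "\<forall>\<^sub>F r in at_right 0. ereal (ln (real (covering_number A r)) / ln (1 / r)) < ereal (\<beta> + e)"
      unfolding upper_box_dim_def by (rule Limsup_lessD)
    then show ?thesis using small
    proof eventually_elim
      case (elim r)
      have ln: "0 < ln (1 / r)" using elim by simp
      have "ln (real (covering_number A r)) < (\<beta> + e) * ln (1 / r)"
        using elim(1) ln by (simp add: divide_less_eq)
      then have *: "ln (real (covering_number A r)) \<le> - ((\<beta> + e) * ln r)"
        using elim by (simp add: ln_div)
      show ?case
      \<comment> \<open>As \<open>ln 0 = 0\<close>, the logarithm does not determine a covering
        number 0.\<close>
      proof (cases "covering_number A r = 0")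
        case False
        then have "real (covering_number A r) = exp (ln (real (covering_number A r)))" by simp
        also have "\<dots> \<le> exp (- ((\<beta> + e) * ln r))" using * by (simp only: exp_le_cancel_iff)
        also have "\<dots> = r powr (- (\<beta> + e))" using elim by (simp add: powr_def algebra_simps)
        finally show ?thesis .
      qed simp
    qed
  next
    assume "\<forall>\<^sub>F r in at_right 0. real (covering_number A r) \<le> r powr (- \<beta>)"
    then show ?thesis using small
    proof eventually_elim
      case (elim r)
      then have "r powr (- \<beta>) \<le> r powr (- (\<beta> + e))" using e by (intro powr_mono') auto
      then show ?case using elim by simp
    qed
  qed
qed

text \<open>A nonempty set needs at least one ball at every scale, so the power bounding this number
  cannot decay. The sign is needed for \<open>(1 / l n) powr \<beta>\<close> to be at least
  1.\<close>

lemma exponent_nonneg: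
  assumes A: "\<And>e. 0 < e \<Longrightarrow> \<forall>\<^sub>F r in at_right 0. real (covering_number A r) \<le> r powr (- (\<beta> + e))"
    and ne: "A \<noteq> {}"
  shows "0 \<le> \<beta>"
proof (rule field_le_epsilon)
  fix e :: real assume e: "0 < e"
  have "\<forall>\<^sub>F r in at_right (0::real). 0 < r \<and> r < 1"
    by (intro eventually_at_rightI[of 0 1]) auto
  then have "\<forall>\<^sub>F r in at_right 0. (0 < r \<and> r < 1) \<and> real (covering_number A r) \<le> r powr (- (\<beta> + e))"
    using A[OF e] by (rule eventually_conj)
  then obtain r where r: "0 < r" "r < 1" "real (covering_number A r) \<le> r powr (- (\<beta> + e))"
    using eventually_happens[of _ "at_right (0::real)"] by auto
  have "1 \<le> r powr (- (\<beta> + e))" using covering_number_pos[OF r(1) ne] r(3) by linarith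
  show "0 \<le> \<beta> + e"
  proof (rule ccontr)
    assume "\<not> 0 \<le> \<beta> + e"
    then have "r powr (- (\<beta> + e)) < r powr 0" using r by (intro powr_less_mono') auto
    then show False using \<open>1 \<le> r powr (- (\<beta> + e))\<close> r by simp
  qed
qed

text \<open>Extends the bound from small scales to all of (0,1), since \<open>l\<close> is not
  assumed to tend to 0. Scales that are not small are compared with the fixed scale
  \<open>r0 / 2\<close> by monotonicity.\<close>

lemma covering_number_scaled_bound:
  assumes A: "\<forall>\<^sub>F r in at_right 0. real (covering_number A r) \<le> r powr (- g)"
    and g: "0 \<le> g" and c: "0 < c"
  shows "\<exists>C>0. \<forall>x. 0 < x \<and> x < 1 \<longrightarrow> real (covering_number A (c * x)) \<le> C * (1 / x) powr g"
proof -
  obtain r0 where r0: "0 < r0" "\<And>r. 0 < r \<Longrightarrow> r < r0 \<Longrightarrow> real (covering_number A r) \<le> r powr (- g)"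
    using A unfolding eventually_at_right_field by auto
  define C where "C = max (c powr (- g)) (real (covering_number A (r0 / 2)))"
  have "real (covering_number A (c * x)) \<le> C * (1 / x) powr g" if x: "0 < x" "x < 1" for x
  proof (cases "c * x < r0")
    case True
    then have "real (covering_number A (c * x)) \<le> (c * x) powr (- g)" using r0 x c by simp
    also have "\<dots> = c powr (- g) * (1 / x) powr g" using x c by (simp add: powr_mult powr_divide powr_minus_divide)
    also have "\<dots> \<le> C * (1 / x) powr g" unfolding C_def by (intro mult_right_mono) auto
    finally show ?thesis .
  next
    case False
    then have "covering_number A (c * x) \<le> covering_number A (r0 / 2)"
      using r0 by (intro covering_number_antimono) auto
    then have "real (covering_number A (c * x)) \<le> C" unfolding C_def by simp
    also have "\<dots> \<le> C * (1 / x) powr g"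
    proof -
      have "1 \<le> (1 / x) powr g" using x g by (intro ge_one_powr_ge_zero) auto
      moreover have "0 \<le> C" unfolding C_def by simp
      ultimately show ?thesis using mult_left_mono by fastforce
    qed
    finally show ?thesis .
  qed
  moreover have "0 < C" unfolding C_def using c by (simp add: less_max_iff_disj)
  ultimately show ?thesis by blast
qed

text \<open>
  Comparing the block \<open>{n..<2 * n}\<close> of a convergent series with its smallest term: monotonicity
  of \<open>l\<close> turns summability into a lower bound of order \<open>ln n\<close> for \<open>n * l n\<close>.
\<close>

lemma exp_decay_of_summable:
  fixes l :: "nat \<Rightarrow> real"
  assumes l: "\<And>n. 1 \<le> n \<Longrightarrow> 0 < l n"
    and decr: "\<And>m n. 1 \<le> m \<Longrightarrow> m \<le> n \<Longrightarrow> l n \<le> l m" and d: "0 < d"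
    and u: "\<And>n. exp (- (real (Suc n) * d * l (Suc n))) \<le> u n" and sum: "summable u" and n: "1 \<le> n"
  shows "real n * exp (- (2 * d * (real n * l n))) \<le> suminf u"
proof -
  \<comment> \<open>The block of n terms starts at \<open>n - 1\<close> because \<open>u m\<close>
    belongs to the index \<open>Suc m\<close>.\<close>
  have "real n * exp (- (2 * d * (real n * l n))) = (\<Sum>m\<in>{n - 1..<2 * n - 1}. exp (- (2 * d * (real n * l n))))"
    using n by simp
  also have "\<dots> \<le> (\<Sum>m\<in>{n - 1..<2 * n - 1}. u m)"
  proof (intro sum_mono)
    fix m assume m: "m \<in> {n - 1..<2 * n - 1}"
    then have m': "n \<le> Suc m" "Suc m \<le> 2 * n" by auto
    have "real (Suc m) * l (Suc m) \<le> (2 * real n) * l n"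
      using m' l[of "Suc m"] n decr[of n "Suc m"] by (intro mult_mono) auto
    then have "d * (real (Suc m) * l (Suc m)) \<le> d * ((2 * real n) * l n)" using d by (intro mult_left_mono) auto
    then have "exp (- (2 * d * (real n * l n))) \<le> exp (- (real (Suc m) * d * l (Suc m)))"
      by (simp add: algebra_simps)
    also have "\<dots> \<le> u m" by (rule u)
    finally show "exp (- (2 * d * (real n * l n))) \<le> u m" .
  qed
  also have "\<dots> \<le> suminf u"
    using sum order_trans[OF exp_ge_zero u] by (intro sum_le_suminf) auto
  finally show ?thesis .
qed

section \<open>Covering by a fixed number of centres, and Borel-Cantelli\<close>

context iid_uniform begin

lemma prob_all_outside:
  assumes "0 \<le> r" "r \<le> 1"
  shows "prob {w\<in>space M. \<forall>k\<in>{1..n}. X k w \<in> - ball c (r / 2)} = (1 - r) ^ n"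
proof -
  have "prob {w\<in>space M. \<forall>k\<in>{1..n}. X k w \<in> - ball c (r / 2)}
      = (\<Prod>k\<in>{1..n}. measure circle_uniform (- ball c (r / 2)))"
    by (rule prob_all_in) auto
  then show ?thesis using assms by (simp add: circle_uniform_not_ball)
qed

text \<open>The radius l n / 2 is divided: d * l n / 2 for the distance from a net point to some
  \<open>X k\<close>, the rest for the distance from a point of \<open>A\<close> to the net. A given
  net point fails with probability (1 - d * l n)^n, and the union bound multiplies by the size of
  the net.\<close>

lemma prob_not_covered_le:
  assumes l: "0 < l n" "l n < 1" and d: "0 < d" "d < 1"
  shows "\<exists>F\<in>sets M. prob F \<le> real (covering_number A ((1 - d) / 2 * l n)) * exp (- (real n * d * l n)) \<and>
     (\<forall>w\<in>space M - F. A \<subseteq> arcs_union l (\<lambda>k. X k w) n)"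
proof -
  have "0 < (1 - d) / 2 * l n" using l d by simp
  from covering_number_attained[OF this] obtain C where C: "finite C" "A \<subseteq> (\<Union>c\<in>C. ball c ((1 - d) / 2 * l n))"
    "card C = covering_number A ((1 - d) / 2 * l n)" .
  define F where "F c = {w\<in>space M. \<forall>k\<in>{1..n}. X k w \<in> - ball c (d * l n / 2)}" for c
  have F: "F c \<in> sets M" for c
  proof -
    have "F c = {w\<in>space M. \<forall>k<n. X (Suc k) w \<in> - ball c (d * l n / 2)}"
      unfolding F_def image_Suc_lessThan[symmetric] by auto
    also have "\<dots> \<in> sets M" by measurable
    finally show ?thesis .
  qed
  have dl: "0 \<le> d * l n" "d * l n \<le> 1" using l d by (auto intro: mult_le_one)
  have "prob (\<Union>c\<in>C. F c) \<le> (\<Sum>c\<in>C. prob (F c))"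
    using F C(1) by (intro finite_measure_subadditive_finite) auto
  also have "\<dots> = real (card C) * (1 - d * l n) ^ n" unfolding F_def prob_all_outside[OF dl] by simp
  also have "\<dots> \<le> real (card C) * exp (- (real n * d * l n))"
  proof (intro mult_left_mono)
    have "(1 - d * l n) ^ n \<le> exp (- (d * l n)) ^ n"
      using dl exp_ge_add_one_self[of "- (d * l n)"] by (intro power_mono) auto
    then show "(1 - d * l n) ^ n \<le> exp (- (real n * d * l n))"
      by (simp add: mult.assoc flip: exp_of_nat_mult)
  qed simp
  finally have "prob (\<Union>c\<in>C. F c) \<le> real (covering_number A ((1 - d) / 2 * l n)) * exp (- (real n * d * l n))"
    by (simp add: C)
  moreover have "A \<subseteq> arcs_union l (\<lambda>k. X k w) n" if w: "w \<in> space M - (\<Union>c\<in>C. F c)" for w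
  proof
    fix x assume "x \<in> A"
    then obtain c where c: "c \<in> C" "dist c x < (1 - d) / 2 * l n" using C(2) by auto
    obtain k where k: "k \<in> {1..n}" "dist c (X k w) < d * l n / 2"
      using w c(1) by (auto simp: F_def)
    have "dist (X k w) x < l n / 2"
      using dist_triangle[of "X k w" x c] c(2) k(2) by (simp add: dist_commute field_simps)
    then show "x \<in> arcs_union l (\<lambda>k. X k w) n" using k(1) by (auto simp: arcs_union_def)
  qed
  ultimately show ?thesis using F C(1) by (intro bexI[of _ "\<Union>c\<in>C. F c"]) auto
qed

text \<open>Raising the decay rate from d to d + \<open>\<kappa>\<close> and the exponent from
  \<open>\<beta>\<close> to \<open>\<beta> + e\<close> multiplies the given summand by (1 / l n)^e *
  exp (- n * \<open>\<kappa>\<close> * l n). This factor is bounded for large n because the given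
  series, with monotone \<open>l\<close>, forces n * l n to grow at least like a multiple of ln
  n.\<close>

theorem covered:
  assumes l: "\<And>n. 1 \<le> n \<Longrightarrow> 0 < l n \<and> l n < 1"
    and decr: "\<And>m n. 1 \<le> m \<Longrightarrow> m \<le> n \<Longrightarrow> l n \<le> l m"
    and A: "upper_box_dim A \<le> ereal \<beta> \<or>
      (\<forall>\<^sub>F r in at_right 0. real (covering_number A r) \<le> r powr (- \<beta>))"
    and d: "0 < d" "d < 1"
    and sum: "summable (\<lambda>n. (1 / l (Suc n)) powr \<beta> * exp (- (real (Suc n) * d * l (Suc n))))"
  shows "AE w in M. A \<subseteq> uniform_cover l (\<lambda>n. X n w)"
proof (cases "A = {}")
  case False
  have \<beta>: "0 \<le> \<beta>" using exponent_nonneg[OF covering_number_bound[OF A] False] .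
  \<comment> \<open>Half the distance from d to 1, so that \<open>d + \<kappa>\<close> is still an
    admissible share of the radius.\<close>
  define \<kappa> where "\<kappa> = (1 - d) / 2"
  \<comment> \<open>Calibrated by \<open>\<kappa> = 2 * d * e\<close>: the e-th power of the bound
    \<open>decay\<close> then contains exactly the surplus exp (- n * \<open>\<kappa>\<close> * l
    n).\<close>
  define e where "e = \<kappa> / (2 * d)"
  have \<kappa>: "0 < \<kappa>" "0 < d + \<kappa>" "d + \<kappa> < 1" using d by (auto simp: \<kappa>_def field_simps)
  have e: "0 < e" "\<kappa> = 2 * d * e" using \<kappa> d by (auto simp: e_def)
  define u where "u n = (1 / l (Suc n)) powr \<beta> * exp (- (real (Suc n) * d * l (Suc n)))" for n
  define S where "S = suminf u"
  have exp_u: "exp (- (real (Suc n) * d * l (Suc n))) \<le> u n" for n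
  proof -
    have "1 \<le> (1 / l (Suc n)) powr \<beta>" using l[of "Suc n"] \<beta> by (intro ge_one_powr_ge_zero) auto
    then show ?thesis unfolding u_def using mult_right_mono[of 1 _ "exp (- (real (Suc n) * d * l (Suc n)))"] by simp
  qed
  have sum_u: "summable u" using sum unfolding u_def .
  have decay: "real n * exp (- (2 * d * (real n * l n))) \<le> S" if "1 \<le> n" for n
    unfolding S_def by (rule exp_decay_of_summable) (use l decr d exp_u sum_u that in auto)
  obtain C where C: "0 < C" "\<And>x. 0 < x \<Longrightarrow> x < 1 \<Longrightarrow>
      real (covering_number A ((1 - (d + \<kappa>)) / 2 * x)) \<le> C * (1 / x) powr (\<beta> + e)"
    using covering_number_scaled_bound[OF covering_number_bound[OF A e(1)], of "(1 - (d + \<kappa>)) / 2"] \<beta> e \<kappa> by auto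
  have "\<forall>n. \<exists>F. F \<in> sets M \<and>
      prob F \<le> real (covering_number A ((1 - (d + \<kappa>)) / 2 * l (Suc n))) * exp (- (real (Suc n) * (d + \<kappa>) * l (Suc n))) \<and>
      (\<forall>w\<in>space M - F. A \<subseteq> arcs_union l (\<lambda>k. X k w) (Suc n))"
  proof
    fix n
    show "\<exists>F. F \<in> sets M \<and>
      prob F \<le> real (covering_number A ((1 - (d + \<kappa>)) / 2 * l (Suc n))) * exp (- (real (Suc n) * (d + \<kappa>) * l (Suc n))) \<and>
      (\<forall>w\<in>space M - F. A \<subseteq> arcs_union l (\<lambda>k. X k w) (Suc n))"
      using prob_not_covered_le[of l "Suc n" "d + \<kappa>" A] l[of "Suc n"] \<kappa> unfolding Bex_def by simp
  qed
  from choice[OF this] obtain F where F: "\<forall>n. F n \<in> sets M \<and>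
      prob (F n) \<le> real (covering_number A ((1 - (d + \<kappa>)) / 2 * l (Suc n))) * exp (- (real (Suc n) * (d + \<kappa>) * l (Suc n))) \<and>
      (\<forall>w\<in>space M - F n. A \<subseteq> arcs_union l (\<lambda>k. X k w) (Suc n))" by blast
  have prob_le: "prob (F n) \<le> (C * S powr e) * u n" if n: "S * exp (2 * d) < real (Suc n)" for n
  proof -
    define x where "x = l (Suc n)"
    define N where "N = real (Suc n)"
    have x: "0 < x" "x < 1" using l[of "Suc n"] by (auto simp: x_def)
    have N: "0 < N" by (simp add: N_def)
    have dec: "N * exp (- (2 * d * (N * x))) \<le> S" using decay[of "Suc n"] by (simp add: N_def x_def)
    \<comment> \<open>Otherwise \<open>dec\<close> would give
      \<open>N \<le> S * exp (2 * d)\<close>, which is excluded for large n. The inequality allows 1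
      / x to be replaced by the factor N that \<open>dec\<close> controls.\<close>
    have "1 \<le> N * x"
    proof (rule ccontr)
      assume "\<not> 1 \<le> N * x"
      then have "2 * d * (N * x) \<le> 2 * d * 1" using d by (intro mult_left_mono) auto
      then have "N * exp (- (2 * d)) \<le> N * exp (- (2 * d * (N * x)))" using N by (intro mult_left_mono) auto
      also note dec
      finally have "N * exp (- (2 * d)) * exp (2 * d) \<le> S * exp (2 * d)" by (intro mult_right_mono) auto
      then have "N \<le> S * exp (2 * d)" by (simp add: mult.assoc flip: exp_add)
      then show False using n by (simp add: N_def)
    qed
    then have "1 / x \<le> N" using x by (simp add: field_simps)
    then have "(1 / x) * exp (- (2 * d * (N * x))) \<le> N * exp (- (2 * d * (N * x)))" by (intro mult_right_mono) auto
    then have "(1 / x) * exp (- (2 * d * (N * x))) \<le> S" using dec by simp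
    then have "((1 / x) * exp (- (2 * d * (N * x)))) powr e \<le> S powr e" using x e by (intro powr_mono2) auto
    also have "((1 / x) * exp (- (2 * d * (N * x)))) powr e = (1 / x) powr e * exp (- (N * \<kappa> * x))"
    proof -
      have "((1 / x) * exp (- (2 * d * (N * x)))) powr e = (1 / x) powr e * exp (- (2 * d * (N * x))) powr e"
        by (rule powr_mult)
      then show ?thesis unfolding exp_powr_real e(2) by (simp add: algebra_simps)
    qed
    finally have gain: "(1 / x) powr e * exp (- (N * \<kappa> * x)) \<le> S powr e" .
    have "prob (F n) \<le> real (covering_number A ((1 - (d + \<kappa>)) / 2 * x)) * exp (- (N * (d + \<kappa>) * x))"
      using F by (simp add: N_def x_def)
    also have "\<dots> \<le> (C * (1 / x) powr (\<beta> + e)) * exp (- (N * (d + \<kappa>) * x))"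
      by (intro mult_right_mono C x) auto
    also have "\<dots> = C * ((1 / x) powr \<beta> * exp (- (N * d * x))) * ((1 / x) powr e * exp (- (N * \<kappa> * x)))"
    proof -
      have "exp (- (N * (d + \<kappa>) * x)) = exp (- (N * d * x)) * exp (- (N * \<kappa> * x))"
        by (simp add: algebra_simps flip: exp_add)
      then show ?thesis by (simp only: powr_add ac_simps)
    qed
    also have "\<dots> \<le> C * ((1 / x) powr \<beta> * exp (- (N * d * x))) * S powr e"
      using C(1) by (intro mult_left_mono gain) auto
    also have "\<dots> = (C * S powr e) * u n" by (simp add: u_def x_def N_def)
    finally show ?thesis .
  qed
  have "summable (\<lambda>n. prob (F n))"
  proof (rule summable_comparison_test_ev)
    obtain n0 where n0: "S * exp (2 * d) < real n0" using reals_Archimedean2 by blast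
    have "norm (prob (F n)) \<le> (C * S powr e) * u n" if "n0 \<le> n" for n
    proof -
      have "S * exp (2 * d) < real (Suc n)" using n0 that by linarith
      from prob_le[OF this] show ?thesis by simp
    qed
    then show "\<forall>\<^sub>F n in sequentially. norm (prob (F n)) \<le> (C * S powr e) * u n"
      unfolding eventually_sequentially by blast
    show "summable (\<lambda>n. (C * S powr e) * u n)" using sum_u by (rule summable_mult)
  qed
  then have "AE w in M. \<forall>\<^sub>F n in sequentially. w \<in> space M - F n"
    using F by (intro borel_cantelli_AE1) (auto simp: emeasure_eq_measure)
  then show ?thesis
  proof eventually_elim
    case (elim w)
    then obtain n0 where n0: "\<And>n. n0 \<le> n \<Longrightarrow> w \<in> space M - F n" unfolding eventually_sequentially by blast
    have "A \<subseteq> arcs_union l (\<lambda>n. X n w) n" if n: "Suc n0 \<le> n" for n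
    proof -
      obtain m where m: "n = Suc m" using n by (cases n) auto
      have "w \<in> space M - F m" using n0[of m] n m by simp
      then show ?thesis using F unfolding m by blast
    qed
    then have "A \<subseteq> (\<Inter>n\<in>{Suc n0..}. arcs_union l (\<lambda>n. X n w) n)" by (intro INT_greatest) simp
    moreover have "Suc n0 \<in> {1..}" by simp
    ultimately show ?case unfolding uniform_cover_def by blast
  qed
qed (simp)

end

section \<open>Conclusion\<close>

text \<open>Probabilities 0 and 1 are expressed by \<open>AE\<close>, which is meaningful even when
  the event that \<open>A\<close> is covered is not measurable.\<close>

theorem theorem0p1:
  fixes M :: "'w measure" and X :: "nat \<Rightarrow> 'w \<Rightarrow> circle"
    and l :: "nat \<Rightarrow> real" and \<delta> :: ereal
  assumes "prob_space M"
    and indep: "prob_space.indep_vars M (\<lambda>_. borel) X {1..}"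
    and unif: "\<And>n. n \<ge> 1 \<Longrightarrow> distr M borel (X n) = circle_uniform"
    and range_l: "\<And>n. n \<ge> 1 \<Longrightarrow> 0 < l n \<and> l n < 1"
    and decr: "\<And>m n. 1 \<le> m \<Longrightarrow> m \<le> n \<Longrightarrow> l n \<le> l m"
    and delta: "\<delta> = liminf (\<lambda>n. ereal (real n * l n / ln (real n)))"
  shows "(\<forall>A :: circle set.
            analytic_set A \<longrightarrow> \<delta> < 1 \<longrightarrow> \<delta> < hausdorff_dim A \<longrightarrow>
              (AE w in M. \<not> A \<subseteq> uniform_cover l (\<lambda>n. X n w)) \<and>
              (AE w in M. hausdorff_dim (A - uniform_cover l (\<lambda>n. X n w)) \<ge> hausdorff_dim A - \<delta>))
       \<and> (\<forall>(A :: circle set) (\<beta> :: real).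
            (upper_box_dim A \<le> ereal \<beta> \<or>
             (\<forall>\<^sub>F r in at_right 0. real (covering_number A r) \<le> r powr (- \<beta>))) \<longrightarrow>
            (\<exists>d\<in>{0<..<1}. summable (\<lambda>n. (1 / l (Suc n)) powr \<beta> * exp (- (real (Suc n) * d * l (Suc n))))) \<longrightarrow>
              (AE w in M. A \<subseteq> uniform_cover l (\<lambda>n. X n w)))"
proof -
  interpret iid_uniform M X
    using assms(1) indep unif by (simp add: iid_uniform_def iid_uniform_axioms_def)
  show ?thesis
  proof (intro conjI allI impI)
    fix A :: "circle set"
    assume A: "analytic_set A" "\<delta> < 1" "\<delta> < hausdorff_dim A"
    show "AE w in M. \<not> A \<subseteq> uniform_cover l (\<lambda>n. X n w)"
      by (rule not_covered) (use range_l decr delta A in auto)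
    show "AE w in M. hausdorff_dim (A - uniform_cover l (\<lambda>n. X n w)) \<ge> hausdorff_dim A - \<delta>"
      by (rule uncovered_dim) (use range_l decr delta A in auto)
  next
    fix A :: "circle set" and \<beta> :: real
    assume A: "upper_box_dim A \<le> ereal \<beta> \<or>
        (\<forall>\<^sub>F r in at_right 0. real (covering_number A r) \<le> r powr (- \<beta>))"
      and "\<exists>d\<in>{0<..<1}. summable (\<lambda>n. (1 / l (Suc n)) powr \<beta> * exp (- (real (Suc n) * d * l (Suc n))))"
    then obtain d where d: "0 < d" "d < 1"
      "summable (\<lambda>n. (1 / l (Suc n)) powr \<beta> * exp (- (real (Suc n) * d * l (Suc n))))" by auto
    show "AE w in M. A \<subseteq> uniform_cover l (\<lambda>n. X n w)"
      by (rule covered[OF _ _ A d]) (use range_l decr in auto)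
  qed
qed

end
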